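(* Let $R$ be an integral domain of characteristic zero with fraction field $L$, let $x=(x_1,\dots,x_m)$, $H\in R[x]^m$ with $\mathcal{J}H$ symmetric, $h\in R[x]$ with $H=\nabla h$, and $r:=\operatorname{rk}\mathcal{J}H$. Let $t,u,v$ be new indeterminates and $y=(y_1,\dots,y_m)$. (i) If $r=0$, then there is an image apex $b\in R^m$ of $H$ over $L$, and $h=g+b_1x_1+\cdots+b_mx_m$ with $g\in R$. Moreover $\{b\}$ is both the Zariski closure of the image of $H:L^m\to L^m$ and the set of image apices of $H$ over $L$, and for every $f\in L[y]$: $f(H)=0\iff f((1-t)H+tb)=0\iff f(b)=0$. (ii) If $r\le1$ and $R$ is a gcd-domain, then there is an image apex $b\in R^m$ of $H$ over $L$ and $h=g(p_1x_1+\cdots+p_mx_m)+b_1x_1+\cdots+b_mx_m$ with $g\in R[t]$, $p\in R^m$, $\operatorname{rk}(p)=r$. Moreover $\{b+\lambda p:\lambda\in L\}$ is both the Zariski closure of the image of $H$ and the set of image apices of $H$ over $L$, and for every $f\in L[y]$: $f(H)=0\iff f(tp+(1-u)H+ub)=0\iff f(tp+b)=0$. (iii) Suppose $b\in R^m$ is an image apex of $H$ over $L$. If $r\le2$ and $R$ is a Bézout domain, then $h=g(p_1x_1+\cdots+p_mx_m,\,q_1x_1+\cdots+q_mx_m)+b_1x_1+\cdots+b_mx_m$ with $g\in R[t,u]$, $p,q\in R^m$ and $\operatorname{rk}(p|q)=r$. Moreover $\{b+\lambda p+\mu q:\lambda,\mu\in L\}$ is both the Zariski closure of the image of $H$ and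 the set of image apices of $H$ over $L$, and for every $f\in L[y]$: $f(H)=0\iff f(tp+uq+(1-v)H+vb)=0\iff f(tp+uq+b)=0$.
   Context: $\mathcal{J}H$ is the Jacobian matrix of $H$ with respect to $x$, rank over $L(x)$; $\nabla h=(\partial h/\partial x_1,\dots,\partial h/\partial x_m)$. For $H\in L[x]^m$, $a\in L^m$ is an image apex of $H$ over $L$ if for every $f\in L[y]$, $f(H)=0$ implies $f((1-t)H+ta)=0$; $p\in L^m$ is a projective image apex of $H$ over $L$ if $p\ne0$ and $f(H)=0$ implies $f(H+tp)=0$ for every $f\in L[y]$. A gcd-domain: any two elements have a gcd; a Bézout domain: every finitely generated ideal is principal. *)

theory Defs
  imports "HOL-Library.Poly_Mapping" "HOL-Computational_Algebra.Fraction_Field"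
    "Jordan_Normal_Form.DL_Rank"
begin

text \<open>Multivariate polynomials over 'a in the variables X_0, X_1, ...;
  a monomial is a finitely supported exponent vector nat =>0 nat.\<close>
type_synonym 'a mpoly = "(nat \<Rightarrow>\<^sub>0 nat) \<Rightarrow>\<^sub>0 'a"

definition mVar :: "nat \<Rightarrow> 'a::comm_ring_1 mpoly" where
  "mVar i = Poly_Mapping.single (Poly_Mapping.single i 1) 1"

definition mConst :: "'a::comm_ring_1 \<Rightarrow> 'a mpoly" where
  "mConst c = Poly_Mapping.single 0 c"

definition polys_in :: "nat \<Rightarrow> 'a::comm_ring_1 mpoly set" where
  "polys_in n = {f. \<forall>a\<in>Poly_Mapping.keys f. Poly_Mapping.keys a \<subseteq> {..<n}}"

definition coeffs_in :: "'a::comm_ring_1 set \<Rightarrow> 'a mpoly set" where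
  "coeffs_in S = {f. \<forall>a\<in>Poly_Mapping.keys f. Poly_Mapping.lookup f a \<in> S}"

definition msubst :: "(nat \<Rightarrow> 'a::comm_ring_1 mpoly) \<Rightarrow> 'a mpoly \<Rightarrow> 'a mpoly" where
  "msubst s f = (\<Sum>a\<in>Poly_Mapping.keys f. mConst (Poly_Mapping.lookup f a) * (\<Prod>i\<in>Poly_Mapping.keys a. s i ^ Poly_Mapping.lookup a i))"

definition meval :: "(nat \<Rightarrow> 'a::comm_ring_1) \<Rightarrow> 'a mpoly \<Rightarrow> 'a" where
  "meval x f = (\<Sum>a\<in>Poly_Mapping.keys f. Poly_Mapping.lookup f a * (\<Prod>i\<in>Poly_Mapping.keys a. x i ^ Poly_Mapping.lookup a i))"

definition mpderiv :: "nat \<Rightarrow> 'a::comm_ring_1 mpoly \<Rightarrow> 'a mpoly" where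
  "mpderiv i f = (\<Sum>a\<in>Poly_Mapping.keys f. Poly_Mapping.single (a - Poly_Mapping.single i 1)
                                 (of_nat (Poly_Mapping.lookup a i) * Poly_Mapping.lookup f a))"

text \<open>points of L^m, represented as functions vanishing from index m on\<close>
definition vecs :: "nat \<Rightarrow> (nat \<Rightarrow> 'a::zero) set" where
  "vecs m = {a. \<forall>i\<ge>m. a i = 0}"

text \<open>image apex of H over L (H_0,...,H_(m-1), t = X_m)\<close>
definition image_apex :: "nat \<Rightarrow> (nat \<Rightarrow> 'a::comm_ring_1 mpoly) \<Rightarrow> (nat \<Rightarrow> 'a) \<Rightarrow> bool" where
  "image_apex m H a \<longleftrightarrow> a \<in> vecs m \<and>
     (\<forall>f\<in>polys_in m. msubst H f = 0 \<longrightarrow>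
        msubst (\<lambda>i. (1 - mVar m) * H i + mVar m * mConst (a i)) f = 0)"

definition poly_map_image :: "nat \<Rightarrow> (nat \<Rightarrow> 'a::comm_ring_1 mpoly) \<Rightarrow> (nat \<Rightarrow> 'a) set" where
  "poly_map_image m H = (\<lambda>x. \<lambda>i. if i < m then meval x (H i) else 0) ` vecs m"

definition zariski_closure :: "nat \<Rightarrow> (nat \<Rightarrow> 'a::comm_ring_1) set \<Rightarrow> (nat \<Rightarrow> 'a) set" where
  "zariski_closure m S = {z \<in> vecs m. \<forall>f\<in>polys_in m.
       (\<forall>s\<in>S. meval s f = 0) \<longrightarrow> meval z f = 0}"

definition jacobian :: "nat \<Rightarrow> (nat \<Rightarrow> 'a::field mpoly) \<Rightarrow> 'a mpoly fract mat" where
  "jacobian m H = mat m m (\<lambda>(i,j). Fract (mpderiv j (H i)) 1)"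

definition subring :: "'a::comm_ring_1 set \<Rightarrow> bool" where
  "subring R \<longleftrightarrow> 0 \<in> R \<and> 1 \<in> R \<and> (\<forall>a\<in>R. \<forall>b\<in>R. a + b \<in> R \<and> a - b \<in> R \<and> a * b \<in> R)"

definition fraction_field_of :: "'a::field set \<Rightarrow> bool" where
  "fraction_field_of R \<longleftrightarrow> subring R \<and> (\<forall>z. \<exists>a\<in>R. \<exists>b\<in>R. b \<noteq> 0 \<and> z = a / b)"

definition rdvd :: "'a::comm_ring_1 set \<Rightarrow> 'a \<Rightarrow> 'a \<Rightarrow> bool" where
  "rdvd R a b \<longleftrightarrow> (\<exists>c\<in>R. b = a * c)"

definition gcd_domain :: "'a::comm_ring_1 set \<Rightarrow> bool" where
  "gcd_domain R \<longleftrightarrow> (\<forall>a\<in>R. \<forall>b\<in>R. \<exists>d\<in>R. rdvd R d a \<and> rdvd R d b \<and>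
      (\<forall>e\<in>R. rdvd R e a \<and> rdvd R e b \<longrightarrow> rdvd R e d))"

definition gen_ideal :: "'a::comm_ring_1 set \<Rightarrow> 'a set \<Rightarrow> 'a set" where
  "gen_ideal R F = {\<Sum>f\<in>F. c f * f | c. \<forall>f\<in>F. c f \<in> R}"

definition bezout_domain :: "'a::comm_ring_1 set \<Rightarrow> bool" where
  "bezout_domain R \<longleftrightarrow> (\<forall>F. finite F \<and> F \<subseteq> R \<longrightarrow> (\<exists>d\<in>R. gen_ideal R F = gen_ideal R {d}))"

definition lin_form :: "nat \<Rightarrow> (nat \<Rightarrow> 'a::comm_ring_1) \<Rightarrow> 'a mpoly" where
  "lin_form m p = (\<Sum>i<m. mConst (p i) * mVar i)"

end

theory Submission
  imports Defs
begin

text \<open>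
  Let K be the field of rational functions in x over L.  The Jacobian of \<open>H = \<nabla>h\<close> is symmetric, so
  its column space over K is the orthogonal complement of its kernel N; the point is that for
  \<open>r = 1\<close>, and for \<open>r = 2\<close> in the presence of an image apex, N is defined over L.  Normalise a kernel
  vector as \<open>\<nu> = \<partial>\<^sub>j - c \<partial>\<^sub>p - e \<partial>\<^sub>q\<close> (with \<open>e = 0\<close> if \<open>r = 1\<close>), where p and q are pivots.  As a derivation of K
  it annihilates its own coefficients, hence is locally nilpotent on polynomials.  On the other hand the
  pivot minor \<open>\<Delta>\<close> of the Hessian of h satisfies \<open>\<nu> \<Delta> = - \<theta> \<Delta>\<close> with \<open>\<theta> = - (\<partial>\<^sub>p c + \<partial>\<^sub>q e)\<close>, and
  \<open>\<nu> \<theta> = - \<theta>\<theta>\<close>; in rank two this uses that an apex b forces \<open>H - b\<close> into the column space, so that the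
  Jacobian of (c, e) in the pivot directions is singular.  Local nilpotency then gives \<open>\<theta> = 0\<close>, and the
  mixed second derivatives of c and e make both of them constant.

  Once N is constant, \<open>H - b\<close> takes values in a fixed plane V over L, h minus its linear part factors
  through linear forms spanning V, and every relation of H is invariant under translation by V, because
  V lies in the column space of the Jacobian.  Integrality of the factorisation comes from a primitive
  vector p and root closedness of R in the gcd case, and from a dual basis over R in the Bezout case.
\<close>

section \<open>Multivariate polynomials\<close>

text \<open>The commutator of the kernel field D with a pivot derivation is a combination of the
  pivot derivations whose coefficients are partials of c and e. As D kills H, applying it to Hessian
  entries shows both that D kills c and e and how it scales the pivot minor. Writing J for the
  Jacobian of (c, e) in the pivot directions, the same commutator gives D(tr J) = tr(J J) = (tr J)^2
  - 2 det J. In rank one J is a scalar and the equation for \<theta> closes by itself; in rank two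
  the determinant is the obstacle, and the apex removes it. A singular J of trace zero is only
  nilpotent, so rank two still needs a separate planar argument. Iterating the Riccati equation
  produces the factor n!, which must not vanish; this is one place where characteristic zero enters.
  Constancy of N yields a factorisation over L only. Over a gcd-domain a section of the linear form
  has denominators, so integrality is read off from restrictions to the coordinate axes. Over a
  Bezout domain the two linear forms have an integral section, and integrality is immediate.\<close>

lemma poly_mapping_single_induct [case_names zero single add]:
  fixes f :: "'k \<Rightarrow>\<^sub>0 'b::comm_monoid_add"
  assumes "P 0" "\<And>a c. P (Poly_Mapping.single a c)" "\<And>f g. P f \<Longrightarrow> P g \<Longrightarrow> P (f + g)"
  shows "P f"
proof (induction f rule: update_induct)
  case const
  show ?case by fact
next
  case (update f a b)
  have "Poly_Mapping.update a b f = f + Poly_Mapping.single a b"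
    using update.hyps
    by (intro poly_mapping_eqI) (auto simp: lookup_update lookup_add lookup_single in_keys_iff when_def)
  then show ?case using assms update by metis
qed

section \<open>Evaluation homomorphisms\<close>

definition monom_eval :: "(nat \<Rightarrow> 'b::comm_ring_1) \<Rightarrow> (nat \<Rightarrow>\<^sub>0 nat) \<Rightarrow> 'b" where
  "monom_eval s a = (\<Prod>i\<in>Poly_Mapping.keys a. s i ^ Poly_Mapping.lookup a i)"

text \<open>The coefficient map is a parameter so that point evaluation, substitution, restriction
  to a line and passage to rational functions are all instances; multiplicativity and the chain rule
  are then proved once.\<close>

definition eval_hom :: "('a::comm_ring_1 \<Rightarrow> 'b::comm_ring_1) \<Rightarrow> (nat \<Rightarrow> 'b) \<Rightarrow> 'a mpoly \<Rightarrow> 'b" where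
  "eval_hom c s f = (\<Sum>a\<in>Poly_Mapping.keys f. c (Poly_Mapping.lookup f a) * monom_eval s a)"

lemma msubst_eq_eval_hom: "msubst s f = eval_hom mConst s f"
  by (simp add: msubst_def eval_hom_def monom_eval_def)

lemma meval_eq_eval_hom: "meval x f = eval_hom (\<lambda>c. c) x f"
  by (simp add: meval_def eval_hom_def monom_eval_def)

lemma monom_eval_superset:
  assumes "finite A" "Poly_Mapping.keys a \<subseteq> A"
  shows "monom_eval s a = (\<Prod>i\<in>A. s i ^ Poly_Mapping.lookup a i)"
  unfolding monom_eval_def
  by (rule prod.mono_neutral_left) (use assms in \<open>auto simp: in_keys_iff\<close>)

lemma monom_eval_zero [simp]: "monom_eval s 0 = 1"
  by (simp add: monom_eval_def)

lemma monom_eval_add: "monom_eval s (a + b) = monom_eval s a * monom_eval s b"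
proof -
  let ?A = "Poly_Mapping.keys a \<union> Poly_Mapping.keys b"
  have "monom_eval s (a + b) = (\<Prod>i\<in>?A. s i ^ Poly_Mapping.lookup (a + b) i)"
    by (rule monom_eval_superset) (auto simp: keys_add)
  also have "\<dots> = (\<Prod>i\<in>?A. s i ^ Poly_Mapping.lookup a i) * (\<Prod>i\<in>?A. s i ^ Poly_Mapping.lookup b i)"
    by (simp add: lookup_add power_add prod.distrib)
  also have "\<dots> = monom_eval s a * monom_eval s b"
    by (simp add: monom_eval_superset[of ?A])
  finally show ?thesis .
qed

lemma monom_eval_single [simp]: "monom_eval s (Poly_Mapping.single i k) = s i ^ k"
  by (cases "k = 0") (auto simp: monom_eval_def)

lemma eval_hom_superset:
  assumes "comm_ring_hom c" "finite A" "Poly_Mapping.keys f \<subseteq> A"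
  shows "eval_hom c s f = (\<Sum>a\<in>A. c (Poly_Mapping.lookup f a) * monom_eval s a)"
proof -
  interpret comm_ring_hom c by fact
  show ?thesis unfolding eval_hom_def
    by (rule sum.mono_neutral_left) (use assms in \<open>auto simp: in_keys_iff\<close>)
qed

lemma eval_hom_single:
  assumes "comm_ring_hom c"
  shows "eval_hom c s (Poly_Mapping.single a k) = c k * monom_eval s a"
  by (subst eval_hom_superset[OF assms, of "{a}"]) auto

lemma eval_hom_zero [simp]: "eval_hom c s 0 = 0"
  by (simp add: eval_hom_def)

lemma eval_hom_add:
  assumes "comm_ring_hom c"
  shows "eval_hom c s (f + g) = eval_hom c s f + eval_hom c s g"
proof -
  interpret comm_ring_hom c by fact
  let ?A = "Poly_Mapping.keys f \<union> Poly_Mapping.keys g"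
  have "eval_hom c s (f + g) = (\<Sum>a\<in>?A. c (Poly_Mapping.lookup (f + g) a) * monom_eval s a)"
    by (rule eval_hom_superset[OF assms]) (auto simp: keys_add)
  also have "\<dots> = (\<Sum>a\<in>?A. c (Poly_Mapping.lookup f a) * monom_eval s a)
      + (\<Sum>a\<in>?A. c (Poly_Mapping.lookup g a) * monom_eval s a)"
    by (simp add: lookup_add hom_add distrib_right sum.distrib)
  also have "\<dots> = eval_hom c s f + eval_hom c s g"
    by (simp add: eval_hom_superset[OF assms, of ?A])
  finally show ?thesis .
qed

lemma eval_hom_mult:
  assumes "comm_ring_hom c"
  shows "eval_hom c s (f * g) = eval_hom c s f * eval_hom c s g"
proof -
  interpret comm_ring_hom c by fact
  show ?thesis
  proof (induction f rule: poly_mapping_single_induct)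
    case zero show ?case by simp
  next
    case (add f1 f2)
    then show ?case by (simp add: distrib_right eval_hom_add[OF assms])
  next
    case (single a k)
    show ?case
    proof (induction g rule: poly_mapping_single_induct)
      case (single b l)
      show ?case by (simp add: mult_single eval_hom_single[OF assms] monom_eval_add hom_mult ac_simps)
    qed (simp_all add: distrib_left eval_hom_add[OF assms])
  qed
qed

lemma eval_hom_mConst: "comm_ring_hom c \<Longrightarrow> eval_hom c s (mConst k) = c k"
  by (simp add: mConst_def eval_hom_single)

lemma eval_hom_mVar:
  assumes "comm_ring_hom c" shows "eval_hom c s (mVar i) = s i"
proof -
  interpret comm_ring_hom c by fact
  show ?thesis by (simp add: mVar_def eval_hom_single[OF assms])
qed

lemma mConst_zero [simp]: "mConst 0 = 0"
  and mConst_one [simp]: "mConst 1 = 1"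
  and mConst_add: "mConst (a + b) = mConst a + mConst b"
  and mConst_mult: "mConst (a * b) = mConst a * mConst b"
  and mConst_diff: "mConst (a - b) = mConst a - mConst b"
  and mConst_uminus: "mConst (- a) = - mConst a"
  by (simp_all add: mConst_def single_add mult_single single_diff single_uminus)

lemma mConst_eq_iff [simp]: "mConst a = mConst b \<longleftrightarrow> a = b"
  by (metis lookup_single_eq mConst_def)

lemma comm_ring_hom_mConst: "comm_ring_hom mConst"
  by unfold_locales (simp_all add: mConst_add mConst_mult)

lemma comm_ring_hom_ident: "comm_ring_hom (\<lambda>c. c)"
  by unfold_locales simp_all

lemma comm_ring_hom_eval_hom:
  assumes "comm_ring_hom c" shows "comm_ring_hom (eval_hom c s)"
proof -
  interpret comm_ring_hom c by fact
  have "eval_hom c s 1 = 1"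
    using eval_hom_mConst[OF assms, of s 1] by simp
  then show ?thesis
    by unfold_locales (simp_all add: eval_hom_add[OF assms] eval_hom_mult[OF assms])
qed

interpretation meval: comm_ring_hom "meval x"
  using comm_ring_hom_eval_hom[OF comm_ring_hom_ident] by (simp add: meval_eq_eval_hom[abs_def])

interpretation msubst: comm_ring_hom "msubst s"
  using comm_ring_hom_eval_hom[OF comm_ring_hom_mConst] by (simp add: msubst_eq_eval_hom[abs_def])

lemma meval_mConst [simp]: "meval x (mConst c) = c"
  and meval_mVar [simp]: "meval x (mVar i) = x i"
  and msubst_mConst [simp]: "msubst s (mConst c) = mConst c"
  and msubst_mVar [simp]: "msubst s (mVar i) = s i"
  by (simp_all add: meval_eq_eval_hom msubst_eq_eval_hom eval_hom_mConst eval_hom_mVar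
      comm_ring_hom_mConst comm_ring_hom_ident)

lemma polys_in_zero: "0 \<in> polys_in n"
  and polys_in_mConst: "mConst c \<in> polys_in n"
  and polys_in_mVar: "i < n \<Longrightarrow> (mVar i :: 'a::comm_ring_1 mpoly) \<in> polys_in n"
  by (auto simp: polys_in_def mConst_def mVar_def split: if_splits)

lemma polys_in_add: "f \<in> polys_in n \<Longrightarrow> g \<in> polys_in n \<Longrightarrow> f + g \<in> polys_in n"
  using keys_add[of f g] by (auto simp: polys_in_def)

lemma polys_in_mult:
  assumes "f \<in> polys_in n" "g \<in> polys_in n" shows "f * g \<in> polys_in n"
proof -
  have "Poly_Mapping.keys a \<subseteq> {..<n}" if a: "a \<in> Poly_Mapping.keys (f * g)" for a
  proof -
    obtain b c where "a = b + c" "b \<in> Poly_Mapping.keys f" "c \<in> Poly_Mapping.keys g"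
      using keys_mult[of f g] a by blast
    then show ?thesis using assms keys_add[of b c] by (fastforce simp: polys_in_def)
  qed
  then show ?thesis by (simp add: polys_in_def)
qed

lemma poly_mapping_sum_single:
  "f = (\<Sum>a\<in>Poly_Mapping.keys f. Poly_Mapping.single a (Poly_Mapping.lookup f a))"
  by (intro poly_mapping_eqI) (auto simp: lookup_sum lookup_single when_def in_keys_iff)

lemma single_eq_monom:
  "Poly_Mapping.single a c = mConst c * monom_eval mVar a"
proof -
  have *: "(mVar i :: 'a mpoly) ^ k = Poly_Mapping.single (Poly_Mapping.single i k) 1" for i k
    by (induction k) (simp_all add: mVar_def mult_single flip: single_add)
  have "(\<Prod>i\<in>A. Poly_Mapping.single (Poly_Mapping.single i (Poly_Mapping.lookup a i)) 1) =
     (Poly_Mapping.single (\<Sum>i\<in>A. Poly_Mapping.single i (Poly_Mapping.lookup a i)) 1 :: 'a mpoly)" if "finite A" for A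
    using that by induction (simp_all add: mult_single)
  moreover have "(\<Sum>i\<in>Poly_Mapping.keys a. Poly_Mapping.single i (Poly_Mapping.lookup a i)) = a"
    by (intro poly_mapping_eqI) (auto simp: lookup_sum lookup_single when_def in_keys_iff)
  ultimately show ?thesis
    by (simp add: monom_eval_def * mConst_def mult_single)
qed

lemma polys_in_induct [consumes 1, case_names const var add mult]:
  assumes "f \<in> polys_in n"
    and const: "\<And>c. P (mConst c)" and var: "\<And>i. i < n \<Longrightarrow> P (mVar i)"
    and add: "\<And>f g. f \<in> polys_in n \<Longrightarrow> g \<in> polys_in n \<Longrightarrow> P f \<Longrightarrow> P g \<Longrightarrow> P (f + g)"
    and mult: "\<And>f g. f \<in> polys_in n \<Longrightarrow> g \<in> polys_in n \<Longrightarrow> P f \<Longrightarrow> P g \<Longrightarrow> P (f * g)"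
  shows "P f"
proof -
  let ?Q = "\<lambda>f. f \<in> polys_in n \<and> P f"
  have one: "?Q 1" using const[of 1] polys_in_mConst[of 1 n] by simp
  have pow: "?Q (mVar i ^ k)" if "i < n" for i k
  proof (induction k)
    case (Suc k) then show ?case using var[OF that] polys_in_mVar[OF that]
      by (auto intro: mult polys_in_mult)
  qed (use one in simp)
  have "?Q (\<Prod>i\<in>A. mVar i ^ Poly_Mapping.lookup a i)" if "finite A" "A \<subseteq> {..<n}" for A a
    using that by induction (use one in simp, use pow in \<open>auto intro: mult polys_in_mult\<close>)
  then have mon: "?Q (Poly_Mapping.single a c)" if "Poly_Mapping.keys a \<subseteq> {..<n}" for a c
    using that const[of c] polys_in_mConst[of c n] by (auto simp: single_eq_monom monom_eval_def intro: mult polys_in_mult)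
  note poly_mapping_sum_single[of f]
  moreover have "?Q (\<Sum>a\<in>A. Poly_Mapping.single a (Poly_Mapping.lookup f a))"
    if "finite A" "A \<subseteq> Poly_Mapping.keys f" for A
    using that
  proof induction
    case empty show ?case using const[of 0] polys_in_zero by simp
  next
    case (insert a A)
    then have "?Q (Poly_Mapping.single a (Poly_Mapping.lookup f a))"
      using assms(1) by (intro mon) (auto simp: polys_in_def)
    then show ?case using insert by (auto intro: add polys_in_add)
  qed
  ultimately show ?thesis by (metis finite_keys order_refl)
qed

lemma polys_in_exists: "\<exists>n. f \<in> polys_in n"
proof -
  have "finite (\<Union>a\<in>Poly_Mapping.keys f. Poly_Mapping.keys a)" by simp
  then obtain n where "\<forall>i\<in>(\<Union>a\<in>Poly_Mapping.keys f. Poly_Mapping.keys a). i < n"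
    using finite_nat_set_iff_bounded by blast
  then show ?thesis by (auto simp: polys_in_def)
qed

lemma polys_in_mono: "f \<in> polys_in n \<Longrightarrow> n \<le> k \<Longrightarrow> f \<in> polys_in k"
  by (fastforce simp: polys_in_def)

lemma mpoly_induct [case_names const var add mult]:
  assumes "\<And>c. P (mConst c)" "\<And>i. P (mVar i)"
    "\<And>f g. P f \<Longrightarrow> P g \<Longrightarrow> P (f + g)" "\<And>f g. P f \<Longrightarrow> P g \<Longrightarrow> P (f * g)"
  shows "P f"
  using polys_in_exists[of f] assms by (blast intro: polys_in_induct)

lemma meval_msubst: "meval x (msubst s f) = meval (\<lambda>i. meval x (s i)) f"
  by (induction f rule: mpoly_induct)
    (simp_all add: meval.hom_add meval.hom_mult msubst.hom_add msubst.hom_mult)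

lemma msubst_msubst: "msubst s (msubst t f) = msubst (\<lambda>i. msubst s (t i)) f"
  by (induction f rule: mpoly_induct)
    (simp_all add: msubst.hom_add msubst.hom_mult)

lemma meval_cong: "f \<in> polys_in n \<Longrightarrow> (\<And>i. i < n \<Longrightarrow> x i = y i) \<Longrightarrow> meval x f = meval y f"
  by (induction f rule: polys_in_induct) (simp_all add: meval.hom_add meval.hom_mult)

lemma msubst_cong: "f \<in> polys_in n \<Longrightarrow> (\<And>i. i < n \<Longrightarrow> s i = t i) \<Longrightarrow> msubst s f = msubst t f"
  by (induction f rule: polys_in_induct) (simp_all add: msubst.hom_add msubst.hom_mult)

lemma msubst_polys_in:
  "f \<in> polys_in n \<Longrightarrow> (\<And>i. i < n \<Longrightarrow> s i \<in> polys_in k) \<Longrightarrow> msubst s f \<in> polys_in k"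
  by (induction f rule: polys_in_induct)
    (simp_all add: msubst.hom_add msubst.hom_mult polys_in_mConst polys_in_add polys_in_mult)

section \<open>Formal partial derivatives\<close>

lemma lookup_mpderiv:
  "Poly_Mapping.lookup (mpderiv i f) a =
    of_nat (Suc (Poly_Mapping.lookup a i)) * Poly_Mapping.lookup f (a + Poly_Mapping.single i 1)"
proof -
  let ?e = "Poly_Mapping.single i (1::nat)"
  \<comment> \<open>Subtraction of exponents truncates. It fails to be invertible only where the
    exponent of i is 0, and there the numerical factor makes both sides vanish.\<close>
  have eq: "(if k - ?e = a then of_nat (Poly_Mapping.lookup k i) * Poly_Mapping.lookup f k else 0) =
    (if k = a + ?e then of_nat (Poly_Mapping.lookup k i) * Poly_Mapping.lookup f k else 0)" for k
  proof (cases "Poly_Mapping.lookup k i = 0")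
    case True
    then have "k \<noteq> a + ?e" by (auto simp: lookup_add)
    then show ?thesis using True by simp
  next
    case False
    then have "k - ?e + ?e = k"
      by (intro poly_mapping_eqI) (auto simp: lookup_add lookup_minus lookup_single when_def)
    then have "k - ?e = a \<longleftrightarrow> k = a + ?e" by auto
    then show ?thesis by simp
  qed
  have "Poly_Mapping.lookup (mpderiv i f) a = (\<Sum>k\<in>Poly_Mapping.keys f.
      if k - ?e = a then of_nat (Poly_Mapping.lookup k i) * Poly_Mapping.lookup f k else 0)"
    by (simp add: mpderiv_def lookup_sum lookup_single when_def)
  also have "\<dots> = (\<Sum>k\<in>Poly_Mapping.keys f.
      if k = a + ?e then of_nat (Poly_Mapping.lookup k i) * Poly_Mapping.lookup f k else 0)"
    by (simp only: eq)
  also have "\<dots> = of_nat (Suc (Poly_Mapping.lookup a i)) * Poly_Mapping.lookup f (a + ?e)"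
    by (auto simp: lookup_add in_keys_iff)
  finally show ?thesis .
qed

lemma mpderiv_zero [simp]: "mpderiv i 0 = 0"
  by (simp add: mpderiv_def)

lemma mpderiv_add: "mpderiv i (f + g) = mpderiv i f + mpderiv i g"
  by (intro poly_mapping_eqI) (simp add: lookup_mpderiv lookup_add distrib_left)

lemma mpderiv_diff: "mpderiv i (f - g) = mpderiv i f - mpderiv i g"
  by (intro poly_mapping_eqI) (simp add: lookup_mpderiv lookup_minus right_diff_distrib)

lemma mpderiv_sum: "mpderiv i (\<Sum>k\<in>A. f k) = (\<Sum>k\<in>A. mpderiv i (f k))"
  by (induction A rule: infinite_finite_induct) (simp_all add: mpderiv_add)

lemma mpderiv_single:
  "mpderiv i (Poly_Mapping.single a c) =
    Poly_Mapping.single (a - Poly_Mapping.single i 1) (of_nat (Poly_Mapping.lookup a i) * c)"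
  by (cases "c = 0") (simp_all add: mpderiv_def)

lemma mpderiv_mConst [simp]: "mpderiv i (mConst c) = 0"
  by (simp add: mConst_def mpderiv_single)

lemma mpderiv_one [simp]: "mpderiv i 1 = 0"
  using mpderiv_mConst[of i 1] by simp

lemma mpderiv_mVar: "mpderiv i (mVar j) = (if i = j then 1 else 0)"
  by (auto simp: mVar_def mpderiv_single lookup_single when_def)

lemma mpderiv_mult: "mpderiv i (f * g) = mpderiv i f * g + f * mpderiv i g"
proof (induction f rule: poly_mapping_single_induct)
  case (single a c)
  show ?case
  proof (induction g rule: poly_mapping_single_induct)
    case (single b d)
    let ?e = "Poly_Mapping.single i (Suc 0)"
    have 1: "a + b - ?e = (a - ?e) + b" if "Poly_Mapping.lookup a i \<noteq> 0" for a b
      using that by (intro poly_mapping_eqI) (auto simp: lookup_add lookup_minus lookup_single when_def)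
    have 2: "Poly_Mapping.single (a + b - ?e) (of_nat (Poly_Mapping.lookup a i) * (c * d)) =
        Poly_Mapping.single (a - ?e + b) (of_nat (Poly_Mapping.lookup a i) * c * d)"
      using 1[of a b] by (cases "Poly_Mapping.lookup a i = 0") (simp_all add: mult.assoc)
    have 3: "Poly_Mapping.single (a + b - ?e) (of_nat (Poly_Mapping.lookup b i) * (c * d)) =
        Poly_Mapping.single (a + (b - ?e)) (c * (of_nat (Poly_Mapping.lookup b i) * d))"
      using 1[of b a] by (cases "Poly_Mapping.lookup b i = 0") (simp_all add: ac_simps)
    show ?case
      by (simp add: mult_single mpderiv_single lookup_add distrib_right single_add 2 3)
  qed (simp_all add: distrib_left mpderiv_add algebra_simps)
qed (simp_all add: distrib_right mpderiv_add algebra_simps)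

lemma mpderiv_commute: "mpderiv i (mpderiv j f) = mpderiv j (mpderiv i f)"
proof (intro poly_mapping_eqI)
  fix a
  show "Poly_Mapping.lookup (mpderiv i (mpderiv j f)) a = Poly_Mapping.lookup (mpderiv j (mpderiv i f)) a"
    by (cases "i = j") (simp_all add: lookup_mpderiv lookup_add lookup_single ac_simps)
qed

lemma mpderiv_polys_in: "f \<in> polys_in n \<Longrightarrow> mpderiv i f \<in> polys_in n"
  by (induction f rule: polys_in_induct)
    (simp_all add: mpderiv_add mpderiv_mult mpderiv_mVar polys_in_add polys_in_mult polys_in_zero
      polys_in_mConst[of 1, simplified])

lemma mpderiv_outside: "f \<in> polys_in n \<Longrightarrow> n \<le> i \<Longrightarrow> mpderiv i f = 0"
  by (induction f rule: polys_in_induct) (auto simp: mpderiv_add mpderiv_mult mpderiv_mVar)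

text \<open>Here d is any derivation of the target ring that kills the coefficients. It is used for
  \<open>mpderiv\<close> after substitution, for \<open>pderiv\<close> on a line, and for vector
  fields on rational functions.\<close>

lemma chain_rule:
  assumes c: "comm_ring_hom c" and f: "f \<in> polys_in n"
    and d_add: "\<And>u v. d (u + v) = d u + d v" and d_mult: "\<And>u v. d (u * v) = d u * v + u * d v"
    and d_c: "\<And>k. d (c k) = 0"
  shows "d (eval_hom c s f) = (\<Sum>i<n. eval_hom c s (mpderiv i f) * d (s i))"
  using f
proof (induction f rule: polys_in_induct)
  case (var i)
  interpret e: comm_ring_hom "eval_hom c s" by (rule comm_ring_hom_eval_hom[OF c])
  have "(\<Sum>j<n. eval_hom c s (mpderiv j (mVar i)) * d (s j)) = (\<Sum>j<n. if j = i then d (s j) else 0)"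
    by (intro sum.cong) (auto simp: mpderiv_mVar)
  then show ?case using var by (simp add: eval_hom_mVar[OF c])
next
  case (add f g)
  then show ?case by (simp add: eval_hom_add[OF c] mpderiv_add d_add distrib_right sum.distrib)
next
  case (mult f g)
  then show ?case
    by (simp add: eval_hom_add[OF c] eval_hom_mult[OF c] mpderiv_mult d_mult algebra_simps sum.distrib
      sum_distrib_left sum_distrib_right)
qed (simp add: eval_hom_mConst[OF c] d_c)

lemma mpderiv_msubst:
  assumes "f \<in> polys_in n"
  shows "mpderiv k (msubst s f) = (\<Sum>i<n. msubst s (mpderiv i f) * mpderiv k (s i))"
  using chain_rule[OF comm_ring_hom_mConst assms, of "mpderiv k" s]
  by (simp add: mpderiv_add mpderiv_mult msubst_eq_eval_hom)

section \<open>Polynomials with coefficients in a subring\<close>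

lemma subring_sum: "subring R \<Longrightarrow> (\<And>i. i \<in> A \<Longrightarrow> f i \<in> R) \<Longrightarrow> sum f A \<in> R"
  by (induction A rule: infinite_finite_induct) (auto simp: subring_def)

lemma coeffs_in_iff: "subring R \<Longrightarrow> f \<in> coeffs_in R \<longleftrightarrow> (\<forall>a. Poly_Mapping.lookup f a \<in> R)"
  by (auto simp: coeffs_in_def subring_def) (metis in_keys_iff)

lemma coeffs_in_mConst: "subring R \<Longrightarrow> c \<in> R \<Longrightarrow> mConst c \<in> coeffs_in R"
  by (auto simp: coeffs_in_iff mConst_def lookup_single when_def subring_def)

lemma coeffs_in_mVar: "subring R \<Longrightarrow> mVar i \<in> coeffs_in R"
  by (auto simp: coeffs_in_iff mVar_def lookup_single when_def subring_def)

lemma coeffs_in_add: "subring R \<Longrightarrow> f \<in> coeffs_in R \<Longrightarrow> g \<in> coeffs_in R \<Longrightarrow> f + g \<in> coeffs_in R"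
  by (auto simp: coeffs_in_iff lookup_add subring_def)

lemma coeffs_in_diff: "subring R \<Longrightarrow> f \<in> coeffs_in R \<Longrightarrow> g \<in> coeffs_in R \<Longrightarrow> f - g \<in> coeffs_in R"
  by (auto simp: coeffs_in_iff lookup_minus subring_def)

lemma coeffs_in_sum:
  "subring R \<Longrightarrow> (\<And>i. i \<in> A \<Longrightarrow> f i \<in> coeffs_in R) \<Longrightarrow> sum f A \<in> coeffs_in R"
  by (auto simp: coeffs_in_iff lookup_sum intro: subring_sum)

lemma coeffs_in_mult:
  assumes R: "subring R" and "f \<in> coeffs_in R" "g \<in> coeffs_in R" shows "f * g \<in> coeffs_in R"
proof -
  have "f * g = (\<Sum>a\<in>Poly_Mapping.keys f. \<Sum>b\<in>Poly_Mapping.keys g.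
      Poly_Mapping.single (a + b) (Poly_Mapping.lookup f a * Poly_Mapping.lookup g b))"
    by (subst poly_mapping_sum_single[of f], subst poly_mapping_sum_single[of g])
      (simp only: sum_product mult_single)
  moreover have "Poly_Mapping.single (a + b) (Poly_Mapping.lookup f a * Poly_Mapping.lookup g b) \<in> coeffs_in R" for a b
    using assms by (auto simp: coeffs_in_iff lookup_single when_def subring_def)
  ultimately show ?thesis using R by (simp add: coeffs_in_sum)
qed

lemma coeffs_in_msubst:
  assumes R: "subring R" and f: "f \<in> coeffs_in R" and s: "\<And>i. s i \<in> coeffs_in R"
  shows "msubst s f \<in> coeffs_in R"
proof -
  have one: "1 \<in> coeffs_in R" using coeffs_in_mConst[OF R, of 1] R by (simp add: subring_def)
  have pow: "u ^ k \<in> coeffs_in R" if "u \<in> coeffs_in R" for u k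
    by (induction k) (use one that in \<open>simp_all add: coeffs_in_mult[OF R]\<close>)
  have "(\<Prod>i\<in>A. s i ^ Poly_Mapping.lookup a i) \<in> coeffs_in R" for A a
    by (induction A rule: infinite_finite_induct) (use one in \<open>simp_all add: coeffs_in_mult[OF R] pow s\<close>)
  then show ?thesis unfolding msubst_def
    using f by (intro coeffs_in_sum coeffs_in_mult coeffs_in_mConst R) (auto simp: coeffs_in_iff[OF R])
qed

lemma lin_form_polys_in: "lin_form m p \<in> polys_in m"
proof -
  have "sum (\<lambda>i. mConst (p i) * mVar i) A \<in> polys_in m" if "A \<subseteq> {..<m}" for A
    using that by (induction A rule: infinite_finite_induct)
      (auto simp: polys_in_zero intro!: polys_in_add polys_in_mult polys_in_mConst polys_in_mVar)
  then show ?thesis by (simp add: lin_form_def)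
qed

lemma lin_form_coeffs_in:
  "subring R \<Longrightarrow> \<forall>i<m. p i \<in> R \<Longrightarrow> lin_form m p \<in> coeffs_in R"
  unfolding lin_form_def
  by (auto intro!: coeffs_in_sum coeffs_in_mult coeffs_in_mConst coeffs_in_mVar)

lemma meval_lin_form [simp]: "meval x (lin_form m p) = (\<Sum>i<m. p i * x i)"
  by (simp add: lin_form_def meval.hom_sum meval.hom_mult)

lemma mpderiv_lin_form: "i < m \<Longrightarrow> mpderiv i (lin_form m p) = mConst (p i)"
  by (simp add: lin_form_def mpderiv_sum mpderiv_mult mpderiv_mVar if_distrib cong: if_cong)

text \<open>The bound on the total degree is strict so that bound 0 means the zero polynomial:
  inductions start there, and d derivatives annihilate a polynomial with bound d.\<close>

definition tdeg_less :: "nat \<Rightarrow> 'a::comm_ring_1 mpoly \<Rightarrow> bool" where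
  "tdeg_less d f \<longleftrightarrow> (\<forall>a\<in>Poly_Mapping.keys f. (\<Sum>i\<in>Poly_Mapping.keys a. Poly_Mapping.lookup a i) < d)"

lemma tdeg_less_0 [simp]: "tdeg_less 0 f \<longleftrightarrow> f = 0"
  by (auto simp: tdeg_less_def poly_mapping_eq_iff fun_eq_iff in_keys_iff)

lemma tdeg_less_exists: "\<exists>d. tdeg_less d f"
proof -
  have "finite ((\<lambda>a. \<Sum>i\<in>Poly_Mapping.keys a. Poly_Mapping.lookup a i) ` Poly_Mapping.keys f)" by simp
  then obtain d where "\<forall>k\<in>(\<lambda>a. \<Sum>i\<in>Poly_Mapping.keys a. Poly_Mapping.lookup a i) ` Poly_Mapping.keys f. k < d"
    using finite_nat_set_iff_bounded by blast
  then show ?thesis by (auto simp: tdeg_less_def)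
qed

lemma tdeg_less_mpderiv:
  assumes "tdeg_less (Suc d) f" shows "tdeg_less d (mpderiv i f)"
  unfolding tdeg_less_def
proof
  fix a assume a: "a \<in> Poly_Mapping.keys (mpderiv i f)"
  let ?b = "a + Poly_Mapping.single i (Suc 0)"
  have sum_eq: "(\<Sum>k\<in>Poly_Mapping.keys c. Poly_Mapping.lookup c k) = (\<Sum>k\<in>insert i (Poly_Mapping.keys a). Poly_Mapping.lookup c k)"
    if "c \<in> {a, ?b}" for c
    using that by (intro sum.mono_neutral_left)
      (auto simp: in_keys_iff lookup_add lookup_single when_def split: if_splits)
  have "?b \<in> Poly_Mapping.keys f"
    using a by (auto simp: in_keys_iff lookup_mpderiv)
  then have "(\<Sum>k\<in>Poly_Mapping.keys ?b. Poly_Mapping.lookup ?b k) < Suc d"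
    using assms by (auto simp: tdeg_less_def)
  moreover have "(\<Sum>k\<in>Poly_Mapping.keys ?b. Poly_Mapping.lookup ?b k) = Suc (\<Sum>k\<in>Poly_Mapping.keys a. Poly_Mapping.lookup a k)"
    unfolding sum_eq[of ?b, simplified] sum_eq[of a, simplified]
    by (simp add: lookup_add sum.distrib lookup_single when_def sum.delta')
  ultimately show "(\<Sum>k\<in>Poly_Mapping.keys a. Poly_Mapping.lookup a k) < d" by simp
qed

lemma mpderiv_induct [case_names zero deriv]:
  assumes "P 0" "\<And>f. (\<And>i. P (mpderiv i f)) \<Longrightarrow> P f"
  shows "P f"
proof -
  have "\<forall>f. tdeg_less d f \<longrightarrow> P f" for d
  proof (induction d)
    case (Suc d)
    then show ?case using assms(2) tdeg_less_mpderiv by blast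
  qed (use assms(1) in simp)
  then show ?thesis using tdeg_less_exists by blast
qed

lemma mpderiv_all_zero:
  fixes f :: "'a::field_char_0 mpoly"
  assumes "\<And>i. mpderiv i f = 0" shows "f = mConst (meval x f)"
proof -
  have "Poly_Mapping.lookup f a = 0" if a: "a \<noteq> 0" for a
  proof -
    obtain i where i: "Poly_Mapping.lookup a i \<noteq> 0"
      using a poly_mapping_eqI[of a 0] by auto
    have "a = (a - Poly_Mapping.single i 1) + Poly_Mapping.single i 1"
      using i by (intro poly_mapping_eqI) (auto simp: lookup_add lookup_minus lookup_single when_def)
    then show ?thesis
      using arg_cong[OF assms[of i], of "\<lambda>g. Poly_Mapping.lookup g (a - Poly_Mapping.single i 1)"]
      by (simp add: lookup_mpderiv of_nat_Suc[symmetric] del: of_nat_Suc)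
  qed
  then have "f = mConst (Poly_Mapping.lookup f 0)"
    by (intro poly_mapping_eqI) (auto simp: mConst_def lookup_single when_def)
  then show ?thesis by (metis meval_mConst)
qed

section \<open>Restriction to lines and polynomials as functions\<close>

definition on_line :: "(nat \<Rightarrow> 'a::comm_ring_1) \<Rightarrow> (nat \<Rightarrow> 'a) \<Rightarrow> 'a mpoly \<Rightarrow> 'a poly" where
  "on_line x v f = eval_hom (\<lambda>c. [:c:]) (\<lambda>i. [:x i, v i:]) f"

lemma comm_ring_hom_pCons: "comm_ring_hom (\<lambda>c. [:c:])"
  by unfold_locales (simp_all add: one_pCons)

interpretation on_line: comm_ring_hom "on_line x v"
  using comm_ring_hom_eval_hom[OF comm_ring_hom_pCons] by (simp add: on_line_def[abs_def])

lemma poly_on_line: "poly (on_line x v f) t = meval (\<lambda>i. x i + t * v i) f"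
  by (induction f rule: mpoly_induct)
    (simp_all add: on_line.hom_add on_line.hom_mult meval.hom_add meval.hom_mult,
     simp_all add: on_line_def eval_hom_mConst eval_hom_mVar comm_ring_hom_pCons)

lemma pderiv_on_line:
  assumes "f \<in> polys_in n"
  shows "pderiv (on_line x v f) = (\<Sum>i<n. [:v i:] * on_line x v (mpderiv i f))"
  using chain_rule[OF comm_ring_hom_pCons assms, of pderiv "\<lambda>i. [:x i, v i:]"]
  by (simp add: pderiv_add pderiv_mult pderiv_pCons on_line_def mult.commute)

lemma poly_pderiv_zero_const:
  fixes p :: "'a::field_char_0 poly"
  assumes "pderiv p = 0" shows "poly p s = poly p t"
proof -
  obtain c where "p = [:c:]" using assms degree_eq_zeroE by (auto simp: pderiv_eq_0_iff)
  then show ?thesis by simp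
qed

text \<open>If f vanishes everywhere, so do its restrictions to coordinate lines and hence all its
  partials as functions. By induction these are zero polynomials, so f is a constant, and its value
  is 0.\<close>

lemma mpoly_zero_iff:
  fixes f :: "'a::field_char_0 mpoly"
  shows "f = 0 \<longleftrightarrow> (\<forall>x. meval x f = 0)"
proof -
  have "(\<forall>x. meval x f = 0) \<longrightarrow> f = 0"
  proof (induction f rule: mpderiv_induct)
    case (deriv f)
    show ?case
    proof
      assume f: "\<forall>x. meval x f = 0"
      obtain n where n: "f \<in> polys_in n" using polys_in_exists by blast
      have "meval x (mpderiv i f) = 0" for x i
      proof -
        define v :: "nat \<Rightarrow> 'a" where "v k = (if k = i then 1 else 0)" for k
        have "on_line x v f = 0"
          using f poly_on_line[of x v f] by (simp add: poly_all_0_iff_0[symmetric])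
        \<comment> \<open>The enlarged bound guarantees that the index i occurs in the sum over
          directions.\<close>
        moreover have n': "f \<in> polys_in (Suc (max i n))"
          using n by (rule polys_in_mono) simp
        ultimately have "0 = poly (\<Sum>k<Suc (max i n). [:v k:] * on_line x v (mpderiv k f)) 0"
          using pderiv_on_line[OF n', of x v] by simp
        also have "\<dots> = (\<Sum>k<Suc (max i n). if k = i then meval x (mpderiv k f) else 0)"
          by (simp only: poly_sum, intro sum.cong) (simp_all add: poly_on_line v_def)
        also have "\<dots> = meval x (mpderiv i f)" by simp
        finally show ?thesis by simp
      qed
      then have "f = mConst (meval (\<lambda>_. 0) f)" using deriv by (intro mpderiv_all_zero) blast
      then show "f = 0" using f by simp
    qed
  qed simp
  then show ?thesis by auto
qed

lemma mpoly_eq_iff: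
  fixes f g :: "'a::field_char_0 mpoly"
  shows "f = g \<longleftrightarrow> (\<forall>x. meval x f = meval x g)"
  using mpoly_zero_iff[of "f - g"] by (simp add: meval.hom_minus)

text \<open>The directional derivative vanishes as a polynomial, hence at every point of the line
  from x in direction v, so f is constant on that line by characteristic zero.\<close>

lemma meval_invariant:
  fixes f :: "'a::field_char_0 mpoly"
  assumes f: "f \<in> polys_in n" and v: "(\<Sum>i<n. mConst (v i) * mpderiv i f) = 0"
  shows "meval (\<lambda>i. x i + v i) f = meval x f"
proof -
  have "poly (pderiv (on_line x v f)) t = 0" for t
    using arg_cong[OF v, of "meval (\<lambda>i. x i + t * v i)"]
    by (simp add: pderiv_on_line[OF f] poly_sum poly_on_line meval.hom_sum meval.hom_mult)
  then have "pderiv (on_line x v f) = 0" by (simp add: poly_all_0_iff_0[symmetric])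
  from poly_pderiv_zero_const[OF this, of 1 0] show ?thesis by (simp add: poly_on_line)
qed

section \<open>Derivations of the field of rational functions\<close>

definition rat_fun :: "'a::field_char_0 mpoly \<Rightarrow> 'a mpoly fract" where
  "rat_fun f = Fract f 1"

lemma rat_fun_simps [simp]:
  "rat_fun 0 = 0" "rat_fun 1 = 1" "rat_fun (f + g) = rat_fun f + rat_fun g" "rat_fun (f - g) = rat_fun f - rat_fun g"
  "rat_fun (- f) = - rat_fun f" "rat_fun (f * g) = rat_fun f * rat_fun g" "rat_fun f = rat_fun g \<longleftrightarrow> f = g"
  by (simp_all add: rat_fun_def Zero_fract_def One_fract_def eq_fract)

lemma rat_fun_eq_0_iff [simp]: "rat_fun f = 0 \<longleftrightarrow> f = 0"
  using rat_fun_simps(7)[of f 0] by (simp del: rat_fun_simps(7))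

lemma rat_fun_cases: obtains f g where "z = rat_fun f / rat_fun g" "g \<noteq> 0"
  by (cases z) (simp add: rat_fun_def)

definition fderiv :: "nat \<Rightarrow> 'a::field_char_0 mpoly fract \<Rightarrow> 'a mpoly fract" where
  "fderiv i z = (THE w. \<exists>a b. b \<noteq> 0 \<and> z = Fract a b \<and>
      w = Fract (mpderiv i a * b - a * mpderiv i b) (b * b))"

text \<open>Well-definedness of the quotient rule: differentiating the cross-multiplied equality of
  two representations turns one quotient into the other.\<close>

lemma fderiv_Fract:
  assumes b: "b \<noteq> 0"
  shows "fderiv i (Fract a b) = Fract (mpderiv i a * b - a * mpderiv i b) (b * b)"
  unfolding fderiv_def
proof (rule the_equality)
  fix w assume "\<exists>a' b'. b' \<noteq> 0 \<and> Fract a b = Fract a' b' \<and>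
      w = Fract (mpderiv i a' * b' - a' * mpderiv i b') (b' * b')"
  then obtain a' b' where b': "b' \<noteq> 0" and eq: "a * b' = a' * b"
    and w: "w = Fract (mpderiv i a' * b' - a' * mpderiv i b') (b' * b')"
    using b by (auto simp: eq_fract)
  have d: "mpderiv i a * b' = mpderiv i a' * b + a' * mpderiv i b - a * mpderiv i b'"
    using arg_cong[OF eq, of "mpderiv i"] by (simp add: mpderiv_mult algebra_simps)
  have "(mpderiv i a * b - a * mpderiv i b) * (b' * b') =
      b * b' * (mpderiv i a * b') - (a * b') * b' * mpderiv i b"
    by (simp add: algebra_simps)
  also have "\<dots> = b * b' * (mpderiv i a' * b + a' * mpderiv i b - a * mpderiv i b') - (a * b') * b' * mpderiv i b"
    by (simp only: d)
  also have "\<dots> = b * b' * (mpderiv i a' * b + a' * mpderiv i b)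
      - b * (a * b') * mpderiv i b' - (a * b') * b' * mpderiv i b"
    by (simp add: algebra_simps)
  also have "\<dots> = (mpderiv i a' * b' - a' * mpderiv i b') * (b * b)"
    by (simp add: eq algebra_simps)
  finally have "(mpderiv i a * b - a * mpderiv i b) * (b' * b') = (mpderiv i a' * b' - a' * mpderiv i b') * (b * b)" .
  then show "w = Fract (mpderiv i a * b - a * mpderiv i b) (b * b)"
    using b b' by (simp add: w eq_fract)
qed (use b in blast)

lemma fderiv_rat_fun: "fderiv i (rat_fun f) = rat_fun (mpderiv i f)"
  by (simp add: rat_fun_def fderiv_Fract)

lemma fderiv_add: "fderiv i (z + w) = fderiv i z + fderiv i w"
proof (cases z, cases w)
  fix a b c d assume "z = Fract a b" "b \<noteq> 0" "w = Fract c d" "d \<noteq> 0"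
  then show ?thesis
    by (simp add: fderiv_Fract mpderiv_add mpderiv_mult eq_fract) (simp add: algebra_simps)
qed

lemma fderiv_mult: "fderiv i (z * w) = fderiv i z * w + z * fderiv i w"
proof (cases z, cases w)
  fix a b c d assume "z = Fract a b" "b \<noteq> 0" "w = Fract c d" "d \<noteq> 0"
  then show ?thesis
    by (simp add: fderiv_Fract mpderiv_mult eq_fract) (simp add: algebra_simps)
qed

lemma fderiv_0 [simp]: "fderiv i 0 = 0"
  using fderiv_rat_fun[of i 0] by simp

lemma fderiv_1 [simp]: "fderiv i 1 = 0"
  using fderiv_rat_fun[of i 1] by simp

lemma fderiv_uminus: "fderiv i (- z) = - fderiv i z"
  using fderiv_add[of i z "- z"] by (simp add: eq_neg_iff_add_eq_0 add.commute)

lemma fderiv_diff: "fderiv i (z - w) = fderiv i z - fderiv i w"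
  using fderiv_add[of i z "- w"] by (simp add: fderiv_uminus)

lemma fderiv_divide:
  assumes "w \<noteq> 0" shows "fderiv i (z / w) = (fderiv i z * w - z * fderiv i w) / (w * w)"
proof -
  have "fderiv i z = fderiv i (z / w * w)" using assms by simp
  also have "\<dots> = fderiv i (z / w) * w + z / w * fderiv i w" by (rule fderiv_mult)
  finally show ?thesis using assms by (simp add: field_simps)
qed

lemma fderiv_commute: "fderiv i (fderiv j z) = fderiv j (fderiv i z)"
proof -
  obtain f g where z: "z = rat_fun f / rat_fun g" and g: "g \<noteq> 0" by (rule rat_fun_cases)
  show ?thesis
    using g by (simp add: z fderiv_divide fderiv_diff fderiv_mult fderiv_rat_fun mpderiv_commute[of i j] field_simps)
qed

text \<open>Writing \<open>z = f / g\<close>, subtract from f the multiple of g that agrees with it at a point x where g does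
  not vanish; along lines through x the orders of vanishing of the difference are incompatible
  with its logarithmic derivative being that of g.\<close>
lemma fderiv_all_zero:
  fixes z :: "'a::field_char_0 mpoly fract"
  assumes z: "\<And>i. fderiv i z = 0"
  obtains c where "z = rat_fun (mConst c)"
proof -
  obtain f g where zfg: "z = rat_fun f / rat_fun g" and g: "g \<noteq> 0" by (rule rat_fun_cases)
  obtain x where x: "meval x g \<noteq> 0" using g mpoly_zero_iff by blast
  define c where "c = meval x f / meval x g"
  define f1 where "f1 = f - mConst c * g"
  have fx: "meval x f1 = 0" using x by (simp add: f1_def c_def meval.hom_minus meval.hom_mult)
  have comm: "mpderiv i f1 * g = f1 * mpderiv i g" for i
  proof -
    have "rat_fun (mpderiv i f * g - f * mpderiv i g) = 0"
      using z[of i] g by (simp add: zfg fderiv_divide fderiv_rat_fun)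
    then have "mpderiv i f * g = f * mpderiv i g" unfolding rat_fun_eq_0_iff by simp
    then show ?thesis by (simp add: f1_def mpderiv_diff mpderiv_mult algebra_simps)
  qed
  have "meval y f1 = 0" for y
  proof -
    define v where "v i = y i - x i" for i
    obtain n0 n1 where "f1 \<in> polys_in n0" "g \<in> polys_in n1" using polys_in_exists by metis
    then have n: "f1 \<in> polys_in (max n0 n1)" "g \<in> polys_in (max n0 n1)" by (auto intro: polys_in_mono)
    let ?F = "on_line x v f1" and ?G = "on_line x v g"
    have FG: "pderiv ?F * ?G = ?F * pderiv ?G"
      unfolding pderiv_on_line[OF n(1)] pderiv_on_line[OF n(2)] sum_distrib_left sum_distrib_right
    proof (rule sum.cong, simp)
      fix i
      show "[:v i:] * on_line x v (mpderiv i f1) * ?G = ?F * ([:v i:] * on_line x v (mpderiv i g))"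
        using arg_cong[OF comm[of i], of "on_line x v"] by (simp add: on_line.hom_mult ac_simps)
    qed
    have G0: "poly ?G 0 \<noteq> 0" using x by (simp add: poly_on_line)
    have F0: "poly ?F 0 = 0" using fx by (simp add: poly_on_line)
    have "?F = 0"
    proof (rule ccontr)
      assume F: "?F \<noteq> 0"
      have dF: "pderiv ?F \<noteq> 0"
      proof
        assume "pderiv ?F = 0"
        then have "poly ?F s = 0" for s using poly_pderiv_zero_const[of ?F s 0] F0 by simp
        then show False using F poly_all_0_iff_0 by blast
      qed
      have G: "?G \<noteq> 0" using G0 by auto
      have "order 0 (pderiv ?F * ?G) = order 0 (pderiv ?F)"
        using G0 dF G order_mult[of "pderiv ?F" ?G 0] by (simp add: order_0I)
      moreover have "order 0 ?F = Suc (order 0 (pderiv ?F))"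
        using order_pderiv[OF F F0] .
      moreover have "?F * pderiv ?G \<noteq> 0" using FG dF G by (metis mult_eq_0_iff)
      then have "order 0 ?F \<le> order 0 (?F * pderiv ?G)" by (simp add: order_mult)
      ultimately show False using FG by simp
    qed
    then show ?thesis using poly_on_line[of x v f1 1] by (simp add: v_def)
  qed
  then have "f1 = 0" using mpoly_zero_iff by blast
  then have "z = rat_fun (mConst c)" using g by (simp add: zfg f1_def)
  then show thesis by (rule that)
qed

section \<open>Vector fields and local nilpotency\<close>

definition vfield :: "nat set \<Rightarrow> (nat \<Rightarrow> 'a::field_char_0 mpoly fract) \<Rightarrow> 'a mpoly fract \<Rightarrow> 'a mpoly fract" where
  "vfield I \<nu> z = (\<Sum>k\<in>I. \<nu> k * fderiv k z)"

lemma vfield_simps: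
  "vfield I \<nu> 0 = 0" "vfield I \<nu> 1 = 0"
  "vfield I \<nu> (z + w) = vfield I \<nu> z + vfield I \<nu> w"
  "vfield I \<nu> (z - w) = vfield I \<nu> z - vfield I \<nu> w"
  "vfield I \<nu> (- z) = - vfield I \<nu> z"
  "vfield I \<nu> (z * w) = vfield I \<nu> z * w + z * vfield I \<nu> w"
  by (simp_all add: vfield_def fderiv_add fderiv_diff fderiv_uminus fderiv_mult sum.distrib
      sum_subtractf sum_negf sum_distrib_left sum_distrib_right algebra_simps)

lemma vfield_sum: "vfield I \<nu> (\<Sum>k\<in>A. f k) = (\<Sum>k\<in>A. vfield I \<nu> (f k))"
  by (induction A rule: infinite_finite_induct) (simp_all add: vfield_simps)

lemma vfield_funpow_const:
  assumes "vfield I \<nu> c = 0"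
  shows "(vfield I \<nu> ^^ n) (c * z) = c * (vfield I \<nu> ^^ n) z"
  by (induction n) (simp_all add: vfield_simps assms)

lemma vfield_funpow_sum: "(vfield I \<nu> ^^ n) (\<Sum>k\<in>A. f k) = (\<Sum>k\<in>A. (vfield I \<nu> ^^ n) (f k))"
  by (induction n) (simp_all add: vfield_sum)

text \<open>The coefficients \<nu> behave as constants for the field, so they can be pulled out of
  its iterates; each application then only replaces f by its partials, lowering the degree.\<close>

lemma vfield_locally_nilpotent:
  assumes \<nu>: "\<And>k. k \<in> I \<Longrightarrow> vfield I \<nu> (\<nu> k) = 0"
  shows "tdeg_less d f \<Longrightarrow> (vfield I \<nu> ^^ d) (rat_fun f) = 0"
proof (induction d arbitrary: f)
  case (Suc d)
  have "(vfield I \<nu> ^^ Suc d) (rat_fun f) = (vfield I \<nu> ^^ d) (\<Sum>k\<in>I. \<nu> k * rat_fun (mpderiv k f))"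
    by (simp add: funpow_swap1 vfield_def fderiv_rat_fun)
  also have "\<dots> = (\<Sum>k\<in>I. \<nu> k * (vfield I \<nu> ^^ d) (rat_fun (mpderiv k f)))"
    by (simp add: vfield_funpow_sum vfield_funpow_const[OF \<nu>])
  also have "\<dots> = 0" using Suc tdeg_less_mpderiv by (metis (no_types, lifting) mult_zero_right sum.neutral)
  finally show ?case .
qed simp

text \<open>Iterating gives \<open>D^n (rat_fun f) = (-1)^n n! \<theta>^n rat_fun f\<close>, while D is locally nilpotent on
  polynomials.\<close>
lemma riccati_zero:
  fixes f :: "'a::field_char_0 mpoly"
  assumes \<nu>: "\<And>k. k \<in> I \<Longrightarrow> vfield I \<nu> (\<nu> k) = 0"
    and f: "f \<noteq> 0" "vfield I \<nu> (rat_fun f) = - \<theta> * rat_fun f"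
    and \<theta>: "vfield I \<nu> \<theta> = - \<theta> * \<theta>"
  shows "\<theta> = 0"
proof (rule ccontr)
  assume nz: "\<theta> \<noteq> 0"
  let ?D = "vfield I \<nu>"
  have pow: "?D (\<theta> ^ n) = - of_nat n * \<theta> ^ Suc n" for n
    by (induction n) (simp_all add: vfield_simps \<theta> algebra_simps)
  have of_nat: "?D (of_nat n) = 0" for n
    by (induction n) (simp_all add: vfield_simps)
  have iter: "(?D ^^ n) (rat_fun f) = (-1) ^ n * of_nat (fact n) * \<theta> ^ n * rat_fun f" for n
  proof (induction n)
    case (Suc n)
    have c: "?D ((-1) ^ n * of_nat (fact n)) = 0"
      using of_nat[of "fact n"] by (cases "even n") (simp_all add: vfield_simps)
    have "(?D ^^ Suc n) (rat_fun f) = ?D ((-1) ^ n * of_nat (fact n) * (\<theta> ^ n * rat_fun f))"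
      using Suc by (simp add: mult.assoc)
    also have "\<dots> = (-1) ^ n * of_nat (fact n) * ?D (\<theta> ^ n * rat_fun f)"
      by (simp add: vfield_simps(6)[of I \<nu> "(-1) ^ n * of_nat (fact n)"] c)
    also have "?D (\<theta> ^ n * rat_fun f) = - of_nat (Suc n) * \<theta> ^ Suc n * rat_fun f"
      by (simp add: vfield_simps pow f algebra_simps)
    finally show ?case by (simp add: algebra_simps)
  qed simp
  obtain d where "tdeg_less d f" using tdeg_less_exists by blast
  then have "(-1) ^ d * of_nat (fact d) * \<theta> ^ d * rat_fun f = 0"
    using vfield_locally_nilpotent[OF \<nu>, of d f] iter[of d] by simp
  moreover have "of_nat (fact d) \<noteq> (0 :: 'a mpoly fract)"
    using rat_fun_simps by (simp add: of_nat_fract Zero_fract_def eq_fract del: of_nat_fact)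
  ultimately show False using nz f by simp
qed

section \<open>Constancy of the kernel of the Jacobian\<close>

text \<open>Cramer's rule for the 2x2 pivot block of the Hessian. In \<open>apex_cone\<close> and
  \<open>rank2_constant\<close> it turns two equations at the pivot rows into the vanishing of both
  coefficients.\<close>

lemma nondegenerate_form:
  fixes X Y Z u v :: "'b::idom"
  assumes nz: "X * Z - Y * Y \<noteq> 0" and uv: "u * X + v * Y = 0" "u * Y + v * Z = 0"
  shows "u = 0 \<and> v = 0"
proof -
  have "u * (X * Z - Y * Y) = (u * X + v * Y) * Z - (u * Y + v * Z) * Y"
    "v * (X * Z - Y * Y) = (u * Y + v * Z) * X - (u * X + v * Y) * Y"
    by (simp_all add: algebra_simps)
  then show ?thesis using uv nz by simp
qed

locale gradient_map =
  fixes m :: nat and H :: "nat \<Rightarrow> 'a::field_char_0 mpoly" and h :: "'a mpoly"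
  assumes h_in: "h \<in> polys_in m" and grad: "i < m \<Longrightarrow> H i = mpderiv i h"
begin

lemma H_in: "i < m \<Longrightarrow> H i \<in> polys_in m"
  by (simp add: grad h_in mpderiv_polys_in)

lemma symmetric: "i < m \<Longrightarrow> j < m \<Longrightarrow> mpderiv i (H j) = mpderiv j (H i)"
  by (simp add: grad mpderiv_commute[of i j])

lemma fderiv_symmetric:
  "i < m \<Longrightarrow> j < m \<Longrightarrow> fderiv i (rat_fun (H j)) = fderiv j (rat_fun (H i))"
  by (simp add: fderiv_rat_fun symmetric)

lemma fderiv_H_outside: "i < m \<Longrightarrow> m \<le> k \<Longrightarrow> fderiv k (rat_fun (H i)) = 0"
  using mpderiv_outside[OF H_in] by (simp add: fderiv_rat_fun)

text \<open>The pivot derivative of every c j is killed first, by the Riccati argument with \<theta>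
  = - \<open>fderiv p (c j)\<close>; derivatives in the other directions then follow by commuting
  partials in the column relation.\<close>

lemma rank1_constant:
  assumes p: "p < m" and j: "j < m"
    and nz: "fderiv p (rat_fun (H p)) \<noteq> 0"
    and col: "\<And>i k. i < m \<Longrightarrow> k < m \<Longrightarrow> fderiv k (rat_fun (H i)) = c k * fderiv p (rat_fun (H i))"
  obtains \<gamma> where "c j = rat_fun (mConst \<gamma>)"
proof -
  let ?X = "fderiv p (rat_fun (H p))"
  have fderiv_p: "fderiv p (c j) = 0" if j: "j < m" for j
  proof (cases "j = p")
    case True
    then have "c j = 1" using col[OF p p] nz by simp
    then show ?thesis by simp
  next
    case False
    define D where "D z = fderiv j z - c j * fderiv p z" for z
    have D: "D = vfield {j, p} (\<lambda>k. if k = j then 1 else - c j)"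
      using False by (auto simp: D_def vfield_def fun_eq_iff)
    \<comment> \<open>D and the pivot derivation fail to commute only through the coefficient
      \<open>c j\<close>. Applied to H, which D kills, this makes every pivot derivative of H an
      eigenvector of D with the same eigenvalue.\<close>
    have commutator: "D (fderiv p z) = fderiv p (D z) + fderiv p (c j) * fderiv p z" for z
      by (simp add: D_def fderiv_diff fderiv_mult fderiv_commute[of j p])
    have DH: "D (rat_fun (H i)) = 0" if "i < m" for i
      using col[OF that j] by (simp add: D_def)
    have DX: "D (fderiv p (rat_fun (H i))) = fderiv p (c j) * fderiv p (rat_fun (H i))" if "i < m" for i
      using DH[OF that] by (simp add: commutator)
    have jp: "fderiv p (rat_fun (H j)) = c j * ?X"
      using col[OF p j] fderiv_symmetric[OF p j] by simp
    \<comment> \<open>D is applied to both sides of \<open>jp\<close>: the two sides scale by the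
      same factor, so the Leibniz term with \<open>D (c j)\<close> is left over.\<close>
    have "D (c j) * ?X = 0"
      using DX[OF j] DX[OF p] unfolding jp by (simp add: D vfield_simps algebra_simps)
    then have Dc: "D (c j) = 0" using nz by simp
    have "- fderiv p (c j) = 0"
    proof (rule riccati_zero)
      show "vfield {j, p} (\<lambda>k. if k = j then 1 else - c j) (if k = j then 1 else - c j) = 0" for k
        using Dc by (simp add: D vfield_simps)
      show "mpderiv p (H p) \<noteq> 0" using nz by (simp add: fderiv_rat_fun)
      show "vfield {j, p} (\<lambda>k. if k = j then 1 else - c j) (rat_fun (mpderiv p (H p))) =
          - (- fderiv p (c j)) * rat_fun (mpderiv p (H p))"
        using DX[OF p] by (simp add: D fderiv_rat_fun)
      show "vfield {j, p} (\<lambda>k. if k = j then 1 else - c j) (- fderiv p (c j)) =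
          - (- fderiv p (c j)) * - fderiv p (c j)"
        using commutator[of "c j"] Dc by (simp add: D vfield_simps)
    qed
    then show ?thesis by simp
  qed
  have "fderiv k (c j) = 0" for k
  proof (cases "k < m")
    \<comment> \<open>Rational functions involve all variables, not only the first m. Directions
      beyond m differentiate neither side of the symmetric relation except through
      \<open>c j\<close>.\<close>
    case False
    then have "fderiv k (fderiv p (rat_fun (H j))) = 0" "fderiv k ?X = 0"
      using fderiv_H_outside[OF j, of k] fderiv_H_outside[OF p, of k] by (simp_all add: fderiv_commute[of k p])
    then have "fderiv k (c j) * ?X = 0"
      using col[OF p j] fderiv_symmetric[OF p j] by (simp add: fderiv_mult)
    then show ?thesis using nz by simp
  next
    case k: True
    \<comment> \<open>Since the pivot derivative of \<open>c k\<close> is already zero, the column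
      relation may be differentiated as if its coefficient were constant; comparing the rows j and p
      isolates the derivative of \<open>c j\<close>.\<close>
    have *: "fderiv k (fderiv p (rat_fun (H i))) = c k * fderiv p (fderiv p (rat_fun (H i)))" if "i < m" for i
      using col[OF that k] fderiv_p[OF k] by (simp add: fderiv_commute[of k p] fderiv_mult)
    have jp: "fderiv p (rat_fun (H j)) = c j * ?X"
      using col[OF p j] fderiv_symmetric[OF p j] by simp
    have "fderiv k (c j) * ?X = 0"
      using *[OF j] *[OF p] fderiv_p[OF j] unfolding jp by (simp add: fderiv_mult)
    then show ?thesis using nz by simp
  qed
  then show thesis using fderiv_all_zero that by blast
qed

text \<open>If the trace of the Jacobian of (c, e) along (p, q) vanishes and its kernel contains (U, V),
  the only remaining freedom is a single function \<open>fderiv p e\<close>.  Mixed partials of c and e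
  then force either that function to vanish, or the level curves of a potential of (U, V) to be
  straight, and the latter contradicts nondegeneracy by another Riccati equation.\<close>
lemma planar_rigidity:
  assumes pq: "p \<noteq> q"
    and U: "U = rat_fun f" "fderiv q U = fderiv p V"
    and nz: "fderiv p U * fderiv q V - fderiv p V * fderiv p V \<noteq> 0"
    and cp: "fderiv p c * U + fderiv p e * V = 0" and cq: "fderiv q c * U + fderiv q e * V = 0"
    and trace: "fderiv p c + fderiv q e = 0"
  shows "fderiv p c = 0 \<and> fderiv p e = 0 \<and> fderiv q c = 0 \<and> fderiv q e = 0"
proof -
  have U0: "U \<noteq> 0" using nz U(2) by auto
  define \<tau> where "\<tau> = V / U"
  have V: "V = \<tau> * U" using U0 by (simp add: \<tau>_def)
  define \<kappa> where "\<kappa> = fderiv p e"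
  have "(fderiv p c + \<tau> * \<kappa>) * U = 0" using cp by (simp add: V \<kappa>_def algebra_simps)
  then have 1: "fderiv p c = - \<tau> * \<kappa>" using U0 by (simp add: eq_neg_iff_add_eq_0)
  have 2: "fderiv q e = \<tau> * \<kappa>" using trace 1 by simp
  have "(fderiv q c + \<tau> * fderiv q e) * U = 0" using cq by (simp add: V algebra_simps)
  then have 3: "fderiv q c = - \<tau> * (\<tau> * \<kappa>)" using U0 2 by (simp add: eq_neg_iff_add_eq_0)
  have mix_e: "fderiv q \<kappa> = fderiv p \<tau> * \<kappa> + \<tau> * fderiv p \<kappa>"
    using fderiv_commute[of q p e] 2 by (simp add: \<kappa>_def fderiv_mult)
  have mix_c: "fderiv q (- \<tau> * \<kappa>) = fderiv p (- \<tau> * (\<tau> * \<kappa>))"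
    using fderiv_commute[of q p c] 1 3 by simp
  \<comment> \<open>Eliminating the q-derivative of \<kappa> from the two mixed-partial identities
    cancels all derivatives of \<kappa>. The remaining factor is the inviscid Burgers equation for
    the slope \<tau>.\<close>
  have "\<kappa> * (\<tau> * fderiv p \<tau> - fderiv q \<tau>) = 0"
    using mix_c by (simp add: fderiv_mult fderiv_uminus mix_e algebra_simps)
  moreover have "\<tau> * fderiv p \<tau> - fderiv q \<tau> \<noteq> 0"
  proof
    assume D\<tau>: "\<tau> * fderiv p \<tau> - fderiv q \<tau> = 0"
    define D where "D z = \<tau> * fderiv p z - fderiv q z" for z
    define \<nu> where "\<nu> k = (if k = p then \<tau> else - 1)" for k
    have D: "D = vfield {p, q} \<nu>"
      using pq by (auto simp: D_def \<nu>_def vfield_def fun_eq_iff)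
    \<comment> \<open>Closedness rewrites the q-derivative of U as the p-derivative of \<tau> U, so
      U supplies the polynomial that \<open>riccati_zero\<close> needs.\<close>
    have DU: "D U = - fderiv p \<tau> * U" by (simp add: D_def U(2)) (simp add: V fderiv_mult)
    have commutator: "D (fderiv p z) = fderiv p (D z) - fderiv p \<tau> * fderiv p z" for z
      by (simp add: D_def fderiv_diff fderiv_mult fderiv_commute[of q p])
    have \<tau>p: "fderiv p \<tau> = 0"
    proof (rule riccati_zero)
      have "D \<tau> = 0" "D (- 1) = 0"
        using D\<tau> by (simp_all only: D_def[of \<tau>]) (simp add: D vfield_simps)
      then show "vfield {p, q} \<nu> (\<nu> k) = 0" for k
        by (simp add: \<nu>_def flip: D)
      show "f \<noteq> 0" using U0 U(1) by auto
      show "vfield {p, q} \<nu> (rat_fun f) = - fderiv p \<tau> * rat_fun f" using DU by (simp add: D U(1))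
      show "vfield {p, q} \<nu> (fderiv p \<tau>) = - fderiv p \<tau> * fderiv p \<tau>"
        using commutator[of \<tau>] D\<tau> by (simp add: D[symmetric] D_def[of \<tau>])
    qed
    then have "fderiv q \<tau> = 0" using D\<tau> by simp
    \<comment> \<open>With \<tau> constant in both pivot directions the Jacobian of (U, V) has
      proportional rows, against \<open>nz\<close>.\<close>
    then have "fderiv q V = \<tau> * fderiv q U" "fderiv p V = \<tau> * fderiv p U"
      using \<tau>p by (simp_all add: V fderiv_mult)
    then show False using nz U(2) by simp
  qed
  ultimately have "\<kappa> = 0" by simp
  then show ?thesis using 1 2 3 \<kappa>_def by simp
qed


end

context gradient_map begin
text \<open>The apex enters only through \<open>cone\<close>, which \<open>apex_cone\<close>
  supplies. Pivot directions are settled first (\<open>planar\<close>); once they are, the column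
  relation reduces all other directions to them.\<close>

lemma rank2_constant:
  fixes \<beta> :: "nat \<Rightarrow> 'a"
  assumes p: "p < m" and q: "q < m" and j: "j < m" and pq: "p \<noteq> q"
    and nz: "fderiv p (rat_fun (H p)) * fderiv q (rat_fun (H q)) - fderiv p (rat_fun (H q)) * fderiv p (rat_fun (H q)) \<noteq> 0"
    and col: "\<And>i k. i < m \<Longrightarrow> k < m \<Longrightarrow>
      fderiv k (rat_fun (H i)) = c k * fderiv p (rat_fun (H i)) + e k * fderiv q (rat_fun (H i))"
    and cone: "\<And>i. i < m \<Longrightarrow> rat_fun (H i - mConst (\<beta> i)) =
      c i * rat_fun (H p - mConst (\<beta> p)) + e i * rat_fun (H q - mConst (\<beta> q))"
  obtains \<gamma> \<delta> where "c j = rat_fun (mConst \<gamma>)" "e j = rat_fun (mConst \<delta>)"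
proof -
  define X Y Z where "X = fderiv p (rat_fun (H p))" and "Y = fderiv p (rat_fun (H q))" and "Z = fderiv q (rat_fun (H q))"
  have Yq: "fderiv q (rat_fun (H p)) = Y" unfolding Y_def by (rule fderiv_symmetric[OF q p])
  have nz: "X * Z - Y * Y \<noteq> 0" using nz by (simp add: X_def Y_def Z_def)
  note solve = nondegenerate_form[OF nz]
  have jp: "fderiv p (rat_fun (H j)) = c j * X + e j * Y" if "j < m" for j
    using col[OF p that] fderiv_symmetric[OF p that] by (simp add: X_def Yq)
  have jq: "fderiv q (rat_fun (H j)) = c j * Y + e j * Z" if "j < m" for j
    using col[OF q that] fderiv_symmetric[OF q that] by (simp add: Y_def Z_def)
  define U V where "U = rat_fun (H p - mConst (\<beta> p))" and "V = rat_fun (H q - mConst (\<beta> q))"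
  have dUV: "fderiv p U = X" "fderiv q U = Y" "fderiv p V = Y" "fderiv q V = Z"
    by (simp_all only: U_def V_def fderiv_rat_fun mpderiv_diff mpderiv_mConst diff_zero)
      (simp_all add: X_def Y_def Z_def Yq flip: fderiv_rat_fun)
  have planar: "fderiv p (c j) = 0 \<and> fderiv p (e j) = 0 \<and> fderiv q (c j) = 0 \<and> fderiv q (e j) = 0"
    if j: "j < m" for j
  proof (cases "j = p \<or> j = q")
    \<comment> \<open>The pivot columns have coefficients (1, 0) and (0, 1). Separating them off
      makes j, p, q distinct, as the field \<nu> requires.\<close>
    case True
    have "c p - 1 = 0 \<and> e p = 0"
      by (rule solve) (use jp[OF p] jq[OF p] in \<open>simp_all add: X_def[symmetric] Yq algebra_simps\<close>)
    moreover have "c q = 0 \<and> e q - 1 = 0"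
      by (rule solve) (use jp[OF q] jq[OF q] in \<open>simp_all add: Y_def[symmetric] Z_def[symmetric] algebra_simps\<close>)
    ultimately show ?thesis using True by auto
  next
    case False
    define cj ej where "cj = c j" and "ej = e j"
    define D where "D z = fderiv j z - cj * fderiv p z - ej * fderiv q z" for z
    define \<nu> where "\<nu> k = (if k = j then 1 else if k = p then - cj else - ej)" for k
    have D: "D = vfield {j, p, q} \<nu>"
      using False pq by (auto simp: D_def \<nu>_def vfield_def fun_eq_iff)
    have D_add: "D (y + z) = D y + D z" and D_diff: "D (y - z) = D y - D z"
      and D_mult: "D (y * z) = D y * z + y * D z" for y z
      by (simp_all add: D vfield_simps)
    have commutator: "D (fderiv k z) = fderiv k (D z) + fderiv k cj * fderiv p z + fderiv k ej * fderiv q z"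
      for k z
      by (simp add: D_def fderiv_diff fderiv_mult fderiv_commute[of j k] fderiv_commute[of p k] fderiv_commute[of q k])
    have DH: "D (fderiv k (rat_fun (H i))) = fderiv k cj * fderiv p (rat_fun (H i)) + fderiv k ej * fderiv q (rat_fun (H i))"
      if "i < m" for i k
    proof -
      have "D (rat_fun (H i)) = 0" using col[OF that j] by (simp add: D_def cj_def ej_def)
      then show ?thesis by (simp add: commutator)
    qed
    have DX: "D X = fderiv p cj * X + fderiv p ej * Y" and DY: "D Y = fderiv p cj * Y + fderiv p ej * Z"
      and DZ: "D Z = fderiv q cj * Y + fderiv q ej * Z"
      using DH[OF p, of p] DH[OF q, of p] DH[OF q, of q] by (simp_all add: X_def Y_def Z_def Yq)
    \<comment> \<open>Y is both a p-derivative of \<open>H q\<close> and a q-derivative of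
      \<open>H p\<close>. Using one expression for each factor in \<open>D (Y * Y)\<close> makes D
      act on the pivot minor as multiplication by the trace.\<close>
    have DY': "D Y = fderiv q cj * X + fderiv q ej * Y"
      using DH[OF p, of q] by (simp add: X_def Yq)
    have product: "D cj * y + D ej * z = 0"
      if "D (cj * y + ej * z) = a * (cj * X + ej * Y) + b * (cj * Y + ej * Z)"
        "D y = a * X + b * Y" "D z = a * Y + b * Z" for a b y z
    proof -
      have "D cj * y + D ej * z = D (cj * y + ej * z) - (cj * D y + ej * D z)"
        by (simp add: D_add D_mult)
      also have "\<dots> = 0" unfolding that by (simp add: distrib_left mult.left_commute)
      finally show ?thesis .
    qed
    \<comment> \<open>As in rank one, D is applied in two ways to the row relations
      \<open>jp\<close> and \<open>jq\<close>; the Leibniz terms left over form a system governed by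
      the pivot block.\<close>
    have "D cj * X + D ej * Y = 0"
      by (rule product[OF _ DX DY]) (use DH[OF j, of p] jp[OF j] jq[OF j] in \<open>simp flip: cj_def ej_def\<close>)
    moreover have "D cj * Y + D ej * Z = 0"
      by (rule product[OF _ DY' DZ]) (use DH[OF j, of q] jp[OF j] jq[OF j] in \<open>simp flip: cj_def ej_def\<close>)
    ultimately have D0: "D cj = 0" "D ej = 0" using solve[of "D cj" "D ej"] by simp_all
    have "rat_fun (H j - mConst (\<beta> j)) = cj * U + ej * V"
      using cone[OF j] by (simp only: U_def V_def cj_def ej_def)
    moreover have "fderiv k (rat_fun (H j)) = fderiv k (rat_fun (H j - mConst (\<beta> j)))" for k
      by (simp only: fderiv_rat_fun mpderiv_diff mpderiv_mConst diff_zero)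
    ultimately have ker: "fderiv k (rat_fun (H j)) = fderiv k (cj * U + ej * V)" for k
      by metis
    \<comment> \<open>Differentiating the cone identity reproduces \<open>jp\<close> when c and e
      are held fixed, so the terms in their derivatives cancel: (U, V) is a kernel vector of the
      Jacobian of (c, e).\<close>
    have cp: "fderiv p cj * U + fderiv p ej * V = 0"
      using ker[of p] by (simp add: jp[OF j] cj_def[symmetric] ej_def[symmetric] fderiv_add fderiv_mult dUV algebra_simps)
    have cq: "fderiv q cj * U + fderiv q ej * V = 0"
      using ker[of q] by (simp add: jq[OF j] cj_def[symmetric] ej_def[symmetric] fderiv_add fderiv_mult dUV algebra_simps)
    have U0: "U \<noteq> 0" using nz dUV by auto
    have "U * (fderiv p cj * fderiv q ej - fderiv q cj * fderiv p ej) =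
        (fderiv p cj * U + fderiv p ej * V) * fderiv q ej - (fderiv q cj * U + fderiv q ej * V) * fderiv p ej"
      by (simp add: algebra_simps)
    then have det: "fderiv p cj * fderiv q ej = fderiv q cj * fderiv p ej"
      using U0 by (simp add: cp cq)
    define \<theta> where "\<theta> = - (fderiv p cj + fderiv q ej)"
    define F where "F = mpderiv p (H p) * mpderiv q (H q) - mpderiv p (H q) * mpderiv p (H q)"
    have F: "rat_fun F = X * Z - Y * Y" by (simp add: F_def X_def Y_def Z_def fderiv_rat_fun)
    have "\<theta> = 0"
    proof (rule riccati_zero)
      have "D (- cj) = 0" "D (- ej) = 0" "D 1 = 0"
        using D0 by (simp_all add: D vfield_simps)
      then show "vfield {j, p, q} \<nu> (\<nu> k) = 0" for k
        by (simp add: \<nu>_def flip: D)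
      show "F \<noteq> 0" using nz F by auto
      have "D (Y * Y) = (fderiv p cj * Y + fderiv p ej * Z) * Y + Y * (fderiv q cj * X + fderiv q ej * Y)"
        by (subst D_mult) (metis DY DY')
      then show "vfield {j, p, q} \<nu> (rat_fun F) = - \<theta> * rat_fun F"
        unfolding F D[symmetric] by (simp add: D_diff D_mult[of X Z] DX DZ \<theta>_def algebra_simps)
      \<comment> \<open>The right-hand sides add up to the trace of the squared Jacobian of (c, e),
        which \<open>det\<close> turns into the square of its trace.\<close>
      have "D (fderiv p cj) = fderiv p cj * fderiv p cj + fderiv p ej * fderiv q cj"
        "D (fderiv q ej) = fderiv q cj * fderiv p ej + fderiv q ej * fderiv q ej"
        by (simp_all add: commutator D0)
      then have "D (fderiv p cj + fderiv q ej) =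
          (fderiv p cj + fderiv q ej) * (fderiv p cj + fderiv q ej)"
        using det by (simp add: D_add algebra_simps)
      then show "vfield {j, p, q} \<nu> \<theta> = - \<theta> * \<theta>"
        by (simp only: \<theta>_def D vfield_simps(5) mult_minus_left mult_minus_right minus_minus)
    qed
    then have trace: "fderiv p cj + fderiv q ej = 0" by (simp only: \<theta>_def neg_equal_0_iff_equal)
    show ?thesis unfolding cj_def[symmetric] ej_def[symmetric]
      by (rule planar_rigidity[OF pq U_def _ _ cp cq trace]) (use nz in \<open>simp_all add: dUV\<close>)
  qed
  have "fderiv k (c j) = 0 \<and> fderiv k (e j) = 0" for k
  proof (cases "k < m")
    case False
    have out: "fderiv k (fderiv l (rat_fun (H i))) = 0" if "i < m" for i l
      using fderiv_H_outside[OF that, of k] False by (simp add: fderiv_commute[of k l])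
    have "fderiv k X = 0" "fderiv k Y = 0" "fderiv k Z = 0"
      by (simp_all add: X_def Y_def Z_def out p q)
    then show ?thesis
      using arg_cong[OF jp[OF j], of "fderiv k"] arg_cong[OF jq[OF j], of "fderiv k"]
      by (intro solve) (simp_all add: fderiv_add fderiv_mult out j)
  next
    case k: True
    \<comment> \<open>By \<open>planar\<close> the coefficients are constant in the pivot
      directions, so second derivatives inherit the column relation; compared with the Leibniz rule
      for \<open>jp\<close> and \<open>jq\<close>, this leaves only the k-derivatives of c and
      e.\<close>
    have *: "fderiv k (fderiv l (rat_fun (H i))) = c k * fderiv p (fderiv l (rat_fun (H i))) + e k * fderiv q (fderiv l (rat_fun (H i)))"
      if "i < m" "l = p \<or> l = q" for i l
      using arg_cong[OF col[OF that(1) k], of "fderiv l"] planar[OF k] that(2)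
      by (auto simp: fderiv_commute[of k l] fderiv_commute[of p l] fderiv_commute[of q l] fderiv_add fderiv_mult)
    have "fderiv k X = c k * fderiv p X + e k * fderiv q X" "fderiv k Y = c k * fderiv p Y + e k * fderiv q Y"
      "fderiv k Z = c k * fderiv p Z + e k * fderiv q Z"
      by (simp_all add: X_def Y_def Z_def * p q)
    then show ?thesis
      using *[OF j, of p] *[OF j, of q] planar[OF j]
      by (intro solve) (simp_all add: jp[OF j] jq[OF j] fderiv_add fderiv_mult algebra_simps)
  qed
  then show thesis using fderiv_all_zero that by metis
qed

end

section \<open>Algebraic dependence and image apices\<close>

interpretation mpoly: vector_space "\<lambda>c f. mConst (c :: 'a::field) * f"
  by unfold_locales (simp_all add: distrib_left distrib_right mConst_add mConst_mult mult.assoc)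

text \<open>Bounding each exponent separately, instead of the total degree, gives exactly
  \<open>Suc d ^ n\<close> monomials, which keeps the later count elementary.\<close>

definition exponent_cube :: "nat \<Rightarrow> nat \<Rightarrow> (nat \<Rightarrow>\<^sub>0 nat) set" where
  "exponent_cube n d = {a. Poly_Mapping.keys a \<subseteq> {..<n} \<and> (\<forall>i. Poly_Mapping.lookup a i \<le> d)}"

lemma bij_betw_exponent_cube:
  "bij_betw (\<lambda>a. restrict (Poly_Mapping.lookup a) {..<n}) (exponent_cube n d) ({..<n} \<rightarrow>\<^sub>E {..d})"
  unfolding bij_betw_def
proof
  show "inj_on (\<lambda>a. restrict (Poly_Mapping.lookup a) {..<n}) (exponent_cube n d)"
  proof (rule inj_onI, rule poly_mapping_eqI)
    fix a b i
    assume ab: "a \<in> exponent_cube n d" "b \<in> exponent_cube n d"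
      and eq: "restrict (Poly_Mapping.lookup a) {..<n} = restrict (Poly_Mapping.lookup b) {..<n}"
    show "Poly_Mapping.lookup a i = Poly_Mapping.lookup b i"
    proof (cases "i < n")
      case True then show ?thesis using fun_cong[OF eq, of i] by simp
    next
      case False
      then have "i \<notin> Poly_Mapping.keys a" "i \<notin> Poly_Mapping.keys b"
        using ab by (auto simp: exponent_cube_def)
      then show ?thesis by (simp add: in_keys_iff)
    qed
  qed
  show "(\<lambda>a. restrict (Poly_Mapping.lookup a) {..<n}) ` exponent_cube n d = {..<n} \<rightarrow>\<^sub>E {..d}"
  proof (intro subset_antisym subsetI)
    fix g assume g: "g \<in> {..<n} \<rightarrow>\<^sub>E {..d}"
    define a where "a = Abs_poly_mapping (\<lambda>i. if i < n then g i else 0)"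
    have "finite {i. (if i < n then g i else 0) \<noteq> 0}"
      by (rule finite_subset[of _ "{..<n}"]) auto
    then have a: "Poly_Mapping.lookup a = (\<lambda>i. if i < n then g i else 0)" by (simp add: a_def)
    have "a \<in> exponent_cube n d"
      using g by (auto simp: exponent_cube_def in_keys_iff a PiE_iff split: if_splits)
    moreover have "g = restrict (Poly_Mapping.lookup a) {..<n}"
      using g by (auto simp: a fun_eq_iff PiE_iff extensional_def)
    ultimately show "g \<in> (\<lambda>a. restrict (Poly_Mapping.lookup a) {..<n}) ` exponent_cube n d" by blast
  qed (auto simp: exponent_cube_def split: if_splits)
qed

lemma finite_exponent_cube: "finite (exponent_cube n d)"
  and card_exponent_cube: "card (exponent_cube n d) = Suc d ^ n"
  using bij_betw_finite[OF bij_betw_exponent_cube, of n d] bij_betw_same_card[OF bij_betw_exponent_cube, of n d]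
  by (simp_all add: finite_PiE card_PiE)

lemma exponent_cube_mono: "d \<le> e \<Longrightarrow> exponent_cube n d \<subseteq> exponent_cube n e"
  by (auto simp: exponent_cube_def intro: order_trans)

lemma keys_mult_cube:
  assumes "Poly_Mapping.keys f \<subseteq> exponent_cube n d" "Poly_Mapping.keys g \<subseteq> exponent_cube n e"
  shows "Poly_Mapping.keys (f * g) \<subseteq> exponent_cube n (d + e)"
proof
  fix a assume a: "a \<in> Poly_Mapping.keys (f * g)"
  obtain b c where "a = b + c" "b \<in> Poly_Mapping.keys f" "c \<in> Poly_Mapping.keys g"
    using keys_mult[of f g] a by blast
  moreover have "Poly_Mapping.lookup (b + c) i \<le> d + e"
    if "b \<in> exponent_cube n d" "c \<in> exponent_cube n e" for i
    using that by (auto simp: exponent_cube_def lookup_add intro: add_mono)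
  ultimately show "a \<in> exponent_cube n (d + e)"
    using assms keys_add[of b c] by (fastforce simp: exponent_cube_def)
qed

lemma keys_power_cube:
  fixes f :: "'a::comm_ring_1 mpoly"
  assumes "Poly_Mapping.keys f \<subseteq> exponent_cube n d"
  shows "Poly_Mapping.keys (f ^ k) \<subseteq> exponent_cube n (k * d)"
proof (induction k)
  case 0 show ?case by (auto simp: exponent_cube_def)
next
  case (Suc k) then show ?case using keys_mult_cube[OF assms Suc] by simp
qed

lemma keys_prod_cube:
  fixes f :: "'b \<Rightarrow> 'a::comm_ring_1 mpoly"
  assumes "\<And>i. i \<in> A \<Longrightarrow> Poly_Mapping.keys (f i) \<subseteq> exponent_cube n d" "finite A"
  shows "Poly_Mapping.keys (\<Prod>i\<in>A. f i) \<subseteq> exponent_cube n (card A * d)"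
  using assms(2,1)
proof (induction A)
  case empty show ?case by (auto simp: exponent_cube_def)
next
  case (insert i A) then show ?case using keys_mult_cube[of "f i" n d "prod f A"] by simp
qed

lemma span_monomials:
  assumes "Poly_Mapping.keys f \<subseteq> E"
  shows "(f :: 'a::field mpoly) \<in> mpoly.span ((\<lambda>a. Poly_Mapping.single a 1) ` E)"
proof -
  have "f = (\<Sum>a\<in>Poly_Mapping.keys f. mConst (Poly_Mapping.lookup f a) * Poly_Mapping.single a 1)"
    using poly_mapping_sum_single[of f] by (simp add: mConst_def mult_single)
  also have "\<dots> \<in> mpoly.span ((\<lambda>a. Poly_Mapping.single a 1) ` E)"
    using assms by (intro mpoly.span_sum mpoly.span_scale mpoly.span_base) auto
  finally show ?thesis .
qed

text \<open>Counting: for large d there are more monomials of degree at most d in each of n + 1 variables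
  than dimensions available for their images.\<close>
lemma algebraically_dependent:
  fixes s :: "nat \<Rightarrow> 'a::field mpoly"
  assumes s: "\<And>i. i \<le> n \<Longrightarrow> s i \<in> polys_in n"
  obtains P where "P \<in> polys_in (Suc n)" "P \<noteq> 0" "msubst s P = 0"
proof -
  let ?S = "\<Union>i\<le>n. \<Union>a\<in>Poly_Mapping.keys (s i). Poly_Mapping.lookup a ` {..<n}"
  have "finite ?S" by simp
  then obtain D where D': "\<And>k. k \<in> ?S \<Longrightarrow> k \<le> D"
    unfolding finite_nat_set_iff_bounded_le by auto
  have D: "Poly_Mapping.keys (s i) \<subseteq> exponent_cube n D" if i: "i \<le> n" for i
  proof
    fix a assume a: "a \<in> Poly_Mapping.keys (s i)"
    have keys: "Poly_Mapping.keys a \<subseteq> {..<n}" using s[OF i] a by (auto simp: polys_in_def)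
    have "Poly_Mapping.lookup a k \<le> D" for k
    proof (cases "k < n")
      case True
      then have "Poly_Mapping.lookup a k \<in> ?S" using i a by auto
      then show ?thesis by (rule D')
    next
      case False
      then have "k \<notin> Poly_Mapping.keys a" using keys by auto
      then show ?thesis by (simp add: in_keys_iff)
    qed
    then show "a \<in> exponent_cube n D" using keys by (simp add: exponent_cube_def)
  qed
  \<comment> \<open>The images have exponents at most e = (n+1) d D, so they span at most
    ((n+1)D+1)^n (d+1)^n dimensions. This d makes the bound d (d+1)^n, just below the (d+1)^(n+1)
    available monomials.\<close>
  define d where "d = Suc (Suc n * D) ^ n"
  define E where "E = exponent_cube (Suc n) d"
  define e where "e = Suc n * (d * D)"
  define T :: "'a mpoly set" where "T = (\<lambda>a. Poly_Mapping.single a 1) ` exponent_cube n e"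
  define M where "M a = msubst s (Poly_Mapping.single a 1)" for a
  have E: "finite E" by (simp add: E_def finite_exponent_cube)
  have T: "finite T" by (simp add: T_def finite_exponent_cube)
  have MT: "M a \<in> mpoly.span T" if "a \<in> E" for a
  proof -
    have "M a = (\<Prod>i<Suc n. s i ^ Poly_Mapping.lookup a i)"
      using that by (simp add: M_def msubst_eq_eval_hom eval_hom_single[OF comm_ring_hom_mConst]
          E_def exponent_cube_def monom_eval_superset[of "{..<Suc n}"])
    moreover have "Poly_Mapping.keys (s i ^ Poly_Mapping.lookup a i) \<subseteq> exponent_cube n (d * D)" if "i < Suc n" for i
    proof -
      have "Poly_Mapping.lookup a i * D \<le> d * D"
        using \<open>a \<in> E\<close> by (simp add: E_def exponent_cube_def)
      then show ?thesis
        using keys_power_cube[OF D, of i "Poly_Mapping.lookup a i"] exponent_cube_mono that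
        by (metis less_Suc_eq_le order_trans)
    qed
    ultimately have "Poly_Mapping.keys (M a) \<subseteq> exponent_cube n e"
      using keys_prod_cube[of "{..<Suc n}" "\<lambda>i. s i ^ Poly_Mapping.lookup a i" n "d * D"]
      unfolding e_def card_lessThan by simp
    then show ?thesis unfolding T_def by (rule span_monomials)
  qed
  have "card T \<le> card (exponent_cube n e)" unfolding T_def by (intro card_image_le finite_exponent_cube)
  also have "\<dots> = Suc e ^ n" by (rule card_exponent_cube)
  also have "\<dots> \<le> (Suc (Suc n * D) * Suc d) ^ n"
  proof (intro power_mono)
    have "e = Suc n * D * d" by (simp only: e_def mult.assoc mult.commute[of d])
    then show "Suc e \<le> Suc (Suc n * D) * Suc d" by simp
  qed simp
  also have "\<dots> = d * Suc d ^ n" by (simp only: d_def power_mult_distrib)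
  also have "\<dots> < Suc d ^ Suc n" unfolding power_Suc by (rule mult_strict_right_mono) simp_all
  also have "\<dots> = card E" by (simp only: E_def card_exponent_cube)
  finally have card: "card T < card E" .
  have single_in: "Poly_Mapping.single a c \<in> polys_in (Suc n)" if "a \<in> E" for a and c :: 'a
    using that by (auto simp: E_def exponent_cube_def polys_in_def split: if_splits)
  show thesis
  proof (cases "inj_on M E")
    case False
    then obtain a b where ab: "a \<in> E" "b \<in> E" "a \<noteq> b" "M a = M b" by (auto simp: inj_on_def)
    define P :: "'a mpoly" where "P = Poly_Mapping.single a 1 + Poly_Mapping.single b (- 1)"
    have "Poly_Mapping.lookup P a = 1" using ab by (simp add: P_def lookup_add lookup_single)
    then have "P \<noteq> 0" by auto
    moreover have "Poly_Mapping.single b (- 1) = - Poly_Mapping.single b (1 :: 'a)" by (rule single_uminus)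
    then have "msubst s P = 0" using ab by (simp add: P_def msubst.hom_minus M_def)
    ultimately show thesis using that[of P] ab single_in by (simp add: P_def polys_in_add)
  next
    case True
    have "mpoly.dependent (M ` E)"
    proof (rule ccontr)
      assume "\<not> mpoly.dependent (M ` E)"
      then have "card (M ` E) \<le> card T"
        using mpoly.independent_span_bound[OF T] MT by blast
      then show False using card card_image[OF True] by simp
    qed
    then obtain u where u: "\<exists>v\<in>M ` E. u v \<noteq> 0" "(\<Sum>v\<in>M ` E. mConst (u v) * v) = 0"
      using mpoly.dependent_finite[of "M ` E"] E by auto
    define P where "P = (\<Sum>a\<in>E. Poly_Mapping.single a (u (M a)))"
    have "Poly_Mapping.lookup P a = u (M a)" if "a \<in> E" for a
      using that E by (simp add: P_def lookup_sum lookup_single when_def)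
    then have "P \<noteq> 0" using u(1) by auto
    moreover have "P \<in> polys_in (Suc n)"
    proof -
      have "(\<Sum>a\<in>A. Poly_Mapping.single a (u (M a))) \<in> polys_in (Suc n)" if "A \<subseteq> E" for A
        using that by (induction A rule: infinite_finite_induct) (auto simp: polys_in_zero intro: polys_in_add single_in)
      then show ?thesis by (simp add: P_def)
    qed
    moreover have "msubst s P = 0"
    proof -
      have "msubst s (Poly_Mapping.single a k) = mConst k * M a" for a k
        by (simp add: M_def msubst_eq_eval_hom eval_hom_single[OF comm_ring_hom_mConst])
      then have "msubst s P = (\<Sum>a\<in>E. mConst (u (M a)) * M a)"
        by (simp add: P_def msubst.hom_sum)
      also have "\<dots> = (\<Sum>v\<in>M ` E. mConst (u v) * v)" by (simp add: sum.reindex[OF True])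
      finally show ?thesis using u(2) by simp
    qed
    ultimately show thesis using that by blast
  qed
qed

text \<open>In characteristic zero a variable with zero partial derivative does not occur in P, so
  its substituted value is irrelevant.\<close>

lemma msubst_cong_mpderiv:
  fixes P :: "'a::field_char_0 mpoly"
  assumes P: "P \<in> polys_in n" and "\<And>i. i < n \<Longrightarrow> mpderiv i P = 0 \<or> s i = t i"
  shows "msubst s P = msubst t P"
  unfolding msubst_def
proof (intro sum.cong refl arg_cong2[of _ _ _ _ "(*)"] prod.cong)
  fix a i assume a: "a \<in> Poly_Mapping.keys P" and i: "i \<in> Poly_Mapping.keys a"
  have "a - Poly_Mapping.single i 1 + Poly_Mapping.single i 1 = a"
    using i by (intro poly_mapping_eqI) (auto simp: lookup_add lookup_minus lookup_single when_def in_keys_iff)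
  then have "Poly_Mapping.lookup (mpderiv i P) (a - Poly_Mapping.single i 1) \<noteq> 0"
    using a i by (simp add: lookup_mpderiv in_keys_iff of_nat_Suc[symmetric] del: of_nat_Suc)
  then have "mpderiv i P \<noteq> 0" by auto
  moreover have "i < n" using P a i by (auto simp: polys_in_def)
  ultimately show "s i ^ Poly_Mapping.lookup a i = t i ^ Poly_Mapping.lookup a i" using assms(2) by metis
qed

lemma comm_ring_hom_rat_fun_mConst: "comm_ring_hom (\<lambda>c. rat_fun (mConst c))"
  by unfold_locales (simp_all add: mConst_add mConst_mult)

lemma rat_fun_msubst: "rat_fun (msubst s f) = eval_hom (\<lambda>c. rat_fun (mConst c)) (\<lambda>i. rat_fun (s i)) f"
  by (induction f rule: mpoly_induct)
    (simp_all add: msubst.hom_add msubst.hom_mult eval_hom_mConst eval_hom_mVar eval_hom_add eval_hom_mult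
      comm_ring_hom_rat_fun_mConst)

lemma vfield_msubst:
  assumes "f \<in> polys_in n"
  shows "vfield I \<nu> (rat_fun (msubst s f)) = (\<Sum>i<n. rat_fun (msubst s (mpderiv i f)) * vfield I \<nu> (rat_fun (s i)))"
  unfolding rat_fun_msubst
  by (rule chain_rule[OF comm_ring_hom_rat_fun_mConst assms])
    (simp_all add: vfield_simps, simp add: vfield_def fderiv_rat_fun)

context gradient_map begin

text \<open>The relation of least degree between \<open>H p\<close>, \<open>H q\<close>, \<open>H j\<close> and the remaining variables does not
  involve the latter, because the vector fields killing H differentiate it with respect to
  them.  Its gradient is proportional to (-c, -e, 1), and the apex property tests that
  gradient against the apex.\<close>
lemma apex_cone:
  fixes \<beta> :: "nat \<Rightarrow> 'a"
  assumes p: "p < m" and q: "q < m" and j: "j < m" and pq: "p \<noteq> q"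
    and nz: "fderiv p (rat_fun (H p)) * fderiv q (rat_fun (H q)) - fderiv p (rat_fun (H q)) * fderiv p (rat_fun (H q)) \<noteq> 0"
    and col: "\<And>i k. i < m \<Longrightarrow> k < m \<Longrightarrow>
      fderiv k (rat_fun (H i)) = c k * fderiv p (rat_fun (H i)) + e k * fderiv q (rat_fun (H i))"
    and apex: "image_apex m H \<beta>"
  shows "rat_fun (H j - mConst (\<beta> j)) =
      c j * rat_fun (H p - mConst (\<beta> p)) + e j * rat_fun (H q - mConst (\<beta> q))"
proof -
  define X Y Z where "X = fderiv p (rat_fun (H p))" and "Y = fderiv p (rat_fun (H q))" and "Z = fderiv q (rat_fun (H q))"
  have Yq: "fderiv q (rat_fun (H p)) = Y" unfolding Y_def by (rule fderiv_symmetric[OF q p])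
  have nz: "X * Z - Y * Y \<noteq> 0" using nz by (simp add: X_def Y_def Z_def)
  note solve = nondegenerate_form[OF nz]
  have jp: "fderiv p (rat_fun (H j)) = c j * X + e j * Y" if "j < m" for j
    using col[OF p that] fderiv_symmetric[OF p that] by (simp add: X_def Yq)
  have jq: "fderiv q (rat_fun (H j)) = c j * Y + e j * Z" if "j < m" for j
    using col[OF q that] fderiv_symmetric[OF q that] by (simp add: Y_def Z_def)
  \<comment> \<open>Variable m is a placeholder for \<open>H j\<close>, while p and q stand for
    \<open>H p\<close> and \<open>H q\<close>. These are m + 1 polynomials in m variables, hence
    dependent; keeping the other variables is what makes the count work.\<close>
  define s where "s i = (if i = m then H j else if i = p \<or> i = q then H i else mVar i)" for i
  have s_simps: "s p = H p" "s q = H q" "s m = H j" using p q by (auto simp: s_def)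
  define relation where "relation d P \<longleftrightarrow> P \<in> polys_in (Suc m) \<and> P \<noteq> 0 \<and> msubst s P = 0 \<and> tdeg_less d P" for d P
  have "s i \<in> polys_in m" if "i \<le> m" for i
    using that H_in p q j polys_in_mVar[of i m] by (auto simp: s_def)
  then have "\<exists>d P. relation d P"
    using algebraically_dependent[of m s] tdeg_less_exists by (metis relation_def)
  then obtain P d where "relation d P" and least: "\<And>d' P'. d' < d \<Longrightarrow> \<not> relation d' P'"
    using exists_least_iff[of "\<lambda>d. \<exists>P. relation d P"] by auto
  then have P: "P \<in> polys_in (Suc m)" "P \<noteq> 0" "msubst s P = 0" "tdeg_less d P"
    by (simp_all add: relation_def)
  obtain d' where d: "d = Suc d'" using P by (cases d) auto
  \<comment> \<open>A partial of P has smaller degree, so by minimality it cannot be a nonzero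
    relation.\<close>
  have minimal: "mpderiv i P = 0" if "msubst s (mpderiv i P) = 0" for i
    using least[of d' "mpderiv i P"] that P d by (auto simp: relation_def mpderiv_polys_in tdeg_less_mpderiv)
  have transversal: "mpderiv k P = 0" if k: "k < m" "k \<noteq> p" "k \<noteq> q" for k
  proof -
    define \<nu> where "\<nu> l = (if l = k then 1 else if l = p then - c k else - e k)" for l
    have \<nu>: "vfield {k, p, q} \<nu> z = fderiv k z - c k * fderiv p z - e k * fderiv q z" for z
      using k pq by (auto simp: \<nu>_def vfield_def)
    have "vfield {k, p, q} \<nu> (rat_fun (s i)) = (if i = k then 1 else 0)" if "i < Suc m" for i
    proof (cases "i = m \<or> i = p \<or> i = q")
      case True
      then have "s i = H j \<or> s i = H p \<or> s i = H q" "i \<noteq> k" using k by (auto simp: s_def)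
      then show ?thesis using col[OF _ k(1)] j p q by (auto simp: \<nu>)
    next
      case False
      then show ?thesis using k that by (auto simp: \<nu> s_def fderiv_rat_fun mpderiv_mVar)
    qed
    then have "vfield {k, p, q} \<nu> (rat_fun (msubst s P)) = (\<Sum>i<Suc m. if i = k then rat_fun (msubst s (mpderiv i P)) else 0)"
      by (subst vfield_msubst[OF P(1)]) (intro sum.cong, auto)
    also have "\<dots> = rat_fun (msubst s (mpderiv k P))" using k by simp
    finally have "msubst s (mpderiv k P) = 0" by (simp add: P(3) vfield_simps)
    then show ?thesis by (rule minimal)
  qed
  define u where "u i = msubst s (mpderiv i P)" for i
  have zero_sum: "(\<Sum>i<Suc m. rat_fun (msubst t (mpderiv i P)) * w i) =
      rat_fun (msubst t (mpderiv p P)) * w p + rat_fun (msubst t (mpderiv q P)) * w q + rat_fun (msubst t (mpderiv m P)) * w m"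
    for t w
  proof -
    have "(\<Sum>i<Suc m. rat_fun (msubst t (mpderiv i P)) * w i) = (\<Sum>i\<in>{p, q, m}. rat_fun (msubst t (mpderiv i P)) * w i)"
      using p q transversal by (intro sum.mono_neutral_right) (auto simp: less_Suc_eq)
    then show ?thesis using p q pq by (simp add: algebra_simps)
  qed
  have row: "rat_fun (u p) * fderiv k (rat_fun (H p)) + rat_fun (u q) * fderiv k (rat_fun (H q)) + rat_fun (u m) * fderiv k (rat_fun (H j)) = 0" for k
  proof -
    have "vfield {k} (\<lambda>_. 1) (rat_fun (msubst s P)) = 0" by (simp add: P(3) vfield_simps)
    then show ?thesis
      unfolding vfield_msubst[OF P(1)] zero_sum by (simp add: u_def s_simps vfield_def)
  qed
  have upq: "rat_fun (u p) + c j * rat_fun (u m) = 0 \<and> rat_fun (u q) + e j * rat_fun (u m) = 0"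
  proof (rule solve)
    show "(rat_fun (u p) + c j * rat_fun (u m)) * X + (rat_fun (u q) + e j * rat_fun (u m)) * Y = 0"
      using row[of p] by (simp add: jp[OF j] X_def[symmetric] Y_def[symmetric] algebra_simps)
    show "(rat_fun (u p) + c j * rat_fun (u m)) * Y + (rat_fun (u q) + e j * rat_fun (u m)) * Z = 0"
      using row[of q] by (simp add: jq[OF j] Yq Z_def[symmetric] algebra_simps)
  qed
  \<comment> \<open>Otherwise all three components vanish, minimality kills every partial of P, and
    P is a nonzero constant, which is no relation.\<close>
  have um: "u m \<noteq> 0"
  proof
    assume "u m = 0"
    then have "u p = 0" "u q = 0" using upq by simp_all
    then have "mpderiv i P = 0" for i
      using minimal[of i] transversal[of i] \<open>u m = 0\<close> mpderiv_outside[OF P(1), of i]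
      by (cases "i < Suc m") (auto simp: u_def less_Suc_eq)
    then have "P = mConst (meval (\<lambda>_. 0) P)" by (rule mpderiv_all_zero)
    then have "msubst s P = P" by (metis msubst_mConst)
    then show False using P by simp
  qed
  define G where "G i = (1 - mVar m) * H i + mVar m * mConst (\<beta> i)" for i
  \<comment> \<open>Renaming the placeholder m to j produces a polynomial in m variables, to which
    the apex property applies. Sending the remaining variables to 0 is harmless, since they do not
    occur in P.\<close>
  define \<rho> :: "nat \<Rightarrow> 'a mpoly" where "\<rho> i = (if i = m then mVar j else if i = p \<or> i = q then mVar i else 0)" for i
  have subst: "msubst t (msubst \<rho> P) = msubst (\<lambda>i. if i = m then t j else if i = p \<or> i = q then t i else mVar i) P" for t
    unfolding msubst_msubst
    by (rule msubst_cong_mpderiv[OF P(1)]) (use transversal in \<open>auto simp: \<rho>_def less_Suc_eq\<close>)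
  have "msubst \<rho> P \<in> polys_in m"
    by (rule msubst_polys_in[OF P(1)]) (use p q j in \<open>auto simp: \<rho>_def polys_in_zero intro: polys_in_mVar\<close>)
  moreover have "msubst H (msubst \<rho> P) = 0"
    unfolding subst using P(3) by (simp add: s_def[abs_def])
  ultimately have G0: "msubst G (msubst \<rho> P) = 0"
    using apex unfolding image_apex_def G_def[abs_def] by blast
  \<comment> \<open>Variable m has two roles: inside P it is the placeholder for \<open>H j\<close>,
    in the substituted polynomials it is the cone parameter t.\<close>
  define g where "g i = (if i = m then G j else if i = p \<or> i = q then G i else mVar i)" for i
  have g_simps: "g p = G p" "g q = G q" "g m = G j" using p q by (auto simp: g_def)
  have g0: "msubst g P = 0" using G0 unfolding subst g_def[abs_def] .
  \<comment> \<open>Substituting \<zeta> sets t = 0, where the cone over H returns to H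
    itself.\<close>
  define \<zeta> :: "nat \<Rightarrow> 'a mpoly" where "\<zeta> i = (if i = m then 0 else mVar i)" for i
  have msubst_id: "msubst mVar f = f" for f :: "'a mpoly"
    by (induction f rule: mpoly_induct) (simp_all add: msubst.hom_add msubst.hom_mult)
  have \<zeta>H: "msubst \<zeta> (H i) = H i" if "i < m" for i
    using msubst_cong[OF H_in[OF that], of \<zeta> mVar] by (simp add: \<zeta>_def msubst_id)
  have \<zeta>G: "msubst \<zeta> (G i) = H i" if "i < m" for i
    using that by (simp add: G_def msubst.hom_add msubst.hom_mult msubst.hom_minus \<zeta>H) (simp add: \<zeta>_def)
  have dG: "mpderiv m (G i) = mConst (\<beta> i) - H i" if "i < m" for i
    using mpderiv_outside[OF H_in[OF that], of m]
    by (simp add: G_def mpderiv_add mpderiv_mult mpderiv_diff mpderiv_mVar)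
  have "msubst \<zeta> (msubst g f) = msubst s f" if "f \<in> polys_in (Suc m)" for f
    unfolding msubst_msubst
    by (rule msubst_cong[OF that]) (use p q j \<zeta>G in \<open>auto simp: g_def s_def \<zeta>_def\<close>)
  then have \<zeta>u: "msubst \<zeta> (msubst g (mpderiv i P)) = u i" for i
    using P(1) by (simp add: u_def mpderiv_polys_in)
  \<comment> \<open>The t-derivative of the cone relation at t = 0 pairs the gradient u with \<beta>
    - H, the velocity of the segment from H to the apex.\<close>
  have "vfield {m} (\<lambda>_. 1) (rat_fun (msubst g P)) = 0" by (simp add: g0 vfield_simps)
  then have "rat_fun (msubst g (mpderiv p P) * mpderiv m (G p) + msubst g (mpderiv q P) * mpderiv m (G q)
      + msubst g (mpderiv m P) * mpderiv m (G j)) = 0"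
    unfolding vfield_msubst[OF P(1)] zero_sum by (simp add: g_simps vfield_def fderiv_rat_fun)
  then have "msubst g (mpderiv p P) * (mConst (\<beta> p) - H p) + msubst g (mpderiv q P) * (mConst (\<beta> q) - H q)
      + msubst g (mpderiv m P) * (mConst (\<beta> j) - H j) = 0"
    unfolding rat_fun_eq_0_iff dG[OF p] dG[OF q] dG[OF j] .
  from arg_cong[OF this, of "msubst \<zeta>"]
  have "u p * (mConst (\<beta> p) - H p) + u q * (mConst (\<beta> q) - H q) + u m * (mConst (\<beta> j) - H j) = 0"
    by (simp add: msubst.hom_add msubst.hom_mult msubst.hom_minus \<zeta>u \<zeta>H p q j)
  from arg_cong[OF this, of rat_fun]
  have apex_row: "rat_fun (u p) * rat_fun (mConst (\<beta> p) - H p) + rat_fun (u q) * rat_fun (mConst (\<beta> q) - H q)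
      + rat_fun (u m) * rat_fun (mConst (\<beta> j) - H j) = 0"
    by (simp only: rat_fun_simps)
  have "rat_fun (u p) = - c j * rat_fun (u m)" "rat_fun (u q) = - e j * rat_fun (u m)"
    using upq by (simp_all add: eq_neg_iff_add_eq_0)
  with apex_row have "rat_fun (u m) * (rat_fun (H j - mConst (\<beta> j)) -
      (c j * rat_fun (H p - mConst (\<beta> p)) + e j * rat_fun (H q - mConst (\<beta> q)))) = 0"
    by (simp add: algebra_simps)
  then show ?thesis using um by simp
qed

text \<open>The relations of H are closed under differentiation along w, so they vanish to all orders along
  w at every value of H.\<close>
lemma relation_translate:
  assumes w: "\<Delta> \<noteq> 0" "\<And>i. i < m \<Longrightarrow> \<Delta> * mConst (w i) = (\<Sum>k<m. \<omega> k * mpderiv k (H i))"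
    and f: "f \<in> polys_in m" "msubst H f = 0"
  shows "meval (\<lambda>i. meval x (H i) + w i) f = 0"
proof -
  \<comment> \<open>By the chain rule the gradient of f along H is orthogonal to every Jacobian
    column. Multiplied by \<Delta>, the vector w is a combination of columns, and \<Delta>
    cancels.\<close>
  have dir: "msubst H (\<Sum>i<m. mConst (w i) * mpderiv i f) = 0" if f: "f \<in> polys_in m" "msubst H f = 0" for f
  proof -
    have "(\<Sum>i<m. msubst H (mpderiv i f) * mpderiv k (H i)) = 0" for k
      using mpderiv_msubst[OF f(1), of k H] f(2) by simp
    then have "0 = (\<Sum>k<m. \<omega> k * (\<Sum>i<m. msubst H (mpderiv i f) * mpderiv k (H i)))" by simp
    also have "\<dots> = (\<Sum>i<m. msubst H (mpderiv i f) * (\<Sum>k<m. \<omega> k * mpderiv k (H i)))"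
      unfolding sum_distrib_left by (subst sum.swap) (simp add: ac_simps)
    also have "\<dots> = \<Delta> * (\<Sum>i<m. msubst H (mpderiv i f) * mConst (w i))"
      by (simp add: w(2)[symmetric] sum_distrib_left ac_simps)
    finally have "(\<Sum>i<m. msubst H (mpderiv i f) * mConst (w i)) = 0" using w(1) by simp
    then show ?thesis by (simp add: msubst.hom_sum msubst.hom_mult mult.commute)
  qed
  \<comment> \<open>Induction on the degree: restricted to the line, the derivative of f is the
    restriction of a relation of smaller degree, and f itself vanishes at the starting point
    H(x).\<close>
  have "\<forall>f\<in>polys_in m. msubst H f = 0 \<longrightarrow> tdeg_less d f \<longrightarrow> on_line (\<lambda>i. meval x (H i)) w f = 0" for d
  proof (induction d)
    case (Suc d)
    show ?case
    proof (intro ballI impI)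
      fix f assume f: "f \<in> polys_in m" "msubst H f = 0" "tdeg_less (Suc d) f"
      let ?g = "\<Sum>i<m. mConst (w i) * mpderiv i f" and ?L = "on_line (\<lambda>i. meval x (H i)) w"
      have sum_in: "(\<Sum>i\<in>A. mConst (w i) * mpderiv i f) \<in> polys_in m" for A
        by (induction A rule: infinite_finite_induct)
          (auto simp: polys_in_zero intro!: polys_in_add polys_in_mult polys_in_mConst mpderiv_polys_in f)
      have "tdeg_less d ?g"
      proof -
        have "Poly_Mapping.keys (mConst (w i) * mpderiv i f) \<subseteq> Poly_Mapping.keys (mpderiv i f)" for i
          using keys_mult[of "mConst (w i)" "mpderiv i f"] by (auto simp: mConst_def split: if_splits)
        then have "Poly_Mapping.keys ?g \<subseteq> (\<Union>i<m. Poly_Mapping.keys (mpderiv i f))"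
          using keys_sum[of "\<lambda>i. mConst (w i) * mpderiv i f" "{..<m}"] by blast
        then show ?thesis
          using tdeg_less_mpderiv[OF f(3)] unfolding tdeg_less_def by blast
      qed
      then have "?L ?g = 0" using Suc dir[OF f(1,2)] sum_in by blast
      moreover have "?L (mConst c) = [:c:]" for c
        by (simp add: on_line_def eval_hom_mConst comm_ring_hom_pCons)
      ultimately have "pderiv (?L f) = 0"
        by (simp add: pderiv_on_line[OF f(1)] on_line.hom_sum on_line.hom_mult)
      moreover have "poly (?L f) 0 = 0"
        using arg_cong[OF f(2), of "meval x"] by (simp add: poly_on_line meval_msubst)
      ultimately have "poly (?L f) t = 0" for t using poly_pderiv_zero_const by metis
      then show "?L f = 0" using poly_all_0_iff_0 by blast
    qed
  qed simp
  then have "on_line (\<lambda>i. meval x (H i)) w f = 0" using f tdeg_less_exists by blast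
  then show ?thesis using poly_on_line[of "\<lambda>i. meval x (H i)" w f 1] by simp
qed

end

section \<open>Ranks and columns\<close>

context vec_space begin

text \<open>Coefficients are indexed by the vectors themselves. For a finite set, coefficients on a
  subset extend by 0, so the existential over subsets disappears and only coordinate equations
  remain.\<close>

lemma lin_indpt_finite_iff:
  assumes S: "finite S" "S \<subseteq> carrier_vec n"
  shows "lin_indpt S \<longleftrightarrow> (\<forall>a. (\<forall>i<n. (\<Sum>x\<in>S. a x * x $ i) = 0) \<longrightarrow> (\<forall>x\<in>S. a x = 0))"
proof -
  have lincomb0: "lincomb a S = 0\<^sub>v n \<longleftrightarrow> (\<forall>i<n. (\<Sum>x\<in>S. a x * x $ i) = 0)" for a
  proof -
    have dim: "dim_vec (lincomb a S) = n" using S by (simp add: lincomb_dim)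
    have index: "lincomb a S $ i = (\<Sum>x\<in>S. a x * x $ i)" if "i < n" for i
      by (rule lincomb_index[OF that S(2)])
    show ?thesis
    proof
      assume "lincomb a S = 0\<^sub>v n"
      then show "\<forall>i<n. (\<Sum>x\<in>S. a x * x $ i) = 0" by (metis index index_zero_vec(1))
    next
      assume "\<forall>i<n. (\<Sum>x\<in>S. a x * x $ i) = 0"
      then show "lincomb a S = 0\<^sub>v n" by (intro eq_vecI) (simp_all add: index dim)
    qed
  qed
  show ?thesis
  proof
    assume ind: "lin_indpt S"
    show "\<forall>a. (\<forall>i<n. (\<Sum>x\<in>S. a x * x $ i) = 0) \<longrightarrow> (\<forall>x\<in>S. a x = 0)"
    proof (intro allI impI ballI, rule ccontr)
      fix a x assume a: "\<forall>i<n. (\<Sum>x\<in>S. a x * x $ i) = 0" and x: "x \<in> S" "a x \<noteq> 0"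
      have "lin_dep S"
        unfolding lin_dep_def
        using lincomb0[of a] a x S(1) by (intro exI[of _ S] exI[of _ a] exI[of _ x]) simp
      then show False using ind by simp
    qed
  next
    assume *: "\<forall>a. (\<forall>i<n. (\<Sum>x\<in>S. a x * x $ i) = 0) \<longrightarrow> (\<forall>x\<in>S. a x = 0)"
    show "lin_indpt S"
    proof
      assume "lin_dep S"
      then obtain A a v where A: "finite A" "A \<subseteq> S" "lincomb a A = 0\<^sub>v n" and v: "v \<in> A" "a v \<noteq> 0"
        unfolding lin_dep_def by auto
      define b where "b x = (if x \<in> A then a x else 0)" for x
      have "(\<Sum>x\<in>S. b x * x $ i) = 0" if "i < n" for i
      proof -
        have "(\<Sum>x\<in>S. b x * x $ i) = (\<Sum>x\<in>A. a x * x $ i)"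
          using S(1) A(2) by (intro sum.mono_neutral_cong_right) (auto simp: b_def)
        also have "\<dots> = lincomb a A $ i" using lincomb_index[OF that] A(2) S(2) by auto
        finally show ?thesis using A(3) that by simp
      qed
      then have "b v = 0" using * v(1) A(2) by blast
      then show False using v by (simp add: b_def)
    qed
  qed
qed

lemma lin_indpt_coeff_zero:
  assumes "lin_indpt S" "finite S" "S \<subseteq> carrier_vec n"
    and "\<forall>i<n. (\<Sum>x\<in>S. a x * x $ i) = 0" "x \<in> S"
  shows "a x = 0"
  using assms(1,4,5) unfolding lin_indpt_finite_iff[OF assms(2,3)] by blast

text \<open>A maximal independent set of columns has as many elements as the rank, and maximality
  puts every other column in its span. Choosing the basis among the columns makes pivots coordinate
  directions.\<close>

lemma rank_basis:
  assumes A: "A \<in> carrier_mat n nc"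
  shows "\<exists>S\<subseteq>set (cols A). lin_indpt S \<and> card S = rank A \<and>
    (\<forall>v\<in>set (cols A). \<exists>a. \<forall>i<n. v $ i = (\<Sum>x\<in>S. a x * x $ i))"
proof -
  let ?P = "\<lambda>T. T \<subseteq> set (cols A) \<and> lin_indpt T"
  have carrier: "set (cols A) \<subseteq> carrier_vec n" using A cols_dim by blast
  have "?P {}" by (simp add: lin_dep_def)
  then obtain S where S: "maximal S ?P" "finite S"
    using maximal_exists_superset[of "set (cols A)" ?P "{}"] by auto
  have P: "?P S" using S by (simp add: maximal_def)
  have "\<exists>a. \<forall>i<n. v $ i = (\<Sum>x\<in>S. a x * x $ i)" if v: "v \<in> set (cols A)" for v
  proof -
    have "v \<in> span S"
    proof (cases "v \<in> S")
      case True then show ?thesis using P carrier by (intro span_mem) auto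
    next
      case False
      have "\<not> lin_indpt (S \<union> {v})"
        using S(1) False v P by (auto simp: maximal_def)
      then show ?thesis using lin_dep_iff_in_span[of S v] P carrier v False by auto
    qed
    then obtain a where "v = lincomb a S"
      using finite_in_span[OF S(2), of v] P carrier by blast
    then show ?thesis using lincomb_index[of _ S a] P carrier by auto
  qed
  then show ?thesis using P rank_card_indpt[OF A S(1)] by (intro exI[of _ S] conjI ballI) simp_all
qed

text \<open>The only column outside U can be the zero vector, which no independent set contains, so
  U is maximal. This covers the degenerate matrices with q = 0 or p = q = 0.\<close>

lemma rank_eq_card:
  assumes A: "A \<in> carrier_mat n nc" and U: "U \<subseteq> set (cols A)" "lin_indpt U"
    "set (cols A) \<subseteq> insert (0\<^sub>v n) U"
  shows "rank A = card U"
proof (rule rank_card_indpt[OF A])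
  have "0\<^sub>v n \<notin> T" if T: "T \<subseteq> set (cols A)" "lin_indpt T" for T
  proof
    assume 0: "0\<^sub>v n \<in> T"
    have fin: "finite T" "T \<subseteq> carrier_vec n"
      using T(1) A cols_dim[of A] finite_subset[OF T(1)] by auto
    define a :: "'a vec \<Rightarrow> 'a" where "a x = (if x = 0\<^sub>v n then 1 else 0)" for x
    have "\<forall>i<n. (\<Sum>x\<in>T. a x * x $ i) = 0"
      by (intro allI impI sum.neutral) (simp add: a_def)
    then have "a (0\<^sub>v n) = 0"
      using T(2) 0 unfolding lin_indpt_finite_iff[OF fin] by blast
    then show False by (simp add: a_def)
  qed
  then show "maximal U (\<lambda>T. T \<subseteq> set (cols A) \<and> lin_indpt T)"
    using U by (auto simp: maximal_def)
qed

end

lemma rank_zero_cols: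
  assumes "\<And>i. i < m \<Longrightarrow> p i = (0 :: 'a::field)" "\<And>i. i < m \<Longrightarrow> q i = 0"
  shows "vec_space.rank m (mat_of_cols m [vec m p]) = 0"
    and "vec_space.rank m (mat_of_cols m [vec m p, vec m q]) = 0"
proof -
  interpret vec_space "TYPE('a)" m .
  have z: "vec m p = 0\<^sub>v m" "vec m q = 0\<^sub>v m" using assms by (auto intro!: eq_vecI)
  have e: "lin_indpt {}" by (simp add: lin_dep_def)
  show "rank (mat_of_cols m [vec m p]) = 0"
    using rank_eq_card[OF mat_of_cols_carrier(1)[of m "[vec m p]"], of "{}"] e by (simp add: z)
  show "rank (mat_of_cols m [vec m p, vec m q]) = 0"
    using rank_eq_card[OF mat_of_cols_carrier(1)[of m "[vec m p, vec m q]"], of "{}"] e by (simp add: z)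
qed

lemma rank_one_col:
  assumes i: "i < m" "p i \<noteq> (0 :: 'a::field)" and q: "\<And>i. i < m \<Longrightarrow> q i = 0"
  shows "vec_space.rank m (mat_of_cols m [vec m p]) = 1"
    and "vec_space.rank m (mat_of_cols m [vec m p, vec m q]) = 1"
proof -
  interpret vec_space "TYPE('a)" m .
  have z: "vec m q = 0\<^sub>v m" using q by (auto intro!: eq_vecI)
  have e: "lin_indpt {vec m p}"
    by (subst lin_indpt_finite_iff) (use i in auto)
  show "rank (mat_of_cols m [vec m p]) = 1"
    using rank_eq_card[OF mat_of_cols_carrier(1)[of m "[vec m p]"], of "{vec m p}"] e by simp
  show "rank (mat_of_cols m [vec m p, vec m q]) = 1"
    using rank_eq_card[OF mat_of_cols_carrier(1)[of m "[vec m p, vec m q]"], of "{vec m p}"] e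
    by (simp add: z)
qed

lemma rank_two_cols:
  fixes p q :: "nat \<Rightarrow> 'a::field"
  assumes ind: "\<And>a b. (\<And>i. i < m \<Longrightarrow> a * p i + b * q i = 0) \<Longrightarrow> a = 0 \<and> b = 0"
  shows "vec_space.rank m (mat_of_cols m [vec m p, vec m q]) = 2"
proof -
  interpret vec_space "TYPE('a)" m .
  have ne: "vec m p \<noteq> vec m q"
  proof
    assume "vec m p = vec m q"
    then have "1 * p i + (- 1) * q i = 0" if "i < m" for i
      using that by (metis add.right_inverse index_vec mult_1 mult_minus_left)
    then show False using ind[of 1 "- 1"] by simp
  qed
  have "lin_indpt {vec m p, vec m q}"
  proof -
    have "\<forall>x\<in>{vec m p, vec m q}. a x = 0" if a: "\<forall>i<m. (\<Sum>x\<in>{vec m p, vec m q}. a x * x $ i) = 0" for a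
    proof -
      have "a (vec m p) = 0 \<and> a (vec m q) = 0"
        by (rule ind) (use a ne in auto)
      then show ?thesis by simp
    qed
    moreover have "finite {vec m p, vec m q}" "{vec m p, vec m q} \<subseteq> carrier_vec m" by auto
    ultimately show ?thesis using lin_indpt_finite_iff by blast
  qed
  then show ?thesis
    using rank_eq_card[OF mat_of_cols_carrier(1)[of m "[vec m p, vec m q]"], of "{vec m p, vec m q}"] ne
    by simp
qed

lemma col_jacobian:
  "v \<in> set (cols (jacobian m H)) \<longleftrightarrow> (\<exists>k<m. v = vec m (\<lambda>i. fderiv k (rat_fun (H i))))"
proof -
  have col: "col (jacobian m H) k = vec m (\<lambda>i. fderiv k (rat_fun (H i)))" if "k < m" for k
    using that by (intro eq_vecI) (simp_all add: jacobian_def fderiv_rat_fun, simp_all add: rat_fun_def)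
  have "set (cols (jacobian m H)) = col (jacobian m H) ` {..<m}"
    by (auto simp: cols_def jacobian_def)
  also have "\<dots> = (\<lambda>k. vec m (\<lambda>i. fderiv k (rat_fun (H i)))) ` {..<m}"
    by (rule image_cong) (simp_all add: col)
  finally show ?thesis by auto
qed

lemma jacobian_carrier: "jacobian m H \<in> carrier_mat m m"
  by (simp add: jacobian_def)

lemma jacobian_rank_0:
  fixes H :: "nat \<Rightarrow> 'a::field_char_0 mpoly"
  assumes "vec_space.rank m (jacobian m H) = 0" "i < m" "k < m"
  shows "mpderiv k (H i) = 0"
proof -
  interpret vec_space "TYPE('a mpoly fract)" m .
  obtain S where "S \<subseteq> set (cols (jacobian m H)) \<and> lin_indpt S \<and> card S = rank (jacobian m H) \<and>
    (\<forall>v\<in>set (cols (jacobian m H)). \<exists>a. \<forall>i<m. v $ i = (\<Sum>x\<in>S. a x * x $ i))"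
    using rank_basis[OF jacobian_carrier[of m H]] by (rule exE)
  note S = this[THEN conjunct1] this[THEN conjunct2, THEN conjunct1]
    this[THEN conjunct2, THEN conjunct2, THEN conjunct1] this[THEN conjunct2, THEN conjunct2, THEN conjunct2]
  have "finite S" using S(1) finite_subset by auto
  then have "S = {}" using S(3) assms(1) by simp
  moreover have "vec m (\<lambda>i. fderiv k (rat_fun (H i))) \<in> set (cols (jacobian m H))"
    using assms(3) by (auto simp: col_jacobian)
  from bspec[OF S(4) this] obtain a where
    "\<forall>l<m. vec m (\<lambda>i. fderiv k (rat_fun (H i))) $ l = (\<Sum>x\<in>S. a x * x $ l)" by blast
  ultimately show ?thesis using assms(2) by (simp add: fderiv_rat_fun)
qed

lemma jacobian_rank_1:
  fixes H :: "nat \<Rightarrow> 'a::field_char_0 mpoly"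
  assumes "vec_space.rank m (jacobian m H) = 1"
  obtains p c i where "p < m" "i < m" "fderiv p (rat_fun (H i)) \<noteq> 0"
    "\<And>i k. i < m \<Longrightarrow> k < m \<Longrightarrow> fderiv k (rat_fun (H i)) = c k * fderiv p (rat_fun (H i))"
proof -
  interpret vec_space "TYPE('a mpoly fract)" m .
  obtain S where "S \<subseteq> set (cols (jacobian m H)) \<and> lin_indpt S \<and> card S = rank (jacobian m H) \<and>
    (\<forall>v\<in>set (cols (jacobian m H)). \<exists>a. \<forall>i<m. v $ i = (\<Sum>x\<in>S. a x * x $ i))"
    using rank_basis[OF jacobian_carrier[of m H]] by (rule exE)
  note S = this[THEN conjunct1] this[THEN conjunct2, THEN conjunct1]
    this[THEN conjunct2, THEN conjunct2, THEN conjunct1] this[THEN conjunct2, THEN conjunct2, THEN conjunct2]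
  have "card S = 1" using S(3) assms by simp
  then obtain v where v: "S = {v}" using card_1_singletonE by blast
  then obtain p where p: "p < m" "v = vec m (\<lambda>i. fderiv p (rat_fun (H i)))" using S(1) col_jacobian by blast
  have S': "finite S" "S \<subseteq> carrier_vec m" by (simp_all add: v p)
  have "\<exists>i<m. fderiv p (rat_fun (H i)) \<noteq> 0"
  proof (rule ccontr)
    assume "\<not> ?thesis"
    then have "\<forall>i<m. (\<Sum>x\<in>S. 1 * x $ i) = 0" by (simp add: v p)
    then have "(1 :: 'a mpoly fract) = 0"
      by (rule lin_indpt_coeff_zero[OF S(2) S', where a = "\<lambda>_. 1"]) (simp add: v)
    then show False by simp
  qed
  then obtain i where i: "i < m" "fderiv p (rat_fun (H i)) \<noteq> 0" by blast
  have choice: "\<forall>k. \<exists>a. k < m \<longrightarrow> (\<forall>i<m. fderiv k (rat_fun (H i)) = a * fderiv p (rat_fun (H i)))"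
  proof
    fix k
    show "\<exists>a. k < m \<longrightarrow> (\<forall>i<m. fderiv k (rat_fun (H i)) = a * fderiv p (rat_fun (H i)))"
    proof (cases "k < m")
      case True
      then have "vec m (\<lambda>i. fderiv k (rat_fun (H i))) \<in> set (cols (jacobian m H))"
        by (auto simp: col_jacobian)
      from bspec[OF S(4) this] obtain a where
        "\<forall>l<m. vec m (\<lambda>i. fderiv k (rat_fun (H i))) $ l = (\<Sum>x\<in>S. a x * x $ l)" by blast
      then show ?thesis by (intro exI[of _ "a v"]) (simp add: v p(2))
    qed simp
  qed
  obtain c where c: "\<forall>k. k < m \<longrightarrow> (\<forall>i<m. fderiv k (rat_fun (H i)) = c k * fderiv p (rat_fun (H i)))"
    using Hilbert_Choice.choice[OF choice] by (rule exE)
  show thesis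
  proof (rule that[of p i c])
    show "fderiv k (rat_fun (H i)) = c k * fderiv p (rat_fun (H i))" if "i < m" "k < m" for i k
      using c that by simp
  qed (rule p i)+
qed

lemma jacobian_rank_2:
  fixes H :: "nat \<Rightarrow> 'a::field_char_0 mpoly"
  assumes "vec_space.rank m (jacobian m H) = 2"
  obtains p q c e where "p < m" "q < m" "p \<noteq> q"
    "\<And>i k. i < m \<Longrightarrow> k < m \<Longrightarrow> fderiv k (rat_fun (H i)) = c k * fderiv p (rat_fun (H i)) + e k * fderiv q (rat_fun (H i))"
    "\<And>a b. (\<And>i. i < m \<Longrightarrow> a * fderiv p (rat_fun (H i)) + b * fderiv q (rat_fun (H i)) = 0) \<Longrightarrow> a = 0 \<and> b = 0"
proof -
  interpret vec_space "TYPE('a mpoly fract)" m .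
  obtain S where "S \<subseteq> set (cols (jacobian m H)) \<and> lin_indpt S \<and> card S = rank (jacobian m H) \<and>
    (\<forall>v\<in>set (cols (jacobian m H)). \<exists>a. \<forall>i<m. v $ i = (\<Sum>x\<in>S. a x * x $ i))"
    using rank_basis[OF jacobian_carrier[of m H]] by (rule exE)
  note S = this[THEN conjunct1] this[THEN conjunct2, THEN conjunct1]
    this[THEN conjunct2, THEN conjunct2, THEN conjunct1] this[THEN conjunct2, THEN conjunct2, THEN conjunct2]
  have "card S = 2" using S(3) assms by simp
  then obtain v w where vw: "S = {v, w}" "v \<noteq> w" by (auto simp: card_2_iff)
  then have "v \<in> set (cols (jacobian m H))" "w \<in> set (cols (jacobian m H))" using S(1) by auto
  then obtain p q where p: "p < m" "v = vec m (\<lambda>i. fderiv p (rat_fun (H i)))"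
    and q: "q < m" "w = vec m (\<lambda>i. fderiv q (rat_fun (H i)))" unfolding col_jacobian by blast
  have S': "finite S" "S \<subseteq> carrier_vec m" by (simp_all add: vw(1) p q)
  have pq: "p \<noteq> q" using vw(2) p(2) q(2) by blast
  have ind: "a = 0 \<and> b = 0"
    if ab: "\<And>i. i < m \<Longrightarrow> a * fderiv p (rat_fun (H i)) + b * fderiv q (rat_fun (H i)) = 0" for a b
  proof -
    define u where "u x = (if x = v then a else b)" for x
    have sum0: "(\<Sum>x\<in>S. u x * x $ i) = 0" if "i < m" for i
      using ab[OF that] vw(2) that by (simp add: u_def vw(1)) (simp add: p(2) q(2))
    have "u x = 0" if "x \<in> S" for x
      by (rule lin_indpt_coeff_zero[OF S(2) S' _ that]) (intro allI impI sum0)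
    then have "u v = 0" "u w = 0" by (simp_all only: vw(1) insert_iff simp_thms)
    then show ?thesis using vw(2) by (simp add: u_def)
  qed
  have choice: "\<forall>k. \<exists>ab. k < m \<longrightarrow> (\<forall>i<m. fderiv k (rat_fun (H i)) = fst ab * fderiv p (rat_fun (H i)) + snd ab * fderiv q (rat_fun (H i)))"
  proof
    fix k
    show "\<exists>ab. k < m \<longrightarrow> (\<forall>i<m. fderiv k (rat_fun (H i)) = fst ab * fderiv p (rat_fun (H i)) + snd ab * fderiv q (rat_fun (H i)))"
    proof (cases "k < m")
      case True
      then have "vec m (\<lambda>i. fderiv k (rat_fun (H i))) \<in> set (cols (jacobian m H))"
        by (auto simp: col_jacobian)
      from bspec[OF S(4) this] obtain a where
        a: "\<forall>l<m. vec m (\<lambda>i. fderiv k (rat_fun (H i))) $ l = (\<Sum>x\<in>S. a x * x $ l)" by blast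
      have "fderiv k (rat_fun (H i)) = a v * fderiv p (rat_fun (H i)) + a w * fderiv q (rat_fun (H i))" if "i < m" for i
      proof -
        have "fderiv k (rat_fun (H i)) = a v * v $ i + a w * w $ i"
          using a that vw by auto
        then show ?thesis using that p(2) q(2) by simp
      qed
      then show ?thesis by (intro exI[of _ "(a v, a w)"]) simp
    qed simp
  qed
  obtain ab where ab: "\<forall>k. k < m \<longrightarrow> (\<forall>i<m. fderiv k (rat_fun (H i)) =
      fst (ab k) * fderiv p (rat_fun (H i)) + snd (ab k) * fderiv q (rat_fun (H i)))"
    using Hilbert_Choice.choice[OF choice] by (rule exE)
  show thesis
  proof (rule that[of p q "\<lambda>k. fst (ab k)" "\<lambda>k. snd (ab k)"])
    show "fderiv k (rat_fun (H i)) = fst (ab k) * fderiv p (rat_fun (H i)) + snd (ab k) * fderiv q (rat_fun (H i))"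
      if "i < m" "k < m" for i k using ab that by simp
    show "a = 0 \<and> b = 0"
      if "\<And>i. i < m \<Longrightarrow> a * fderiv p (rat_fun (H i)) + b * fderiv q (rat_fun (H i)) = 0" for a b
      using that by (rule ind)
  qed (rule p q pq)+
qed

section \<open>Primitive vectors and dual bases over subrings\<close>

text \<open>Trivial content, phrased with multipliers from the whole fraction field: in this form
  factors of p can be cancelled from membership statements without choosing gcds again.\<close>

definition primitive :: "'a::field set \<Rightarrow> nat \<Rightarrow> (nat \<Rightarrow> 'a) \<Rightarrow> bool" where
  "primitive R m p \<longleftrightarrow> (\<forall>i<m. p i \<in> R) \<and> (\<forall>c. (\<forall>i<m. c * p i \<in> R) \<longrightarrow> c \<in> R)"

locale fraction_field =
  fixes R :: "'a::field set"
  assumes fraction_field: "fraction_field_of R"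
begin

lemma subring: "subring R"
  using fraction_field by (simp add: fraction_field_of_def)

lemma zero_in: "0 \<in> R" and one_in: "1 \<in> R"
  and add_in: "a \<in> R \<Longrightarrow> b \<in> R \<Longrightarrow> a + b \<in> R"
  and diff_in: "a \<in> R \<Longrightarrow> b \<in> R \<Longrightarrow> a - b \<in> R"
  and mult_in: "a \<in> R \<Longrightarrow> b \<in> R \<Longrightarrow> a * b \<in> R"
  using subring by (simp_all add: subring_def)

lemma power_in: "a \<in> R \<Longrightarrow> a ^ k \<in> R"
  by (induction k) (simp_all add: one_in mult_in)

lemma sum_in: "(\<And>i. i \<in> A \<Longrightarrow> f i \<in> R) \<Longrightarrow> sum f A \<in> R"
  by (rule subring_sum[OF subring])

lemma fraction: obtains a b where "a \<in> R" "b \<in> R" "b \<noteq> 0" "z = a / b"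
  using fraction_field unfolding fraction_field_of_def by blast

lemma common_denominator: "\<exists>s\<in>R. s \<noteq> 0 \<and> (\<forall>i<m. s * v i \<in> R)" for m :: nat
proof (induction m)
  case 0 then show ?case using one_in by (intro bexI[of _ 1]) auto
next
  case (Suc m)
  then obtain s where s: "s \<in> R" "s \<noteq> 0" "\<forall>i<m. s * v i \<in> R" by blast
  obtain a b where ab: "a \<in> R" "b \<in> R" "b \<noteq> 0" "v m = a / b" by (rule fraction)
  have "s * b * v i \<in> R" if "i < Suc m" for i
  proof (cases "i = m")
    case True
    then have "s * b * v i = s * a" using ab by simp
    then show ?thesis using mult_in[OF s(1) ab(1)] by (simp only:)
  next
    case False
    then have "s * v i \<in> R" using that s(3) by simp
    then have "b * (s * v i) \<in> R" by (rule mult_in[OF ab(2)])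
    then show ?thesis by (simp add: ac_simps)
  qed
  then show ?case using s ab mult_in by (intro bexI[of _ "s * b"]) auto
qed

lemma rdvdI: "c \<in> R \<Longrightarrow> b = a * c \<Longrightarrow> rdvd R a b"
  by (auto simp: rdvd_def)

lemma gcd_exists:
  assumes "gcd_domain R" "x \<in> R" "y \<in> R"
  obtains d where "d \<in> R" "rdvd R d x" "rdvd R d y"
    "\<And>e. e \<in> R \<Longrightarrow> rdvd R e x \<Longrightarrow> rdvd R e y \<Longrightarrow> rdvd R e d"
proof -
  have "\<exists>d\<in>R. rdvd R d x \<and> rdvd R d y \<and> (\<forall>e\<in>R. rdvd R e x \<and> rdvd R e y \<longrightarrow> rdvd R e d)"
    using assms by (simp add: gcd_domain_def)
  then show thesis using that by blast
qed

text \<open>Extends the gcd property to fractional multipliers a / b. The gcd e of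
  \<open>a * x\<close> and \<open>a * y\<close> is divisible by both a and b, and
  \<open>e / a\<close> divides d; so b divides \<open>a * d\<close>.\<close>

lemma gcd_pair:
  assumes gcd: "gcd_domain R" and xy: "x \<in> R" "y \<in> R"
  shows "\<exists>d\<in>R. rdvd R d x \<and> rdvd R d y \<and> (\<forall>c. c * x \<in> R \<longrightarrow> c * y \<in> R \<longrightarrow> c * d \<in> R)"
proof -
  obtain d where d: "d \<in> R" "rdvd R d x" "rdvd R d y"
    and greatest: "\<And>e. e \<in> R \<Longrightarrow> rdvd R e x \<Longrightarrow> rdvd R e y \<Longrightarrow> rdvd R e d"
    using gcd_exists[OF gcd xy] by blast
  have "c * d \<in> R" if c: "c * x \<in> R" "c * y \<in> R" for c
  proof -
    obtain a b where ab: "a \<in> R" "b \<in> R" "b \<noteq> 0" "c = a / b" by (rule fraction)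
    show ?thesis
    proof (cases "a = 0")
      case True then show ?thesis using ab zero_in by simp
    next
      case False
      obtain e where e: "e \<in> R" "rdvd R e (a * x)" "rdvd R e (a * y)"
        and gr: "\<And>f. f \<in> R \<Longrightarrow> rdvd R f (a * x) \<Longrightarrow> rdvd R f (a * y) \<Longrightarrow> rdvd R f e"
        using gcd_exists[OF gcd mult_in[OF ab(1) xy(1)] mult_in[OF ab(1) xy(2)]] by blast
      have "rdvd R a e" using ab xy by (intro gr) (auto intro: rdvdI)
      then obtain e' where e': "e' \<in> R" "e = a * e'" by (auto simp: rdvd_def)
      have "rdvd R b (a * x)" "rdvd R b (a * y)"
        using ab(3,4) by (auto intro: rdvdI[OF c(1)] rdvdI[OF c(2)])
      then have "rdvd R b e" by (rule gr[OF ab(2)])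
      then obtain k where k: "k \<in> R" "e = b * k" by (auto simp: rdvd_def)
      have "rdvd R e' x" "rdvd R e' y" using e(2,3) False by (auto simp: rdvd_def e'(2) mult.assoc)
      then have "rdvd R e' d" by (rule greatest[OF e'(1)])
      then obtain g where g: "g \<in> R" "d = e' * g" by (auto simp: rdvd_def)
      have "a * e' = b * k" using e' k by simp
      then have "c * d = k * g" using ab(3) by (simp add: ab(4) g field_simps)
      then show ?thesis using mult_in[OF k(1) g(1)] by (simp only:)
    qed
  qed
  then show ?thesis using d by blast
qed

lemma rdvd_trans: "rdvd R a b \<Longrightarrow> rdvd R b c \<Longrightarrow> rdvd R a c"
  unfolding rdvd_def using mult_in by (metis mult.assoc)

lemma gcd_family:
  fixes m :: nat
  assumes gcd: "gcd_domain R" and v: "\<And>i. i < m \<Longrightarrow> v i \<in> R"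
  shows "\<exists>d\<in>R. (\<forall>i<m. rdvd R d (v i)) \<and> (\<forall>c. (\<forall>i<m. c * v i \<in> R) \<longrightarrow> c * d \<in> R)"
  using v
proof (induction m)
  case 0 then show ?case using zero_in by (intro bexI[of _ 0]) auto
next
  case (Suc m)
  then obtain d where d: "d \<in> R" "\<forall>i<m. rdvd R d (v i)" "\<forall>c. (\<forall>i<m. c * v i \<in> R) \<longrightarrow> c * d \<in> R"
    by (metis less_SucI)
  obtain e where e: "e \<in> R" "rdvd R e d" "rdvd R e (v m)"
    "\<forall>c. c * d \<in> R \<longrightarrow> c * v m \<in> R \<longrightarrow> c * e \<in> R"
    using gcd_pair[OF gcd d(1), of "v m"] Suc.prems by blast
  then show ?case using d rdvd_trans by (intro bexI[of _ e]) (auto simp: less_Suc_eq)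
qed

lemma primitive_multiple:
  assumes gcd: "gcd_domain R" and nz: "i < m" "v i \<noteq> 0"
  obtains \<sigma> where "\<sigma> \<noteq> 0" "primitive R m (\<lambda>i. \<sigma> * v i)"
proof -
  obtain s where s: "s \<in> R" "s \<noteq> 0" "\<forall>i<m. s * v i \<in> R" using common_denominator[of m v] by blast
  obtain d where d: "d \<in> R" "\<forall>i<m. rdvd R d (s * v i)"
    and cd: "\<forall>c. (\<forall>i<m. c * (s * v i) \<in> R) \<longrightarrow> c * d \<in> R"
    using gcd_family[OF gcd, of m "\<lambda>i. s * v i"] s(3) by auto
  have "rdvd R d (s * v i)" using d nz by blast
  then have d0: "d \<noteq> 0" using s(2) nz(2) by (auto simp: rdvd_def)
  have "s / d * v i \<in> R" if "i < m" for i
    using d(2) d0 that by (auto simp: rdvd_def)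
  moreover have "c \<in> R" if "\<forall>i<m. c * (s / d * v i) \<in> R" for c
  proof -
    have "c / d * d \<in> R" using cd[rule_format, of "c / d"] that by simp
    then show ?thesis using d0 by simp
  qed
  ultimately have "primitive R m (\<lambda>i. s / d * v i)" by (simp add: primitive_def)
  then show thesis using that[of "s / d"] s d0 by simp
qed

text \<open>For z = a' / b' in lowest terms, the power of z in R makes b' divide a power of a'.
  Coprimality strips the factors a' one by one until b' is a unit.\<close>

lemma root_closed:
  assumes gcd: "gcd_domain R" and z: "z ^ k \<in> R" and k: "0 < k"
  shows "z \<in> R"
proof -
  obtain a b where ab: "a \<in> R" "b \<in> R" "b \<noteq> 0" "z = a / b" by (rule fraction)
  obtain d where d: "d \<in> R" "rdvd R d a" "rdvd R d b"
    and cd: "\<And>c. c * a \<in> R \<Longrightarrow> c * b \<in> R \<Longrightarrow> c * d \<in> R"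
    using gcd_pair[OF gcd ab(1,2)] by blast
  obtain a' b' where a': "a' \<in> R" "a = d * a'" and b': "b' \<in> R" "b = d * b'"
    using d by (auto simp: rdvd_def)
  have nz: "d \<noteq> 0" "b' \<noteq> 0" using ab b' by auto
  have coprime: "c \<in> R" if "c * a' \<in> R" "c * b' \<in> R" for c
    using cd[of "c / d"] that nz by (simp add: a' b')
  have "a' ^ (k - j) / b' \<in> R" if "j \<le> k" for j
    using that
  proof (induction j)
    case 0
    have "a' ^ k = z ^ k * b' ^ k" using nz by (simp add: ab(4) a' b' power_divide)
    then have "a' ^ k / b' = z ^ k * b' ^ (k - 1)" using nz k by (cases k) auto
    then show ?case using mult_in z power_in b' by simp
  next
    case (Suc j)
    then have "a' ^ (k - j) = a' * a' ^ (k - Suc j)" by (metis Suc_diff_Suc Suc_le_lessD power_Suc)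
    then have "a' ^ (k - Suc j) / b' * a' \<in> R" using Suc by (simp add: mult.commute)
    moreover have "a' ^ (k - Suc j) / b' * b' \<in> R" using nz power_in a' by simp
    ultimately show ?case by (rule coprime)
  qed
  from this[of k] have "1 / b' \<in> R" by simp
  then have "a' * (1 / b') \<in> R" using mult_in a' by blast
  then show ?thesis using nz by (simp add: ab(4) a' b')
qed

text \<open>By root closedness the products of p over index lists of length k may replace the pure
  powers; then the factors are removed one at a time.\<close>
lemma primitive_power:
  assumes gcd: "gcd_domain R" and p: "primitive R m p" and m: "0 < m"
    and c: "\<And>i. i < m \<Longrightarrow> c * p i ^ k \<in> R"
  shows "c \<in> R"
proof (cases "k = 0")
  case True then show ?thesis using c[OF m] by simp
next
  case False
  have "c * prod_list (map p l) \<in> R" if "set l \<subseteq> {..<m}" "length l = k - j" "j \<le> k" for l j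
    using that
  proof (induction j arbitrary: l)
    case 0
    have pow: "prod_list (map (\<lambda>i. c * p i ^ k) l) = c ^ length l * prod_list (map p l) ^ k" for l
      by (induction l) (simp_all add: power_mult_distrib)
    have "prod_list (map (\<lambda>i. c * p i ^ k) l) \<in> R" if "set l \<subseteq> {..<m}" for l
      using that by (induction l) (auto simp: one_in intro!: mult_in c)
    from this[OF 0(1)] have "(c * prod_list (map p l)) ^ k \<in> R"
      unfolding pow using 0(2) by (simp add: power_mult_distrib)
    then show ?case using root_closed[OF gcd] False by blast
  next
    case (Suc j)
    have "c * prod_list (map p l) * p i \<in> R" if "i < m" for i
      using Suc.IH[of "i # l"] Suc.prems that by (simp add: ac_simps Suc_diff_Suc)
    then show ?case using p unfolding primitive_def by blast
  qed
  from this[of "[]" k] show ?thesis by simp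
qed

lemma bezout_pair:
  assumes B: "bezout_domain R" and xy: "x \<in> R" "y \<in> R"
  obtains d s t where "d \<in> R" "s \<in> R" "t \<in> R" "d = s * x + t * y" "rdvd R d x" "rdvd R d y"
proof -
  obtain d where d: "d \<in> R" "gen_ideal R {x, y} = gen_ideal R {d}"
    using B xy unfolding bezout_domain_def by (metis finite.emptyI finite_insert insert_subset empty_subsetI)
  have "d \<in> gen_ideal R {d}"
    unfolding gen_ideal_def using one_in by (auto intro!: exI[of _ "\<lambda>_. 1"])
  then have "d \<in> gen_ideal R {x, y}" using d(2) by simp
  then obtain c where c: "d = (\<Sum>f\<in>{x, y}. c f * f)" "\<forall>f\<in>{x, y}. c f \<in> R"
    unfolding gen_ideal_def by blast
  have div: "rdvd R d z" if "z \<in> {x, y}" for z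
  proof -
    have "z = (\<Sum>f\<in>{x, y}. (if f = z then 1 else 0) * f)"
      using that by (cases "x = y") auto
    then have "z \<in> gen_ideal R {x, y}"
      unfolding gen_ideal_def using one_in zero_in by (auto intro!: exI[of _ "\<lambda>f. if f = z then 1 else 0"])
    then have "z \<in> gen_ideal R {d}" using d(2) by simp
    then obtain c' where "z = c' d * d" "c' d \<in> R" unfolding gen_ideal_def by auto
    then show ?thesis unfolding rdvd_def by (metis mult.commute)
  qed
  show thesis
  proof (cases "x = y")
    \<comment> \<open>If x = y the generating set collapses to a singleton and its ideal sum has a
      single term, so the second cofactor is taken to be 0.\<close>
    case True
    then show ?thesis using that[of d "c x" 0] d c zero_in div by simp
  next
    case False
    then show ?thesis using that[of d "c x" "c y"] d c div by simp
  qed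
qed

lemma bezout_imp_gcd:
  assumes B: "bezout_domain R" shows "gcd_domain R"
  unfolding gcd_domain_def
proof (intro ballI)
  fix x y assume xy: "x \<in> R" "y \<in> R"
  obtain d s t where d: "d \<in> R" "s \<in> R" "t \<in> R" "d = s * x + t * y" "rdvd R d x" "rdvd R d y"
    by (rule bezout_pair[OF B xy])
  have "rdvd R e d" if e: "rdvd R e x" "rdvd R e y" for e
  proof -
    obtain u w where u: "u \<in> R" "x = e * u" and w: "w \<in> R" "y = e * w"
      using e unfolding rdvd_def by blast
    show ?thesis
    proof (rule rdvdI)
      show "s * u + t * w \<in> R" using d(2,3) u(1) w(1) by (intro add_in mult_in)
      show "d = e * (s * u + t * w)" unfolding d(4) u(2) w(2) by (simp add: algebra_simps)
    qed
  qed
  then show "\<exists>d\<in>R. rdvd R d x \<and> rdvd R d y \<and> (\<forall>e\<in>R. rdvd R e x \<and> rdvd R e y \<longrightarrow> rdvd R e d)"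
    using d(1,5,6) by blast
qed

lemma bezout_family:
  fixes m :: nat
  assumes B: "bezout_domain R" and v: "\<And>i. i < m \<Longrightarrow> v i \<in> R"
  shows "\<exists>d\<in>R. \<exists>a. (\<forall>i<m. a i \<in> R) \<and> d = (\<Sum>i<m. a i * v i) \<and> (\<forall>i<m. rdvd R d (v i))"
  using v
proof (induction m)
  case 0 then show ?case using zero_in by (intro bexI[of _ 0]) auto
next
  case (Suc m)
  then obtain d a where d: "d \<in> R" "\<forall>i<m. a i \<in> R" "d = (\<Sum>i<m. a i * v i)" "\<forall>i<m. rdvd R d (v i)"
    using less_SucI by blast
  obtain e s t where e: "e \<in> R" "s \<in> R" "t \<in> R" "e = s * d + t * v m" "rdvd R e d" "rdvd R e (v m)"
    by (rule bezout_pair[OF B d(1), of "v m"]) (use Suc.prems in auto)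
  define a' where "a' i = (if i = m then t else s * a i)" for i
  have "(\<Sum>i<Suc m. a' i * v i) = s * (\<Sum>i<m. a i * v i) + t * v m"
    by (simp add: a'_def sum_distrib_left mult.assoc)
  then have "e = (\<Sum>i<Suc m. a' i * v i)" by (simp only: e(4) d(3))
  moreover have "\<forall>i<Suc m. a' i \<in> R" using d(2) e(2,3) mult_in by (simp add: a'_def less_Suc_eq)
  moreover have "\<forall>i<Suc m. rdvd R e (v i)"
    using d(4) e(6) rdvd_trans[OF e(5)] by (simp add: less_Suc_eq)
  ultimately show ?case by (intro bexI[of _ e] exI[of _ a'] conjI e(1))
qed

text \<open>After clearing denominators and dividing by the gcd, the Bezout cofactors become a
  functional over R taking the value 1 on the rescaled vector.\<close>

lemma unimodular_multiple:
  fixes m :: nat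
  assumes B: "bezout_domain R" and nz: "i < m" "v i \<noteq> 0"
  obtains \<sigma> a where "\<sigma> \<noteq> 0" "\<And>i. i < m \<Longrightarrow> \<sigma> * v i \<in> R" "\<And>i. i < m \<Longrightarrow> a i \<in> R"
    "(\<Sum>i<m. a i * (\<sigma> * v i)) = 1"
proof -
  obtain s where s: "s \<in> R" "s \<noteq> 0" "\<forall>i<m. s * v i \<in> R" using common_denominator[of m v] by blast
  obtain d a where d: "d \<in> R" "\<forall>i<m. a i \<in> R" "d = (\<Sum>i<m. a i * (s * v i))" "\<forall>i<m. rdvd R d (s * v i)"
    using bezout_family[OF B, of m "\<lambda>i. s * v i"] s(3) by blast
  have "rdvd R d (s * v i)" using d nz by blast
  then have d0: "d \<noteq> 0" using s(2) nz(2) by (auto simp: rdvd_def)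
  have in_R: "s / d * v i \<in> R" if "i < m" for i
    using d(4) d0 that by (auto simp: rdvd_def)
  have "(\<Sum>i<m. a i * (s / d * v i)) = (\<Sum>i<m. a i * (s * v i)) / d"
    by (simp add: sum_divide_distrib)
  then have one: "(\<Sum>i<m. a i * (s / d * v i)) = 1" unfolding d(3)[symmetric] using d0 by simp
  show thesis
  proof (rule that[of "s / d" a])
    show "s / d \<noteq> 0" using s(2) d0 by simp
    show "a i \<in> R" if "i < m" for i using d(2) that by blast
  qed (rule in_R one, assumption?)+
qed

text \<open>Elimination over R: scale \<gamma> to a unimodular vector with functional a, remove from
  \<delta> its a-component, scale the rest to a unimodular q with functional b, and subtract s q
  from the first vector so that b kills it. As a already kills q, its value on p stays 1. The
  a-component t may be fractional, but q is rescaled after its removal; s is in R.\<close>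

lemma dual_basis:
  fixes m :: nat
  assumes B: "bezout_domain R"
    and ind: "\<And>k l. (\<And>i. i < m \<Longrightarrow> k * \<gamma> i + l * \<delta> i = 0) \<Longrightarrow> k = 0 \<and> l = 0"
  obtains p q a b A B C D A' B' C' D' where
    "\<And>i. i < m \<Longrightarrow> p i \<in> R \<and> q i \<in> R \<and> a i \<in> R \<and> b i \<in> R"
    "(\<Sum>i<m. a i * p i) = 1" "(\<Sum>i<m. a i * q i) = 0" "(\<Sum>i<m. b i * p i) = 0" "(\<Sum>i<m. b i * q i) = 1"
    "\<And>i. p i = A * \<gamma> i + B * \<delta> i" "\<And>i. q i = C * \<gamma> i + D * \<delta> i"
    "\<And>i. \<gamma> i = A' * p i + B' * q i" "\<And>i. \<delta> i = C' * p i + D' * q i"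
proof -
  have "\<exists>i<m. \<gamma> i \<noteq> 0"
  proof (rule ccontr)
    assume "\<not> ?thesis"
    then have "(1 :: 'a) = 0 \<and> (0 :: 'a) = 0" by (intro ind) simp
    then show False by simp
  qed
  then obtain i where i: "i < m" "\<gamma> i \<noteq> 0" by blast
  obtain \<sigma> a where \<sigma>: "\<sigma> \<noteq> 0" and p0R: "\<And>i. i < m \<Longrightarrow> \<sigma> * \<gamma> i \<in> R" and aR: "\<And>i. i < m \<Longrightarrow> a i \<in> R"
    and ap: "(\<Sum>i<m. a i * (\<sigma> * \<gamma> i)) = 1"
    using unimodular_multiple[OF B, of i m \<gamma>, OF i] by blast
  define t where "t = (\<Sum>i<m. a i * \<delta> i)"
  define \<delta>' where "\<delta>' i = \<delta> i - t * (\<sigma> * \<gamma> i)" for i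
  have "\<exists>i<m. \<delta>' i \<noteq> 0"
  proof (rule ccontr)
    assume "\<not> ?thesis"
    then have "- t * \<sigma> * \<gamma> i + 1 * \<delta> i = 0" if "i < m" for i
      using that by (simp add: \<delta>'_def)
    then have "- t * \<sigma> = 0 \<and> (1 :: 'a) = 0" by (rule ind)
    then show False by simp
  qed
  then obtain j where j: "j < m" "\<delta>' j \<noteq> 0" by blast
  obtain \<tau> b where \<tau>: "\<tau> \<noteq> 0" and qR: "\<And>i. i < m \<Longrightarrow> \<tau> * \<delta>' i \<in> R" and bR: "\<And>i. i < m \<Longrightarrow> b i \<in> R"
    and bq: "(\<Sum>i<m. b i * (\<tau> * \<delta>' i)) = 1"
    using unimodular_multiple[OF B, of j m \<delta>', OF j] by blast
  define q where "q i = \<tau> * \<delta>' i" for i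
  have "(\<Sum>i<m. a i * q i) = \<tau> * (t - t * (\<Sum>i<m. a i * (\<sigma> * \<gamma> i)))"
    by (simp add: q_def \<delta>'_def t_def sum_subtractf sum_distrib_left sum_distrib_right algebra_simps)
  then have aq: "(\<Sum>i<m. a i * q i) = 0" by (simp add: ap)
  define s where "s = (\<Sum>i<m. b i * (\<sigma> * \<gamma> i))"
  have sR: "s \<in> R" unfolding s_def by (intro sum_in mult_in bR p0R) auto
  define p where "p i = \<sigma> * \<gamma> i - s * q i" for i
  have "(\<Sum>i<m. c i * p i) = (\<Sum>i<m. c i * (\<sigma> * \<gamma> i)) - s * (\<Sum>i<m. c i * q i)" for c
    by (simp add: p_def right_diff_distrib sum_subtractf sum_distrib_left mult.left_commute)
  then have abp: "(\<Sum>i<m. a i * p i) = 1" "(\<Sum>i<m. b i * p i) = 0"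
    using ap aq bq by (simp_all add: q_def s_def)
  have in_R: "p i \<in> R \<and> q i \<in> R \<and> a i \<in> R \<and> b i \<in> R" if "i < m" for i
    unfolding p_def q_def by (intro conjI diff_in p0R qR aR bR mult_in sR that)
  have p_eq: "p i = (\<sigma> + s * \<tau> * t * \<sigma>) * \<gamma> i + (- s * \<tau>) * \<delta> i" for i
    by (simp add: p_def q_def \<delta>'_def algebra_simps)
  have q_eq: "q i = (- \<tau> * t * \<sigma>) * \<gamma> i + \<tau> * \<delta> i" for i
    by (simp add: q_def \<delta>'_def algebra_simps)
  have \<gamma>_eq: "\<gamma> i = (1 / \<sigma>) * p i + (s / \<sigma>) * q i" for i
    using \<sigma> by (simp add: p_def field_simps)
  have \<delta>_eq: "\<delta> i = t * p i + (t * s + 1 / \<tau>) * q i" for i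
    using \<tau> by (simp add: p_def q_def \<delta>'_def algebra_simps)
  have bq': "(\<Sum>i<m. b i * q i) = 1" using bq by (simp add: q_def)
  show thesis
    by (rule that[OF in_R abp(1) aq abp(2) bq' p_eq q_eq \<gamma>_eq \<delta>_eq])
qed

end

section \<open>Zariski closure of the image and the set of apices\<close>

lemma msubst_zero_iff:
  fixes f :: "'a::field_char_0 mpoly"
  shows "msubst G f = 0 \<longleftrightarrow> (\<forall>x. meval (\<lambda>i. meval x (G i)) f = 0)"
  by (subst mpoly_zero_iff) (simp add: meval_msubst)

lemma meval_coeffs_in:
  assumes R: "subring R" and f: "f \<in> coeffs_in R" and x: "\<And>i. x i \<in> R"
  shows "meval x f \<in> R"
proof -
  have "msubst (\<lambda>i. mConst (x i)) f = mConst (meval x f)"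
    by (induction f rule: mpoly_induct)
      (simp_all add: msubst.hom_add msubst.hom_mult meval.hom_add meval.hom_mult mConst_add mConst_mult)
  moreover have "msubst (\<lambda>i. mConst (x i)) f \<in> coeffs_in R"
    by (intro coeffs_in_msubst R f coeffs_in_mConst x)
  ultimately have "Poly_Mapping.lookup (mConst (meval x f)) 0 \<in> R"
    unfolding coeffs_in_iff[OF R] by simp
  then show ?thesis by (simp add: mConst_def)
qed

text \<open>The linear map sending y to (a.y) p + (b.y) q fixes p and q, hence projects onto their
  span. This is weaker than biorthogonality and so also admits lines (q = 0) and points (p = q =
  0).\<close>

definition dual_pair :: "nat \<Rightarrow> (nat \<Rightarrow> 'a::field) \<Rightarrow> (nat \<Rightarrow> 'a) \<Rightarrow> (nat \<Rightarrow> 'a) \<Rightarrow> (nat \<Rightarrow> 'a) \<Rightarrow> bool" where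
  "dual_pair m p q a b \<longleftrightarrow> (\<forall>i<m.
     p i = (\<Sum>k<m. a k * p k) * p i + (\<Sum>k<m. b k * p k) * q i \<and>
     q i = (\<Sum>k<m. a k * q k) * p i + (\<Sum>k<m. b k * q k) * q i)"

text \<open>The dual pair supplies affine equations for the plane.\<close>
locale dense_plane =
  fixes m :: nat and H :: "nat \<Rightarrow> 'a::field_char_0 mpoly" and \<beta> p q a b :: "nat \<Rightarrow> 'a"
  assumes H_in: "\<And>i. i < m \<Longrightarrow> H i \<in> polys_in m"
    and vecs: "\<beta> \<in> vecs m" "p \<in> vecs m" "q \<in> vecs m"
    and in_plane: "\<And>x. \<exists>l n. \<forall>i<m. meval x (H i) = \<beta> i + l * p i + n * q i"
    and dense: "\<And>f l n. f \<in> polys_in m \<Longrightarrow> msubst H f = 0 \<Longrightarrow> meval (\<lambda>i. \<beta> i + l * p i + n * q i) f = 0"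
    and dual: "dual_pair m p q a b"
begin

lemma dual_p: "i < m \<Longrightarrow> p i = (\<Sum>k<m. a k * p k) * p i + (\<Sum>k<m. b k * p k) * q i"
  and dual_q: "i < m \<Longrightarrow> q i = (\<Sum>k<m. a k * q k) * p i + (\<Sum>k<m. b k * q k) * q i"
  using dual unfolding dual_pair_def by blast+

text \<open>The relations of H are exactly the polynomials vanishing on the plane, so every
  parametrisation G with that plane as its set of values has the same relations.\<close>

lemma relation_iff:
  assumes f: "f \<in> polys_in m"
    and G: "\<And>x. \<exists>l n. \<forall>i<m. meval x (G i) = \<beta> i + l * p i + n * q i"
    and onto: "\<And>l n. \<exists>x. \<forall>i<m. meval x (G i) = \<beta> i + l * p i + n * q i"
  shows "msubst H f = 0 \<longleftrightarrow> msubst G f = 0"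
proof
  assume H0: "msubst H f = 0"
  show "msubst G f = 0"
    unfolding msubst_zero_iff
  proof
    fix x
    obtain l n where "\<forall>i<m. meval x (G i) = \<beta> i + l * p i + n * q i" using G[of x] by blast
    then have "meval (\<lambda>i. meval x (G i)) f = meval (\<lambda>i. \<beta> i + l * p i + n * q i) f"
      by (intro meval_cong[OF f]) simp
    then show "meval (\<lambda>i. meval x (G i)) f = 0" using dense[OF f H0] by simp
  qed
next
  assume G0: "msubst G f = 0"
  show "msubst H f = 0"
    unfolding msubst_zero_iff
  proof
    fix x
    obtain l n where ln: "\<forall>i<m. meval x (H i) = \<beta> i + l * p i + n * q i" using in_plane[of x] by blast
    obtain y where y: "\<forall>i<m. meval y (G i) = \<beta> i + l * p i + n * q i" using onto[of l n] by blast
    have "meval (\<lambda>i. meval x (H i)) f = meval (\<lambda>i. meval y (G i)) f"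
      using ln y by (intro meval_cong[OF f]) simp
    also have "\<dots> = 0" using G0 unfolding msubst_zero_iff by blast
    finally show "meval (\<lambda>i. meval x (H i)) f = 0" .
  qed
qed

lemma plane_in_vecs: "(\<lambda>i. \<beta> i + l * p i + n * q i) \<in> vecs m"
  using vecs by (simp add: vecs_def)

lemma zariski_closure_eq:
  "zariski_closure m (poly_map_image m H) = {(\<lambda>i. \<beta> i + l * p i + n * q i) | l n. True}"
proof (intro subset_antisym subsetI)
  fix z assume z: "z \<in> zariski_closure m (poly_map_image m H)"
  define A where "A y = (\<Sum>k<m. a k * (y k - \<beta> k))" for y :: "nat \<Rightarrow> 'a"
  define B where "B y = (\<Sum>k<m. b k * (y k - \<beta> k))" for y :: "nat \<Rightarrow> 'a"
  have eq: "z i = \<beta> i + A z * p i + B z * q i" if i: "i < m" for i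
  proof -
    \<comment> \<open>One affine equation per coordinate. It vanishes on the plane because the
      projection fixes p and q, and its vanishing at z exhibits z as a point of the plane.\<close>
    define f :: "'a mpoly" where "f = mVar i - mConst (\<beta> i)
      - (lin_form m a - mConst (\<Sum>k<m. a k * \<beta> k)) * mConst (p i)
      - (lin_form m b - mConst (\<Sum>k<m. b k * \<beta> k)) * mConst (q i)"
    have diff_in: "u - v \<in> polys_in m" if "u \<in> polys_in m" "v \<in> polys_in m" for u v :: "'a mpoly"
      using polys_in_add[OF that(1) polys_in_mult[OF polys_in_mConst[of "- 1"] that(2)]]
      by (simp add: mConst_uminus)
    have f_in: "f \<in> polys_in m"
      unfolding f_def by (intro diff_in polys_in_mVar polys_in_mConst polys_in_mult lin_form_polys_in i)
    have fy: "meval y f = y i - \<beta> i - A y * p i - B y * q i" for y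
      by (simp add: f_def A_def B_def meval.hom_minus meval.hom_mult right_diff_distrib sum_subtractf)
    have f0: "meval y f = 0" if y: "\<forall>i<m. y i = \<beta> i + l * p i + n * q i" for y l n
    proof -
      have dot: "(\<Sum>k<m. c k * (y k - \<beta> k)) = l * (\<Sum>k<m. c k * p k) + n * (\<Sum>k<m. c k * q k)" for c
        unfolding sum_distrib_left sum.distrib[symmetric]
        by (intro sum.cong) (simp_all add: y algebra_simps)
      have "l * p i + n * q i = l * ((\<Sum>k<m. a k * p k) * p i + (\<Sum>k<m. b k * p k) * q i)
          + n * ((\<Sum>k<m. a k * q k) * p i + (\<Sum>k<m. b k * q k) * q i)"
        by (rule arg_cong2[of _ _ _ _ "\<lambda>u v. l * u + n * v", OF dual_p[OF i] dual_q[OF i]])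
      also have "\<dots> = A y * p i + B y * q i"
        unfolding A_def B_def dot by (simp add: algebra_simps)
      finally show ?thesis using y i by (simp add: fy)
    qed
    have "meval s f = 0" if s_in: "s \<in> poly_map_image m H" for s
    proof -
      obtain x where s: "s = (\<lambda>i. if i < m then meval x (H i) else 0)" using s_in by (auto simp: poly_map_image_def)
      obtain l n where "\<forall>i<m. meval x (H i) = \<beta> i + l * p i + n * q i" using in_plane[of x] by blast
      then show ?thesis by (intro f0[of s l n]) (simp add: s)
    qed
    then have "meval z f = 0" using z f_in by (simp add: zariski_closure_def)
    then show ?thesis by (simp add: fy algebra_simps)
  qed
  have "z = (\<lambda>i. \<beta> i + A z * p i + B z * q i)"
  proof
    fix i
    have "z i = 0" "\<beta> i = 0" "p i = 0" "q i = 0" if "m \<le> i"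
      using z vecs that by (simp_all add: zariski_closure_def vecs_def)
    then show "z i = \<beta> i + A z * p i + B z * q i" using eq by (cases "i < m") auto
  qed
  then show "z \<in> {(\<lambda>i. \<beta> i + l * p i + n * q i) | l n. True}" by blast
next
  fix z assume "z \<in> {(\<lambda>i. \<beta> i + l * p i + n * q i) | l n. True}"
  then obtain l n where z: "z = (\<lambda>i. \<beta> i + l * p i + n * q i)" by blast
  have "meval z f = 0" if f: "f \<in> polys_in m" and 0: "\<And>s. s \<in> poly_map_image m H \<Longrightarrow> meval s f = 0" for f
  proof -
    have "msubst H f = 0"
      unfolding msubst_zero_iff
    proof
      fix x :: "nat \<Rightarrow> 'a"
      \<comment> \<open>Points of the image come only from arguments in \<open>vecs m\<close>;
        truncating x does not change the values of H.\<close>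
      define y where "y i = (if i < m then x i else 0)" for i
      have "meval (\<lambda>i. meval x (H i)) f = meval (\<lambda>i. if i < m then meval y (H i) else 0) f"
        by (intro meval_cong[OF f]) (auto intro!: meval_cong[OF H_in] simp: y_def)
      also have "\<dots> = 0"
        by (rule 0) (auto simp: poly_map_image_def vecs_def y_def)
      finally show "meval (\<lambda>i. meval x (H i)) f = 0" .
    qed
    then show ?thesis unfolding z by (rule dense[OF f])
  qed
  then show "z \<in> zariski_closure m (poly_map_image m H)"
    using plane_in_vecs by (simp add: zariski_closure_def z)
qed

text \<open>An apex satisfies every relation of H, so it lies in the closure; conversely the segment
  from a point of the plane to another one stays in the plane.\<close>

lemma apices_eq: "{c. image_apex m H c} = {(\<lambda>i. \<beta> i + l * p i + n * q i) | l n. True}"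
proof (intro subset_antisym subsetI)
  fix c assume "c \<in> {c. image_apex m H c}"
  then have c: "image_apex m H c" by simp
  have "meval c f = 0" if f: "f \<in> polys_in m" and 0: "\<forall>s\<in>poly_map_image m H. meval s f = 0" for f
  proof -
    have "msubst H f = 0"
    proof -
      have "meval (\<lambda>i. \<beta> i + l * p i + n * q i) f = 0" for l n
      proof -
        have "(\<lambda>i. \<beta> i + l * p i + n * q i) \<in> zariski_closure m (poly_map_image m H)"
          unfolding zariski_closure_eq by blast
        then show ?thesis using f 0 by (simp add: zariski_closure_def)
      qed
      moreover have "\<exists>l n. meval (\<lambda>i. meval x (H i)) f = meval (\<lambda>i. \<beta> i + l * p i + n * q i) f" for x
      proof -
        obtain l n where "\<forall>i<m. meval x (H i) = \<beta> i + l * p i + n * q i" using in_plane[of x] by blast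
        then show ?thesis by (intro exI[of _ l] exI[of _ n] meval_cong[OF f]) simp
      qed
      ultimately show ?thesis by (simp add: msubst_zero_iff)
    qed
    then have "msubst (\<lambda>i. (1 - mVar m) * H i + mVar m * mConst (c i)) f = 0"
      using c f unfolding image_apex_def by blast
    \<comment> \<open>At t = 1 the term with H disappears and only f at the apex remains.\<close>
    from arg_cong[OF this, of "meval (\<lambda>_. 1)"] show ?thesis
      by (simp add: meval_msubst meval.hom_add meval.hom_mult meval.hom_minus)
  qed
  then have "c \<in> zariski_closure m (poly_map_image m H)"
    using c by (simp add: zariski_closure_def image_apex_def)
  then show "c \<in> {(\<lambda>i. \<beta> i + l * p i + n * q i) | l n. True}" by (simp only: zariski_closure_eq)
next
  fix c assume "c \<in> {(\<lambda>i. \<beta> i + l * p i + n * q i) | l n. True}"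
  then obtain l n where c: "c = (\<lambda>i. \<beta> i + l * p i + n * q i)" by blast
  have "msubst (\<lambda>i. (1 - mVar m) * H i + mVar m * mConst (c i)) f = 0"
    if f: "f \<in> polys_in m" and 0: "msubst H f = 0" for f
    unfolding msubst_zero_iff
  proof
    fix x
    obtain l' n' where ln: "\<forall>i<m. meval x (H i) = \<beta> i + l' * p i + n' * q i" using in_plane[of x] by blast
    have "meval (\<lambda>i. meval x ((1 - mVar m) * H i + mVar m * mConst (c i))) f =
        meval (\<lambda>i. \<beta> i + ((1 - x m) * l' + x m * l) * p i + ((1 - x m) * n' + x m * n) * q i) f"
      by (intro meval_cong[OF f])
        (simp add: meval.hom_add meval.hom_mult meval.hom_minus ln c algebra_simps)
    also have "\<dots> = 0" by (rule dense[OF f 0])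
    finally show "meval (\<lambda>i. meval x ((1 - mVar m) * H i + mVar m * mConst (c i))) f = 0" .
  qed
  then show "c \<in> {c. image_apex m H c}"
    using plane_in_vecs by (simp add: image_apex_def c)
qed

end

section \<open>The column space and factorisation of the potential over L\<close>

context gradient_map begin

text \<open>Constant vectors in the span of the Jacobian columns over the field of rational
  functions; \<Delta> is a common denominator, which keeps the condition inside polynomials.\<close>

definition column_space :: "(nat \<Rightarrow> 'a) set" where
  "column_space = {w. \<exists>\<Delta> \<omega>. \<Delta> \<noteq> 0 \<and> (\<forall>i<m. \<Delta> * mConst (w i) = (\<Sum>k<m. \<omega> k * mpderiv k (H i)))}"

lemma column_space_zero: "(\<lambda>_. 0) \<in> column_space"
  unfolding column_space_def by (auto intro!: exI[of _ "1 :: 'a mpoly"] exI[of _ "\<lambda>_. 0 :: 'a mpoly"])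

lemma column_space_combination:
  assumes "v \<in> column_space" "w \<in> column_space"
    and u: "\<And>i. i < m \<Longrightarrow> u i = k * v i + l * w i"
  shows "u \<in> column_space"
proof -
  obtain D \<omega> where D: "D \<noteq> 0" "\<And>i. i < m \<Longrightarrow> D * mConst (v i) = (\<Sum>k<m. \<omega> k * mpderiv k (H i))"
    using assms(1) unfolding column_space_def by blast
  obtain E \<psi> where E: "E \<noteq> 0" "\<And>i. i < m \<Longrightarrow> E * mConst (w i) = (\<Sum>k<m. \<psi> k * mpderiv k (H i))"
    using assms(2) unfolding column_space_def by blast
  have "D * E * mConst (u i) = (\<Sum>j<m. (mConst k * E * \<omega> j + mConst l * D * \<psi> j) * mpderiv j (H i))" if i: "i < m" for i
  proof -
    have "D * E * mConst (u i) = mConst k * E * (D * mConst (v i)) + mConst l * D * (E * mConst (w i))"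
      by (simp add: u[OF i] mConst_add mConst_mult algebra_simps)
    also have "\<dots> = (\<Sum>j<m. (mConst k * E * \<omega> j + mConst l * D * \<psi> j) * mpderiv j (H i))"
      unfolding D(2)[OF i] E(2)[OF i]
      by (simp add: sum_distrib_left sum.distrib distrib_right mult.assoc)
    finally show ?thesis .
  qed
  then show ?thesis unfolding column_space_def using D(1) E(1)
    by (intro CollectI exI[of _ "D * E"] exI[of _ "\<lambda>j. mConst k * E * \<omega> j + mConst l * D * \<psi> j"]) simp
qed

lemma dense_planeI:
  assumes vecs: "\<beta> \<in> vecs m" "p \<in> vecs m" "q \<in> vecs m"
    and UV: "\<And>i. i < m \<Longrightarrow> H i = mConst (\<beta> i) + mConst (p i) * U + mConst (q i) * V"
    and col: "p \<in> column_space" "q \<in> column_space"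
    and dual: "dual_pair m p q a b"
  shows "dense_plane m H \<beta> p q a b"
proof
  have UVx: "meval x (H i) = \<beta> i + meval x U * p i + meval x V * q i" if "i < m" for x i
    by (simp add: UV[OF that] meval.hom_add meval.hom_mult)
  show "\<exists>l n. \<forall>i<m. meval x (H i) = \<beta> i + l * p i + n * q i" for x
    using UVx by blast
  fix f l n assume f: "f \<in> polys_in m" "msubst H f = 0"
  \<comment> \<open>The base point is H(0), with plane coordinates U(0) and V(0); the translation
    moves it to the prescribed point.\<close>
  let ?l = "l - meval (\<lambda>_. 0) U" and ?n = "n - meval (\<lambda>_. 0) V"
  have "(\<lambda>i. ?l * p i + ?n * q i) \<in> column_space"
    by (rule column_space_combination[OF col]) simp
  then obtain D \<omega> where "D \<noteq> 0" "\<And>i. i < m \<Longrightarrow> D * mConst (?l * p i + ?n * q i) = (\<Sum>k<m. \<omega> k * mpderiv k (H i))"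
    unfolding column_space_def by blast
  from relation_translate[where w = "\<lambda>i. ?l * p i + ?n * q i", OF this f]
  have "meval (\<lambda>i. meval (\<lambda>_. 0) (H i) + (?l * p i + ?n * q i)) f = 0" .
  moreover have "meval (\<lambda>i. meval (\<lambda>_. 0) (H i) + (?l * p i + ?n * q i)) f = meval (\<lambda>i. \<beta> i + l * p i + n * q i) f"
    by (intro meval_cong[OF f(1)]) (simp add: UVx algebra_simps)
  ultimately show "meval (\<lambda>i. \<beta> i + l * p i + n * q i) f = 0" by simp
qed (use vecs dual H_in in auto)

lemma shifted_in: "h - lin_form m \<beta> \<in> polys_in m"
  using polys_in_add[OF h_in polys_in_mult[OF polys_in_mConst[of "- 1"] lin_form_polys_in[of m \<beta>]]]
  by (simp add: mConst_uminus)

text \<open>The argument x and its replacement in the span of a and b have the same products with p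
  and q. Their difference is therefore orthogonal to p U + q V, the gradient of the shifted
  potential.\<close>

lemma potential_reduces:
  assumes UV: "\<And>i. i < m \<Longrightarrow> H i = mConst (\<beta> i) + mConst (p i) * U + mConst (q i) * V"
    and dual: "dual_pair m p q a b"
  shows "meval x (h - lin_form m \<beta>) =
    meval (\<lambda>k. (\<Sum>i<m. p i * x i) * a k + (\<Sum>i<m. q i * x i) * b k) (h - lin_form m \<beta>)"
proof -
  define P Q where "P = (\<Sum>i<m. p i * x i)" and "Q = (\<Sum>i<m. q i * x i)"
  define v where "v k = P * a k + Q * b k - x k" for k
  have dot: "(\<Sum>k<m. c k * v k) = P * (\<Sum>k<m. a k * c k) + Q * (\<Sum>k<m. b k * c k) - (\<Sum>k<m. c k * x k)" for c
    by (simp add: v_def sum_distrib_left sum.distrib sum_subtractf algebra_simps)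
  have dual_p: "p i = (\<Sum>k<m. a k * p k) * p i + (\<Sum>k<m. b k * p k) * q i"
    and dual_q: "q i = (\<Sum>k<m. a k * q k) * p i + (\<Sum>k<m. b k * q k) * q i" if "i < m" for i
    using dual that unfolding dual_pair_def by blast+
  have comb: "(\<Sum>i<m. (k * p i + l * q i) * x i) = k * P + l * Q" for k l
    by (simp add: P_def Q_def distrib_right sum.distrib sum_distrib_left mult.assoc)
  have "(\<Sum>i<m. p i * x i) = (\<Sum>i<m. ((\<Sum>k<m. a k * p k) * p i + (\<Sum>k<m. b k * p k) * q i) * x i)"
    by (intro sum.cong refl arg_cong2[of _ _ _ _ "(*)"] dual_p) simp
  then have P0: "(\<Sum>k<m. p k * v k) = 0"
    unfolding dot comb by (simp add: mult.commute)
  have "(\<Sum>i<m. q i * x i) = (\<Sum>i<m. ((\<Sum>k<m. a k * q k) * p i + (\<Sum>k<m. b k * q k) * q i) * x i)"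
    by (intro sum.cong refl arg_cong2[of _ _ _ _ "(*)"] dual_q) simp
  then have Q0: "(\<Sum>k<m. q k * v k) = 0"
    unfolding dot comb by (simp add: mult.commute)
  have "(\<Sum>i<m. mConst (v i) * mpderiv i (h - lin_form m \<beta>)) =
      (\<Sum>i<m. mConst (v i) * (mConst (p i) * U + mConst (q i) * V))"
    by (intro sum.cong refl) (simp add: mpderiv_diff mpderiv_lin_form UV flip: grad)
  also have "\<dots> = mConst (\<Sum>k<m. p k * v k) * U + mConst (\<Sum>k<m. q k * v k) * V"
  proof -
    have const_sum: "mConst (\<Sum>k<m. c k) = (\<Sum>k<m. mConst (c k))" for c :: "nat \<Rightarrow> 'a"
      by (induction m) (simp_all add: mConst_add)
    have "mConst (v i) * (mConst (p i) * U + mConst (q i) * V) = mConst (p i * v i) * U + mConst (q i * v i) * V" for i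
      by (simp add: mConst_mult algebra_simps)
    then show ?thesis
      by (simp only: sum.distrib const_sum sum_distrib_right)
  qed
  also have "\<dots> = 0" by (simp add: P0 Q0)
  finally have "meval (\<lambda>i. x i + v i) (h - lin_form m \<beta>) = meval x (h - lin_form m \<beta>)"
    by (rule meval_invariant[OF shifted_in])
  then show ?thesis by (simp add: v_def P_def Q_def)
qed

lemma rank1_structure:
  assumes rank: "vec_space.rank m (jacobian m H) = 1"
  obtains \<gamma> U p where "p < m" "\<gamma> p = 1" "\<gamma> \<in> column_space"
    "\<And>i. i < m \<Longrightarrow> H i = mConst (meval (\<lambda>_. 0) (H i)) + mConst (\<gamma> i) * U"
proof (rule jacobian_rank_1[OF rank])
  fix p c i0
  assume p: "p < m" and i0: "i0 < m" "fderiv p (rat_fun (H i0)) \<noteq> 0"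
    and col: "\<And>i k. i < m \<Longrightarrow> k < m \<Longrightarrow> fderiv k (rat_fun (H i)) = c k * fderiv p (rat_fun (H i))"
  \<comment> \<open>By symmetry every entry of the pivot column is a multiple of its diagonal entry,
    so a nonzero column forces a nonzero diagonal.\<close>
  have nz: "fderiv p (rat_fun (H p)) \<noteq> 0"
    using i0(2) fderiv_symmetric[OF p i0(1)] col[OF p i0(1)] by (metis mult_zero_right)
  have "\<forall>j. \<exists>g. j < m \<longrightarrow> c j = rat_fun (mConst g)"
  proof
    fix j
    show "\<exists>g. j < m \<longrightarrow> c j = rat_fun (mConst g)"
    proof (cases "j < m")
      case True
      obtain g where "c j = rat_fun (mConst g)" by (rule rank1_constant[OF p True nz col])
      then show ?thesis by blast
    qed simp
  qed
  from choice[OF this] obtain \<gamma> where \<gamma>: "\<forall>j. j < m \<longrightarrow> c j = rat_fun (mConst (\<gamma> j))" by (rule exE)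
  have "c p = 1" using col[OF p p] nz by simp
  then have "rat_fun (mConst (\<gamma> p)) = rat_fun (mConst 1)" using \<gamma> p by simp
  then have \<gamma>p: "\<gamma> p = 1" by (simp only: rat_fun_simps mConst_eq_iff)
  have deriv: "mpderiv k (H i) = mConst (\<gamma> k) * mpderiv p (H i)" if "i < m" "k < m" for i k
  proof -
    have "rat_fun (mpderiv k (H i)) = rat_fun (mConst (\<gamma> k) * mpderiv p (H i))"
      using col[OF that] \<gamma> that by (simp add: fderiv_rat_fun)
    then show ?thesis by (simp only: rat_fun_simps(7))
  qed
  have deriv_p: "mpderiv p (H i) = mConst (\<gamma> i) * mpderiv p (H p)" if "i < m" for i
    using deriv[OF p that] symmetric[OF p that] by simp
  have col_space: "\<gamma> \<in> column_space"
    unfolding column_space_def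
  proof (intro CollectI exI conjI allI impI)
    show "mpderiv p (H p) \<noteq> 0" using nz by (auto simp: fderiv_rat_fun)
    fix i assume i: "i < m"
    have "(\<Sum>k<m. (if k = p then 1 else 0) * mpderiv k (H i)) = (\<Sum>k<m. if k = p then mpderiv k (H i) else 0)"
      by (intro sum.cong) auto
    also have "\<dots> = mpderiv p (H i)" using p by simp
    finally show "mpderiv p (H p) * mConst (\<gamma> i) = (\<Sum>k<m. (if k = p then 1 else 0) * mpderiv k (H i))"
      using deriv_p[OF i] by (simp add: mult.commute)
  qed
  have H_eq: "H i = mConst (meval (\<lambda>_. 0) (H i)) + mConst (\<gamma> i) * (H p - mConst (meval (\<lambda>_. 0) (H p)))"
    if i: "i < m" for i
  proof -
    \<comment> \<open>The column relation factors \<gamma> k out of the k-th derivative of E, and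
      the row relation kills the rest; E is constant and is evaluated at 0.\<close>
    define E where "E = H i - mConst (\<gamma> i) * H p"
    have "mpderiv k E = 0" for k
    proof (cases "k < m")
      case True
      have "mpderiv k E = mConst (\<gamma> k) * (mpderiv p (H i) - mConst (\<gamma> i) * mpderiv p (H p))"
        by (simp add: E_def mpderiv_diff mpderiv_mult deriv[OF i True] deriv[OF p True] algebra_simps)
      also have "\<dots> = 0" unfolding deriv_p[OF i] by simp
      finally show ?thesis .
    next
      case False
      then show ?thesis
        using mpderiv_outside[OF H_in[OF i], of k] mpderiv_outside[OF H_in[OF p], of k]
        by (simp add: E_def mpderiv_diff mpderiv_mult)
    qed
    then have "E = mConst (meval (\<lambda>_. 0) E)" by (rule mpderiv_all_zero)
    then have "H i - mConst (\<gamma> i) * H p =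
        mConst (meval (\<lambda>_. 0) (H i)) - mConst (\<gamma> i) * mConst (meval (\<lambda>_. 0) (H p))"
      by (simp add: E_def meval.hom_minus meval.hom_mult mConst_diff mConst_mult)
    then show ?thesis by (simp add: algebra_simps)
  qed
  show thesis by (rule that[OF p \<gamma>p col_space H_eq])
qed

lemma rank2_structure:
  assumes rank: "vec_space.rank m (jacobian m H) = 2" and apex: "image_apex m H \<beta>"
  obtains \<gamma> \<delta> U V where "\<gamma> \<in> column_space" "\<delta> \<in> column_space"
    "\<And>i. i < m \<Longrightarrow> H i = mConst (\<beta> i) + mConst (\<gamma> i) * U + mConst (\<delta> i) * V"
    "\<And>k l. (\<And>i. i < m \<Longrightarrow> k * \<gamma> i + l * \<delta> i = 0) \<Longrightarrow> k = 0 \<and> l = 0"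
proof (rule jacobian_rank_2[OF rank])
  fix p q c e
  assume p: "p < m" and q: "q < m" and pq: "p \<noteq> q"
    and col: "\<And>i k. i < m \<Longrightarrow> k < m \<Longrightarrow>
      fderiv k (rat_fun (H i)) = c k * fderiv p (rat_fun (H i)) + e k * fderiv q (rat_fun (H i))"
    and ind: "\<And>a b. (\<And>i. i < m \<Longrightarrow> a * fderiv p (rat_fun (H i)) + b * fderiv q (rat_fun (H i)) = 0) \<Longrightarrow> a = 0 \<and> b = 0"
  define X Y Z where "X = mpderiv p (H p)" and "Y = mpderiv p (H q)" and "Z = mpderiv q (H q)"
  have Yq: "mpderiv q (H p) = Y" unfolding Y_def by (rule symmetric[OF q p])
  have ip: "fderiv p (rat_fun (H i)) = c i * rat_fun X + e i * rat_fun Y" if "i < m" for i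
    using col[OF p that] symmetric[OF p that] by (simp add: fderiv_rat_fun X_def Yq)
  have iq: "fderiv q (rat_fun (H i)) = c i * rat_fun Y + e i * rat_fun Z" if "i < m" for i
    using col[OF q that] symmetric[OF q that] by (simp add: fderiv_rat_fun Y_def Z_def)
  \<comment> \<open>Symmetry makes all entries of the two pivot columns combinations of the pivot
    block. If the block were singular, (Z, -Y) and (-Y, X) would be dependencies between these
    columns, hence zero.\<close>
  have nz: "X * Z - Y * Y \<noteq> 0"
  proof
    assume "X * Z - Y * Y = 0"
    from arg_cong[OF this, of rat_fun] have 0: "rat_fun X * rat_fun Z = rat_fun Y * rat_fun Y"
      by (simp del: rat_fun_eq_0_iff rat_fun_simps(7))
    have "rat_fun Z = 0 \<and> - rat_fun Y = 0"
    proof (rule ind)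
      fix i assume i: "i < m"
      have "rat_fun Z * (c i * rat_fun X + e i * rat_fun Y) + - rat_fun Y * (c i * rat_fun Y + e i * rat_fun Z)
          = c i * (rat_fun X * rat_fun Z - rat_fun Y * rat_fun Y)" by (simp add: algebra_simps)
      then show "rat_fun Z * fderiv p (rat_fun (H i)) + - rat_fun Y * fderiv q (rat_fun (H i)) = 0"
        unfolding ip[OF i] iq[OF i] 0 by simp
    qed
    moreover have "- rat_fun Y = 0 \<and> rat_fun X = 0"
    proof (rule ind)
      fix i assume i: "i < m"
      have "- rat_fun Y * (c i * rat_fun X + e i * rat_fun Y) + rat_fun X * (c i * rat_fun Y + e i * rat_fun Z)
          = e i * (rat_fun X * rat_fun Z - rat_fun Y * rat_fun Y)" by (simp add: algebra_simps)
      then show "- rat_fun Y * fderiv p (rat_fun (H i)) + rat_fun X * fderiv q (rat_fun (H i)) = 0"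
        unfolding ip[OF i] iq[OF i] 0 by simp
    qed
    ultimately have XY: "rat_fun X = 0" "rat_fun Y = 0" by simp_all
    have "(1 :: 'a mpoly fract) = 0 \<and> (0 :: 'a mpoly fract) = 0"
      by (rule ind) (simp add: ip XY del: rat_fun_eq_0_iff)
    then show False by simp
  qed
  have nz': "fderiv p (rat_fun (H p)) * fderiv q (rat_fun (H q)) - fderiv p (rat_fun (H q)) * fderiv p (rat_fun (H q)) \<noteq> 0"
  proof -
    have "rat_fun (X * Z - Y * Y) \<noteq> 0" using nz by (simp only: rat_fun_eq_0_iff not_False_eq_True)
    then show ?thesis by (simp only: fderiv_rat_fun X_def Y_def Z_def rat_fun_simps not_False_eq_True)
  qed
  have cone: "rat_fun (H i - mConst (\<beta> i)) =
      c i * rat_fun (H p - mConst (\<beta> p)) + e i * rat_fun (H q - mConst (\<beta> q))" if "i < m" for i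
    by (rule apex_cone[OF p q that pq nz' col apex])
  have "\<forall>j. \<exists>g. j < m \<longrightarrow> c j = rat_fun (mConst (fst g)) \<and> e j = rat_fun (mConst (snd g))"
  proof
    fix j
    show "\<exists>g. j < m \<longrightarrow> c j = rat_fun (mConst (fst g)) \<and> e j = rat_fun (mConst (snd g))"
    proof (cases "j < m")
      case True
      obtain g d where "c j = rat_fun (mConst g)" "e j = rat_fun (mConst d)"
        by (rule rank2_constant[OF p q True pq nz' col cone])
      then show ?thesis by (intro exI[of _ "(g, d)"]) simp
    qed simp
  qed
  from choice[OF this] obtain g where g: "\<forall>j. j < m \<longrightarrow> c j = rat_fun (mConst (fst (g j))) \<and> e j = rat_fun (mConst (snd (g j)))"
    by (rule exE)
  define \<gamma> \<delta> where "\<gamma> j = fst (g j)" and "\<delta> j = snd (g j)" for j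
  have ce: "c j = rat_fun (mConst (\<gamma> j))" "e j = rat_fun (mConst (\<delta> j))" if "j < m" for j
    using g that by (simp_all add: \<gamma>_def \<delta>_def)
  have poly: "mpderiv p (H i) = mConst (\<gamma> i) * X + mConst (\<delta> i) * Y"
    "mpderiv q (H i) = mConst (\<gamma> i) * Y + mConst (\<delta> i) * Z" if "i < m" for i
  proof -
    have "rat_fun (mpderiv p (H i)) = rat_fun (mConst (\<gamma> i) * X + mConst (\<delta> i) * Y)"
      "rat_fun (mpderiv q (H i)) = rat_fun (mConst (\<gamma> i) * Y + mConst (\<delta> i) * Z)"
      using ip[OF that] iq[OF that] ce[OF that] by (simp_all add: fderiv_rat_fun)
    then show "mpderiv p (H i) = mConst (\<gamma> i) * X + mConst (\<delta> i) * Y"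
      "mpderiv q (H i) = mConst (\<gamma> i) * Y + mConst (\<delta> i) * Z" by (simp_all only: rat_fun_simps(7))
  qed
  have pivot: "(\<Sum>k<m. (if k = p then S else if k = q then T else 0) * mpderiv k (H i)) =
      S * mpderiv p (H i) + T * mpderiv q (H i)" for S T i
  proof -
    have "(\<Sum>k<m. (if k = p then S else if k = q then T else 0) * mpderiv k (H i)) =
        (\<Sum>k\<in>{p, q}. (if k = p then S else if k = q then T else 0) * mpderiv k (H i))"
      using p q by (intro sum.mono_neutral_right) auto
    then show ?thesis using pq by simp
  qed
  show thesis
  proof (rule that)
    \<comment> \<open>The multipliers (Z, -Y) for \<gamma>, and (-Y, X) for \<delta>, are the rows
      of the adjugate of the pivot block, and \<Delta> is its determinant.\<close>
    show "\<gamma> \<in> column_space"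
      unfolding column_space_def
    proof (intro CollectI exI conjI allI impI)
      fix i assume i: "i < m"
      show "(X * Z - Y * Y) * mConst (\<gamma> i) =
          (\<Sum>k<m. (if k = p then Z else if k = q then - Y else 0) * mpderiv k (H i))"
        unfolding pivot poly[OF i] by (simp add: algebra_simps)
    qed (rule nz)
    show "\<delta> \<in> column_space"
      unfolding column_space_def
    proof (intro CollectI exI conjI allI impI)
      fix i assume i: "i < m"
      show "(X * Z - Y * Y) * mConst (\<delta> i) =
          (\<Sum>k<m. (if k = p then - Y else if k = q then X else 0) * mpderiv k (H i))"
        unfolding pivot poly[OF i] by (simp add: algebra_simps)
    qed (rule nz)
    show "H i = mConst (\<beta> i) + mConst (\<gamma> i) * (H p - mConst (\<beta> p)) + mConst (\<delta> i) * (H q - mConst (\<beta> q))"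
      if i: "i < m" for i
    proof -
      have "rat_fun (H i - mConst (\<beta> i)) =
          rat_fun (mConst (\<gamma> i) * (H p - mConst (\<beta> p)) + mConst (\<delta> i) * (H q - mConst (\<beta> q)))"
        using cone[OF i] ce[OF i] by (simp only: rat_fun_simps(3,6))
      then have "H i - mConst (\<beta> i) = mConst (\<gamma> i) * (H p - mConst (\<beta> p)) + mConst (\<delta> i) * (H q - mConst (\<beta> q))"
        by (simp only: rat_fun_simps(7))
      then show ?thesis by (simp add: algebra_simps)
    qed
    \<comment> \<open>At the coordinates p and q the vectors \<gamma> and \<delta> form the identity
      matrix, which gives their independence over L.\<close>
    have "c p - 1 = 0 \<and> e p = 0"
    proof (rule ind)
      show "(c p - 1) * fderiv p (rat_fun (H i)) + e p * fderiv q (rat_fun (H i)) = 0" if "i < m" for i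
      proof -
        have "(c p - 1) * fderiv p (rat_fun (H i)) + e p * fderiv q (rat_fun (H i)) =
            (c p * fderiv p (rat_fun (H i)) + e p * fderiv q (rat_fun (H i))) - fderiv p (rat_fun (H i))"
          by (simp add: left_diff_distrib)
        then show ?thesis unfolding col[OF that p, symmetric] by simp
      qed
    qed
    then have "rat_fun (mConst (\<gamma> p)) = rat_fun (mConst 1)" "rat_fun (mConst (\<delta> p)) = rat_fun (mConst 0)"
      using ce[OF p] by simp_all
    then have 1: "\<gamma> p = 1" "\<delta> p = 0" by (simp_all only: rat_fun_simps(7) mConst_eq_iff)
    have "c q = 0 \<and> e q - 1 = 0"
    proof (rule ind)
      show "c q * fderiv p (rat_fun (H i)) + (e q - 1) * fderiv q (rat_fun (H i)) = 0" if "i < m" for i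
      proof -
        have "c q * fderiv p (rat_fun (H i)) + (e q - 1) * fderiv q (rat_fun (H i)) =
            (c q * fderiv p (rat_fun (H i)) + e q * fderiv q (rat_fun (H i))) - fderiv q (rat_fun (H i))"
          by (simp add: left_diff_distrib)
        then show ?thesis unfolding col[OF that q, symmetric] by simp
      qed
    qed
    then have "rat_fun (mConst (\<gamma> q)) = rat_fun (mConst 0)" "rat_fun (mConst (\<delta> q)) = rat_fun (mConst 1)"
      using ce[OF q] by simp_all
    then have 2: "\<gamma> q = 0" "\<delta> q = 1" by (simp_all only: rat_fun_simps(7) mConst_eq_iff)
    show "k = 0 \<and> l = 0" if kl: "\<And>i. i < m \<Longrightarrow> k * \<gamma> i + l * \<delta> i = 0" for k l
      using kl[OF p] kl[OF q] 1 2 by simp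
  qed
qed

end

section \<open>Integrality of the factor in one variable\<close>

lemma lookup_msubst_scale:
  assumes g: "g \<in> polys_in 1"
  shows "Poly_Mapping.lookup (msubst (\<lambda>_. mConst c * mVar 0) g) (Poly_Mapping.single 0 k) =
    c ^ k * Poly_Mapping.lookup g (Poly_Mapping.single 0 k)"
proof -
  have mon: "msubst (\<lambda>_. mConst c * mVar 0) (Poly_Mapping.single a v) = Poly_Mapping.single a (c ^ Poly_Mapping.lookup a 0 * v)"
    if a: "Poly_Mapping.keys a \<subseteq> {0}" for a v
  proof -
    have eq: "a = Poly_Mapping.single 0 (Poly_Mapping.lookup a 0)"
    proof (rule poly_mapping_eqI)
      fix i show "Poly_Mapping.lookup a i = Poly_Mapping.lookup (Poly_Mapping.single 0 (Poly_Mapping.lookup a 0)) i"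
        using a by (cases "i = 0") (auto simp: lookup_single in_keys_iff)
    qed
    have var: "(mVar 0 :: 'a mpoly) ^ j = Poly_Mapping.single (Poly_Mapping.single 0 j) 1" for j
      by (induction j) (simp_all add: mVar_def mult_single flip: single_add)
    have const: "(mConst c :: 'a mpoly) ^ j = mConst (c ^ j)" for j
      by (induction j) (simp_all add: mConst_mult)
    have "msubst (\<lambda>_. mConst c * mVar 0) (Poly_Mapping.single a v) =
        mConst v * monom_eval (\<lambda>_. mConst c * mVar 0) a"
      by (simp add: msubst_eq_eval_hom eval_hom_single[OF comm_ring_hom_mConst])
    also have "monom_eval (\<lambda>_. mConst c * mVar 0) a = (mConst c * mVar 0) ^ Poly_Mapping.lookup a 0"
      by (subst eq) (rule monom_eval_single)
    also have "\<dots> = Poly_Mapping.single a (c ^ Poly_Mapping.lookup a 0)"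
      unfolding power_mult_distrib var const eq[symmetric] by (simp add: mConst_def mult_single)
    finally show ?thesis by (simp add: mConst_def mult_single mult.commute)
  qed
  have "msubst (\<lambda>_. mConst c * mVar 0) g =
      (\<Sum>a\<in>Poly_Mapping.keys g. msubst (\<lambda>_. mConst c * mVar 0) (Poly_Mapping.single a (Poly_Mapping.lookup g a)))"
    by (subst poly_mapping_sum_single[of g]) (rule msubst.hom_sum)
  also have "\<dots> = (\<Sum>a\<in>Poly_Mapping.keys g. Poly_Mapping.single a (c ^ Poly_Mapping.lookup a 0 * Poly_Mapping.lookup g a))"
    using g by (intro sum.cong refl mon) (auto simp: polys_in_def)
  finally show ?thesis
    by (simp add: lookup_sum lookup_single when_def in_keys_iff)
qed

text \<open>\<open>axis\<close> is the identity f(x) = g(p.x) restricted to the i-th coordinate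
  axis. It shows that the k-th coefficient of g times \<open>p i ^ k\<close> is in R for every i,
  and \<open>primitive_power\<close> removes the powers.\<close>

lemma (in fraction_field) primitive_coeffs_in:
  assumes gcd: "gcd_domain R" and p: "primitive R m p" and m: "0 < m"
    and g: "g \<in> polys_in 1" and f: "f \<in> coeffs_in R"
    and axis: "\<And>i. i < m \<Longrightarrow> msubst (\<lambda>_. mConst (p i) * mVar 0) g = msubst (\<lambda>k. if k = i then mVar 0 else 0) f"
  shows "g \<in> coeffs_in R"
  unfolding coeffs_in_def
proof (intro CollectI ballI)
  fix a assume a: "a \<in> Poly_Mapping.keys g"
  define k where "k = Poly_Mapping.lookup a 0"
  have keys: "Poly_Mapping.keys a \<subseteq> {0}" using a g by (auto simp: polys_in_def)
  have ak: "a = Poly_Mapping.single 0 k"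
  proof (rule poly_mapping_eqI)
    fix i show "Poly_Mapping.lookup a i = Poly_Mapping.lookup (Poly_Mapping.single 0 k) i"
      using keys by (cases "i = 0") (auto simp: k_def lookup_single in_keys_iff)
  qed
  have "Poly_Mapping.lookup g a * p i ^ k \<in> R" if i: "i < m" for i
  proof -
    have "0 \<in> coeffs_in R" by (simp add: coeffs_in_def)
    then have "msubst (\<lambda>k. if k = i then mVar 0 else 0) f \<in> coeffs_in R"
      by (intro coeffs_in_msubst[OF subring f]) (auto intro: coeffs_in_mVar[OF subring])
    then have "Poly_Mapping.lookup (msubst (\<lambda>_. mConst (p i) * mVar 0) g) (Poly_Mapping.single 0 k) \<in> R"
      unfolding axis[OF i] coeffs_in_iff[OF subring] by blast
    then show ?thesis unfolding lookup_msubst_scale[OF g] ak by (simp add: mult.commute)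
  qed
  then show "Poly_Mapping.lookup g a \<in> R" by (rule primitive_power[OF gcd p m])
qed

context dense_plane begin

text \<open>Values stay in the plane, being joins of plane points with \<beta> translated by p and
  q. Where C = 1 the term with H vanishes, so surjectivity only concerns A and B.\<close>

lemma relation_join:
  assumes f: "f \<in> polys_in m"
    and onto: "\<And>l n. \<exists>x. meval x C = 1 \<and> (\<forall>i<m. meval x A * p i + meval x B * q i = l * p i + n * q i)"
  shows "msubst H f = 0 \<longleftrightarrow>
    msubst (\<lambda>i. A * mConst (p i) + B * mConst (q i) + (1 - C) * H i + C * mConst (\<beta> i)) f = 0"
    (is "_ \<longleftrightarrow> msubst ?G f = 0")
proof (rule relation_iff[OF f])
  fix x
  obtain l n where ln: "\<forall>i<m. meval x (H i) = \<beta> i + l * p i + n * q i" using in_plane[of x] by blast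
  have "meval x (?G i) = \<beta> i + (meval x A + (1 - meval x C) * l) * p i + (meval x B + (1 - meval x C) * n) * q i"
    if "i < m" for i
    using ln that by (simp add: meval.hom_add meval.hom_mult meval.hom_minus algebra_simps)
  then show "\<exists>l n. \<forall>i<m. meval x (?G i) = \<beta> i + l * p i + n * q i" by blast
next
  fix l n
  obtain x where x: "meval x C = 1" "\<forall>i<m. meval x A * p i + meval x B * q i = l * p i + n * q i"
    using onto[of l n] by blast
  have "meval x (?G i) = \<beta> i + l * p i + n * q i" if "i < m" for i
  proof -
    have "meval x (?G i) = \<beta> i + (meval x A * p i + meval x B * q i)"
      using x(1) by (simp add: meval.hom_add meval.hom_mult meval.hom_minus)
    then show ?thesis using x(2) that by (simp add: add.assoc)
  qed
  then show "\<exists>x. \<forall>i<m. meval x (?G i) = \<beta> i + l * p i + n * q i" by blast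
qed

lemma relation_param:
  assumes f: "f \<in> polys_in m"
    and onto: "\<And>l n. \<exists>x. \<forall>i<m. meval x A * p i + meval x B * q i = l * p i + n * q i"
  shows "msubst H f = 0 \<longleftrightarrow> msubst (\<lambda>i. A * mConst (p i) + B * mConst (q i) + mConst (\<beta> i)) f = 0"
    (is "_ \<longleftrightarrow> msubst ?G f = 0")
proof (rule relation_iff[OF f])
  fix x
  have "meval x (?G i) = \<beta> i + meval x A * p i + meval x B * q i" for i
    by (simp add: meval.hom_add meval.hom_mult)
  then show "\<exists>l n. \<forall>i<m. meval x (?G i) = \<beta> i + l * p i + n * q i" by blast
next
  fix l n
  obtain x where x: "\<forall>i<m. meval x A * p i + meval x B * q i = l * p i + n * q i"
    using onto[of l n] by blast
  have "meval x (?G i) = \<beta> i + l * p i + n * q i" if "i < m" for i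
  proof -
    have "meval x (?G i) = \<beta> i + (meval x A * p i + meval x B * q i)"
      by (simp add: meval.hom_add meval.hom_mult)
    then show ?thesis using x that by (simp add: add.assoc)
  qed
  then show "\<exists>x. \<forall>i<m. meval x (?G i) = \<beta> i + l * p i + n * q i" by blast
qed

lemma apex: "image_apex m H \<beta>"
proof -
  have "\<beta> \<in> {(\<lambda>i. \<beta> i + l * p i + n * q i) | l n. True}"
    by (intro CollectI exI[of _ 0]) simp
  then show ?thesis unfolding apices_eq[symmetric] by simp
qed

end

section \<open>Integral form of the potential\<close>

context gradient_map begin

text \<open>H(0) is the apex used in rank at most one: its coordinates are constant terms of H and
  hence lie in R.\<close>

definition value_at_0 :: "nat \<Rightarrow> 'a" where
  "value_at_0 i = (if i < m then meval (\<lambda>_. 0) (H i) else 0)"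

lemma value_at_0_vecs: "value_at_0 \<in> vecs m"
  by (simp add: vecs_def value_at_0_def)

lemma potential_shift: "meval x h = meval x (h - lin_form m \<beta>) + (\<Sum>i<m. \<beta> i * x i)"
  by (simp add: meval.hom_minus)

lemma rank0_H:
  assumes rank: "vec_space.rank m (jacobian m H) = 0" and i: "i < m"
  shows "H i = mConst (value_at_0 i)"
proof -
  have "mpderiv k (H i) = 0" for k
    using jacobian_rank_0[OF rank i, of k] mpderiv_outside[OF H_in[OF i], of k] by (cases "k < m") auto
  then have "H i = mConst (meval (\<lambda>_. 0) (H i))" by (rule mpderiv_all_zero)
  then show ?thesis using i by (simp add: value_at_0_def)
qed

lemma rank0_plane:
  assumes rank: "vec_space.rank m (jacobian m H) = 0"
  shows "dense_plane m H value_at_0 (\<lambda>_. 0) (\<lambda>_. 0) (\<lambda>_. 0) (\<lambda>_. 0)"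
  by (rule dense_planeI[where U = 0 and V = 0])
    (simp_all add: value_at_0_vecs rank0_H[OF rank] column_space_zero dual_pair_def, simp_all add: vecs_def)

lemma rank0_potential:
  assumes rank: "vec_space.rank m (jacobian m H) = 0"
  shows "h = mConst (meval (\<lambda>_. 0) h) + lin_form m value_at_0"
  unfolding mpoly_eq_iff
proof
  fix x
  let ?h = "h - lin_form m value_at_0"
  have "meval x ?h = meval (\<lambda>k. (\<Sum>i<m. 0 * x i) * 0 + (\<Sum>i<m. 0 * x i) * 0) ?h"
    by (rule potential_reduces[where U = 0 and V = 0]) (simp_all add: rank0_H[OF rank] dual_pair_def)
  also have "\<dots> = meval (\<lambda>_. 0) h" by (simp add: meval.hom_minus)
  finally show "meval x h = meval x (mConst (meval (\<lambda>_. 0) h) + lin_form m value_at_0)"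
    by (simp only: potential_shift[of x value_at_0] meval.hom_add meval_lin_form meval_mConst)
qed

lemma dual_pair_single:
  fixes p :: "nat \<Rightarrow> 'a"
  assumes "j < m" "p j \<noteq> 0"
  shows "dual_pair m p (\<lambda>_. 0) (\<lambda>k. if k = j then 1 / p j else 0) (\<lambda>_. 0)"
proof -
  have "(\<Sum>k<m. (if k = j then 1 / p j else 0) * p k) = (\<Sum>k<m. if k = j then 1 else 0)"
    using assms(2) by (intro sum.cong) auto
  then show ?thesis using assms(1) by (simp add: dual_pair_def)
qed

text \<open>g is the shifted potential on the line spanned by the j-th unit vector divided by
  \<open>p j\<close>. This division hides integrality, which \<open>primitive_coeffs_in\<close>
  recovers.\<close>

lemma rank1_potential:
  assumes R: "fraction_field_of R" and gcd: "gcd_domain R" and hR: "h \<in> coeffs_in R"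
    and \<beta>: "\<forall>i<m. \<beta> i \<in> R" and p: "primitive R m p" and j: "j < m" "p j \<noteq> 0"
    and U: "\<And>i. i < m \<Longrightarrow> H i = mConst (\<beta> i) + mConst (p i) * U"
  shows "\<exists>g \<in> polys_in 1 \<inter> coeffs_in R. h = msubst (\<lambda>_. lin_form m p) g + lin_form m \<beta>"
proof -
  interpret fraction_field R by unfold_locales (rule R)
  define a where "a k = (if k = j then 1 / p j else 0)" for k
  let ?h = "h - lin_form m \<beta>"
  have reduce: "meval x ?h = meval (\<lambda>k. (\<Sum>i<m. p i * x i) * a k) ?h" for x
  proof -
    have "meval x ?h = meval (\<lambda>k. (\<Sum>i<m. p i * x i) * a k + (\<Sum>i<m. 0 * x i) * 0) ?h"
      by (rule potential_reduces[where U = U and V = 0])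
        (use dual_pair_single[of j p] j U in \<open>simp_all add: a_def[abs_def]\<close>)
    then show ?thesis by simp
  qed
  define g where "g = msubst (\<lambda>k. mConst (a k) * mVar 0) ?h"
  have g_in: "g \<in> polys_in 1"
    unfolding g_def by (rule msubst_polys_in[OF shifted_in]) (intro polys_in_mult polys_in_mConst polys_in_mVar, simp)
  have hR': "?h \<in> coeffs_in R"
    using \<beta> by (intro coeffs_in_diff subring hR lin_form_coeffs_in)
  have axis: "msubst (\<lambda>_. mConst (p i) * mVar 0) g = msubst (\<lambda>k. if k = i then mVar 0 else 0) ?h"
    if i: "i < m" for i
    unfolding mpoly_eq_iff
  proof
    fix x :: "nat \<Rightarrow> 'a"
    define y where "y k = (if k = i then x 0 else 0)" for k
    have "(\<Sum>k<m. p k * y k) = (\<Sum>k<m. if k = i then p i * x 0 else 0)"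
      by (intro sum.cong) (auto simp: y_def)
    also have "\<dots> = p i * x 0" using i by simp
    finally have dot: "(\<Sum>k<m. p k * y k) = p i * x 0" .
    have "meval x (msubst (\<lambda>_. mConst (p i) * mVar 0) g) = meval (\<lambda>k. (p i * x 0) * a k) ?h"
      unfolding g_def meval_msubst by (simp add: meval.hom_mult mult.commute)
    also have "\<dots> = meval y ?h" by (simp only: reduce[of y] dot)
    also have "\<dots> = meval (\<lambda>k. meval x (if k = i then mVar 0 else 0)) ?h"
      by (rule arg_cong[of _ _ "\<lambda>z. meval z ?h"]) (auto simp: y_def)
    finally show "meval x (msubst (\<lambda>_. mConst (p i) * mVar 0) g) = meval x (msubst (\<lambda>k. if k = i then mVar 0 else 0) ?h)"
      by (simp only: meval_msubst)
  qed
  have "0 < m" using j by simp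
  then have "g \<in> coeffs_in R" by (rule primitive_coeffs_in[OF gcd p _ g_in hR' axis])
  moreover have "h = msubst (\<lambda>_. lin_form m p) g + lin_form m \<beta>"
    unfolding mpoly_eq_iff
  proof
    fix x
    have "meval x (msubst (\<lambda>_. lin_form m p) g) = meval (\<lambda>k. (\<Sum>i<m. p i * x i) * a k) ?h"
      unfolding g_def meval_msubst by (simp add: meval.hom_mult mult.commute)
    also have "\<dots> = meval x ?h" by (rule reduce[symmetric])
    finally show "meval x h = meval x (msubst (\<lambda>_. lin_form m p) g + lin_form m \<beta>)"
      by (simp only: potential_shift[of x \<beta>] meval.hom_add meval_lin_form)
  qed
  ultimately show ?thesis using g_in by blast
qed

text \<open>Here the section (a, b) of the two linear forms has entries in R, so substituting it
  into the shifted potential keeps coefficients in R.\<close>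

lemma rank2_potential:
  assumes R: "subring R" and hR: "h \<in> coeffs_in R" and \<beta>: "\<forall>i<m. \<beta> i \<in> R"
    and ab: "\<And>i. a i \<in> R" "\<And>i. b i \<in> R"
    and UV: "\<And>i. i < m \<Longrightarrow> H i = mConst (\<beta> i) + mConst (p i) * U + mConst (q i) * V"
    and dual: "dual_pair m p q a b"
  shows "\<exists>g \<in> polys_in 2 \<inter> coeffs_in R.
    h = msubst (\<lambda>k. if k = 0 then lin_form m p else lin_form m q) g + lin_form m \<beta>"
proof -
  let ?h = "h - lin_form m \<beta>"
  define g where "g = msubst (\<lambda>k. mConst (a k) * mVar 0 + mConst (b k) * mVar 1) ?h"
  have "g \<in> polys_in 2"
    unfolding g_def by (rule msubst_polys_in[OF shifted_in])
      (intro polys_in_add polys_in_mult polys_in_mConst polys_in_mVar, simp_all)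
  moreover have "?h \<in> coeffs_in R"
    using \<beta> by (intro coeffs_in_diff R hR lin_form_coeffs_in)
  then have "g \<in> coeffs_in R"
    unfolding g_def by (rule coeffs_in_msubst[OF R])
      (intro coeffs_in_add coeffs_in_mult coeffs_in_mConst coeffs_in_mVar R ab)
  moreover have "h = msubst (\<lambda>k. if k = 0 then lin_form m p else lin_form m q) g + lin_form m \<beta>"
    unfolding mpoly_eq_iff
  proof
    fix x
    have "meval x (msubst (\<lambda>k. if k = 0 then lin_form m p else lin_form m q) g) =
        meval (\<lambda>k. (\<Sum>i<m. p i * x i) * a k + (\<Sum>i<m. q i * x i) * b k) ?h"
      unfolding g_def meval_msubst by (simp add: meval.hom_mult meval.hom_add mult.commute)
    also have "\<dots> = meval x ?h" by (rule potential_reduces[OF UV dual, symmetric])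
    finally show "meval x h = meval x (msubst (\<lambda>k. if k = 0 then lin_form m p else lin_form m q) g + lin_form m \<beta>)"
      by (simp only: potential_shift[of x \<beta>] meval.hom_add meval_lin_form)
  qed
  ultimately show ?thesis by blast
qed

end

section \<open>The structure theorem\<close>

theorem theorem6p2:
  fixes R :: "'a::field_char_0 set"
    and m :: nat
    and H :: "nat \<Rightarrow> 'a mpoly"
    and h :: "'a mpoly"
  assumes R: "fraction_field_of R"
    and H_in: "\<forall>i<m. H i \<in> polys_in m \<inter> coeffs_in R"
    and h_in: "h \<in> polys_in m \<inter> coeffs_in R"
    and sym: "\<forall>i<m. \<forall>j<m. mpderiv j (H i) = mpderiv i (H j)"
    and grad: "\<forall>i<m. H i = mpderiv i h"
  defines "r \<equiv> vec_space.rank m (jacobian m H)"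
  shows
  \<comment> \<open>(i)\<close>
  "(r = 0 \<longrightarrow>
     (\<exists>b \<in> vecs m. (\<forall>i<m. b i \<in> R) \<and> image_apex m H b \<and>
        (\<exists>g\<in>R. h = mConst g + lin_form m b) \<and>
        zariski_closure m (poly_map_image m H) = {b} \<and>
        {a. image_apex m H a} = {b} \<and>
        (\<forall>f\<in>polys_in m.
           (msubst H f = 0 \<longleftrightarrow>
              msubst (\<lambda>i. (1 - mVar m) * H i + mVar m * mConst (b i)) f = 0) \<and>
           (msubst H f = 0 \<longleftrightarrow> meval b f = 0))))
  \<and>
  \<comment> \<open>(ii)\<close>
  (r \<le> 1 \<and> gcd_domain R \<longrightarrow>
     (\<exists>b \<in> vecs m. (\<forall>i<m. b i \<in> R) \<and> image_apex m H b \<and>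
        (\<exists>g \<in> polys_in 1 \<inter> coeffs_in R. \<exists>p \<in> vecs m. (\<forall>i<m. p i \<in> R) \<and>
           vec_space.rank m (mat_of_cols m [vec m p]) = r \<and>
           h = msubst (\<lambda>_. lin_form m p) g + lin_form m b \<and>
           zariski_closure m (poly_map_image m H) = {(\<lambda>i. b i + l * p i) | l. True} \<and>
           {a. image_apex m H a} = {(\<lambda>i. b i + l * p i) | l. True} \<and>
        (\<forall>f\<in>polys_in m.
           (msubst H f = 0 \<longleftrightarrow>
              msubst (\<lambda>i. mVar m * mConst (p i) + (1 - mVar (Suc m)) * H i
                           + mVar (Suc m) * mConst (b i)) f = 0) \<and>
           (msubst H f = 0 \<longleftrightarrow>
              msubst (\<lambda>i. mVar m * mConst (p i) + mConst (b i)) f = 0)))))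
  \<and>
  \<comment> \<open>(iii)\<close>
  (\<forall>b \<in> vecs m. (\<forall>i<m. b i \<in> R) \<and> image_apex m H b \<and> r \<le> 2 \<and> bezout_domain R \<longrightarrow>
     (\<exists>g \<in> polys_in 2 \<inter> coeffs_in R. \<exists>p \<in> vecs m. \<exists>q \<in> vecs m.
        (\<forall>i<m. p i \<in> R \<and> q i \<in> R) \<and>
        vec_space.rank m (mat_of_cols m [vec m p, vec m q]) = r \<and>
        h = msubst (\<lambda>k. if k = 0 then lin_form m p else lin_form m q) g + lin_form m b \<and>
        zariski_closure m (poly_map_image m H) =
          {(\<lambda>i. b i + l * p i + n * q i) | l n. True} \<and>
        {a. image_apex m H a} = {(\<lambda>i. b i + l * p i + n * q i) | l n. True} \<and>
        (\<forall>f\<in>polys_in m.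
           (msubst H f = 0 \<longleftrightarrow>
              msubst (\<lambda>i. mVar m * mConst (p i) + mVar (Suc m) * mConst (q i)
                        + (1 - mVar (Suc (Suc m))) * H i
                        + mVar (Suc (Suc m)) * mConst (b i)) f = 0) \<and>
           (msubst H f = 0 \<longleftrightarrow>
              msubst (\<lambda>i. mVar m * mConst (p i) + mVar (Suc m) * mConst (q i)
                        + mConst (b i)) f = 0))))"
proof -
  interpret fraction_field R by unfold_locales (rule R)
  have hR: "h \<in> coeffs_in R" using h_in by simp
  have HR: "\<forall>i<m. H i \<in> coeffs_in R" using H_in by simp
  interpret gradient_map m H h using h_in grad by unfold_locales auto
  let ?\<beta>0 = value_at_0
  have \<beta>0R: "\<forall>i<m. ?\<beta>0 i \<in> R"
    using HR by (auto simp: value_at_0_def intro!: meval_coeffs_in subring zero_in)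
  \<comment> \<open>The direction over L is rescaled to a primitive vector and the inverse scalar is
    absorbed into U. Both (ii) and the rank-one case of (iii) use this.\<close>
  have rank1: "\<exists>p U. p \<in> vecs m \<and> (\<forall>i<m. p i \<in> R) \<and> primitive R m p \<and> (\<exists>j<m. p j \<noteq> 0) \<and>
      p \<in> column_space \<and> (\<forall>i<m. H i = mConst (?\<beta>0 i) + mConst (p i) * U)"
    if r1: "r = 1" and gcd: "gcd_domain R"
  proof (rule rank1_structure[OF r1[unfolded r_def]])
    fix \<gamma> U j
    assume j: "j < m" "\<gamma> j = 1" and \<gamma>: "\<gamma> \<in> column_space"
      and U: "\<And>i. i < m \<Longrightarrow> H i = mConst (meval (\<lambda>_. 0) (H i)) + mConst (\<gamma> i) * U"
    obtain \<sigma> where \<sigma>: "\<sigma> \<noteq> 0" "primitive R m (\<lambda>i. \<sigma> * \<gamma> i)"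
      by (rule primitive_multiple[OF gcd j(1), of \<gamma>]) (use j(2) in auto)
    define p where "p i = (if i < m then \<sigma> * \<gamma> i else 0)" for i
    have "primitive R m p" using \<sigma>(2) by (simp add: primitive_def p_def)
    moreover have "p \<in> column_space"
      by (rule column_space_combination[OF \<gamma> column_space_zero, of p \<sigma> 0]) (simp add: p_def)
    moreover have "H i = mConst (?\<beta>0 i) + mConst (p i) * (mConst (1 / \<sigma>) * U)" if "i < m" for i
    proof -
      have "mConst (p i) * (mConst (1 / \<sigma>) * U) = mConst (p i * (1 / \<sigma>)) * U"
        by (simp only: mConst_mult mult.assoc)
      then show ?thesis using U[OF that] that \<sigma>(1) by (simp add: value_at_0_def p_def)
    qed
    moreover have "p j \<noteq> 0" using j \<sigma>(1) by (simp add: p_def)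
    ultimately show ?thesis
      using j(1) by (intro exI[of _ p] exI[of _ "mConst (1 / \<sigma>) * U"]) (auto simp: vecs_def p_def primitive_def)
  qed
  have zero_vecs: "(\<lambda>_. 0) \<in> vecs m" by (simp add: vecs_def)
  \<comment> \<open>In rank 0 the factor g is a constant, so the linear forms substituted into it do
    not matter.\<close>
  have poly_const: "\<exists>g \<in> polys_in n \<inter> coeffs_in R. h = msubst s g + lin_form m ?\<beta>0"
    if "r = 0" for n s
    using rank0_potential[OF that[unfolded r_def]] meval_coeffs_in[OF subring hR, of "\<lambda>_. 0"]
    by (intro bexI[of _ "mConst (meval (\<lambda>_. 0) h)"])
      (simp_all add: zero_in polys_in_mConst coeffs_in_mConst[OF subring])
  show ?thesis
  proof (intro conjI impI ballI, goal_cases)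
    case r0: 1
    interpret dense_plane m H ?\<beta>0 "\<lambda>_. 0" "\<lambda>_. 0" "\<lambda>_. 0" "\<lambda>_. 0"
      by (rule rank0_plane[OF r0[unfolded r_def]])
    have closure: "zariski_closure m (poly_map_image m H) = {?\<beta>0}" and apices: "{a. image_apex m H a} = {?\<beta>0}"
      using zariski_closure_eq apices_eq by simp_all
    have g: "\<exists>g\<in>R. h = mConst g + lin_form m ?\<beta>0"
      using rank0_potential[OF r0[unfolded r_def]] meval_coeffs_in[OF subring hR, of "\<lambda>_. 0"] zero_in by blast
    have iffs: "(msubst H f = 0 \<longleftrightarrow> msubst (\<lambda>i. (1 - mVar m) * H i + mVar m * mConst (?\<beta>0 i)) f = 0) \<and>
        (msubst H f = 0 \<longleftrightarrow> meval ?\<beta>0 f = 0)" if f: "f \<in> polys_in m" for f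
    proof
      have "\<exists>x. meval x (mVar m) = (1 :: 'a)" by (rule exI[of _ "\<lambda>_. 1"]) simp
      then show "msubst H f = 0 \<longleftrightarrow> msubst (\<lambda>i. (1 - mVar m) * H i + mVar m * mConst (?\<beta>0 i)) f = 0"
        using relation_join[OF f, of "mVar m" 0 0] by simp
      show "msubst H f = 0 \<longleftrightarrow> meval ?\<beta>0 f = 0"
        using relation_param[OF f, of 0 0] by (simp add: msubst_zero_iff[of "\<lambda>i. mConst (?\<beta>0 i)"])
    qed
    show ?case
      by (intro bexI[of _ ?\<beta>0] conjI[OF \<beta>0R] conjI[OF apex] conjI[OF g] conjI[OF closure] conjI[OF apices]
          ballI iffs value_at_0_vecs)
  next
    case 2
    then have gcd: "gcd_domain R" and r: "r = 0 \<or> r = 1" by auto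
    have "\<exists>g \<in> polys_in 1 \<inter> coeffs_in R. \<exists>p \<in> vecs m. (\<forall>i<m. p i \<in> R) \<and>
        vec_space.rank m (mat_of_cols m [vec m p]) = r \<and>
        h = msubst (\<lambda>_. lin_form m p) g + lin_form m ?\<beta>0 \<and>
        (\<exists>a b. dense_plane m H ?\<beta>0 p (\<lambda>_. 0) a b)"
      using r
    proof
      assume r0: "r = 0"
      obtain g where g: "g \<in> polys_in 1 \<inter> coeffs_in R"
          "h = msubst (\<lambda>_. lin_form m (\<lambda>_. 0)) g + lin_form m ?\<beta>0"
        using poly_const[OF r0] by blast
      have rank: "vec_space.rank m (mat_of_cols m [vec m (\<lambda>_. 0 :: 'a)]) = r"
        unfolding r0 by (rule rank_zero_cols(1)) simp_all
      show ?thesis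
        by (intro bexI[OF _ g(1)] bexI[OF _ zero_vecs] conjI[OF _ conjI[OF rank conjI[OF g(2)]]]
            exI[of _ "\<lambda>_. 0"]) (simp_all add: zero_in rank0_plane[OF r0[unfolded r_def]])
    next
      assume r1: "r = 1"
      obtain p U j where p: "p \<in> vecs m" "\<forall>i<m. p i \<in> R" "primitive R m p" "j < m" "p j \<noteq> 0" "p \<in> column_space"
        and U: "\<forall>i<m. H i = mConst (?\<beta>0 i) + mConst (p i) * U"
        using rank1[OF r1 gcd] by blast
      obtain g where g: "g \<in> polys_in 1 \<inter> coeffs_in R" "h = msubst (\<lambda>_. lin_form m p) g + lin_form m ?\<beta>0"
        using rank1_potential[OF R gcd hR \<beta>0R p(3,4,5)] U by blast
      have plane: "dense_plane m H ?\<beta>0 p (\<lambda>_. 0) (\<lambda>k. if k = j then 1 / p j else 0) (\<lambda>_. 0)"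
        by (rule dense_planeI[OF value_at_0_vecs p(1) zero_vecs _ p(6) column_space_zero dual_pair_single[of j p, OF p(4,5)],
              where U = U and V = 0]) (use U in simp)
      have rank: "vec_space.rank m (mat_of_cols m [vec m p]) = r"
        unfolding r1 using p(4,5) by (rule rank_one_col(1)) simp
      show ?thesis
        by (intro bexI[OF _ g(1)] bexI[OF _ p(1)] conjI[OF p(2)] conjI[OF rank] conjI[OF g(2)] exI) (rule plane)
    qed
    then obtain g p a b where g: "g \<in> polys_in 1 \<inter> coeffs_in R" and p: "p \<in> vecs m" "\<forall>i<m. p i \<in> R"
      and rank: "vec_space.rank m (mat_of_cols m [vec m p]) = r"
      and h: "h = msubst (\<lambda>_. lin_form m p) g + lin_form m ?\<beta>0"
      and plane: "dense_plane m H ?\<beta>0 p (\<lambda>_. 0) a b" by blast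
    interpret dense_plane m H ?\<beta>0 p "\<lambda>_. 0" a b by (rule plane)
    have closure: "zariski_closure m (poly_map_image m H) = {(\<lambda>i. ?\<beta>0 i + l * p i) | l. True}"
      and apices: "{a. image_apex m H a} = {(\<lambda>i. ?\<beta>0 i + l * p i) | l. True}"
      using zariski_closure_eq apices_eq by simp_all
    have iffs: "(msubst H f = 0 \<longleftrightarrow>
          msubst (\<lambda>i. mVar m * mConst (p i) + (1 - mVar (Suc m)) * H i + mVar (Suc m) * mConst (?\<beta>0 i)) f = 0) \<and>
        (msubst H f = 0 \<longleftrightarrow> msubst (\<lambda>i. mVar m * mConst (p i) + mConst (?\<beta>0 i)) f = 0)"
      if f: "f \<in> polys_in m" for f
    proof
      \<comment> \<open>The point has t = l and u = 1, so the cone is taken at its apex end.\<close>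
      have "\<exists>x. meval x (mVar (Suc m)) = (1 :: 'a) \<and> (\<forall>i<m. meval x (mVar m) * p i + meval x 0 * 0 = l * p i + n * 0)" for l n
        by (rule exI[of _ "\<lambda>k. if k = m then l else 1"]) simp
      from relation_join[OF f this] show "msubst H f = 0 \<longleftrightarrow>
          msubst (\<lambda>i. mVar m * mConst (p i) + (1 - mVar (Suc m)) * H i + mVar (Suc m) * mConst (?\<beta>0 i)) f = 0"
        by simp
      have "\<exists>x. \<forall>i<m. meval x (mVar m) * p i + meval x 0 * 0 = l * p i + n * 0" for l n
        by (rule exI[of _ "\<lambda>_. l"]) simp
      from relation_param[OF f this] show "msubst H f = 0 \<longleftrightarrow> msubst (\<lambda>i. mVar m * mConst (p i) + mConst (?\<beta>0 i)) f = 0"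
        by simp
    qed
    show ?case
      by (intro bexI[of _ ?\<beta>0] conjI[OF \<beta>0R] conjI[OF apex] bexI[OF _ g] bexI[OF _ p(1)] conjI[OF p(2)]
          conjI[OF rank] conjI[OF h] conjI[OF closure] conjI[OF apices] ballI iffs value_at_0_vecs)
  next
    case (3 b)
    note b = 3(1)
    have bR: "\<forall>i<m. b i \<in> R" and b_apex: "image_apex m H b" and bezout: "bezout_domain R"
      and r: "r = 0 \<or> r = 1 \<or> r = 2" using 3(2) by auto
    have gcd: "gcd_domain R" by (rule bezout_imp_gcd[OF bezout])
    let ?s = "\<lambda>p q k. if k = 0 then lin_form m p else lin_form m q"
    have "\<exists>g \<in> polys_in 2 \<inter> coeffs_in R. \<exists>p \<in> vecs m. \<exists>q \<in> vecs m. (\<forall>i<m. p i \<in> R \<and> q i \<in> R) \<and>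
        vec_space.rank m (mat_of_cols m [vec m p, vec m q]) = r \<and>
        h = msubst (?s p q) g + lin_form m b \<and> (\<exists>c d. dense_plane m H b p q c d)"
      using r
    proof (elim disjE)
      assume r0: "r = 0"
      interpret dense_plane m H ?\<beta>0 "\<lambda>_. 0" "\<lambda>_. 0" "\<lambda>_. 0" "\<lambda>_. 0"
        by (rule rank0_plane[OF r0[unfolded r_def]])
      have "b \<in> {a. image_apex m H a}" using b_apex by simp
      \<comment> \<open>The prescribed apex must be used; in rank 0 there is only one.\<close>
      then have b0: "b = ?\<beta>0" unfolding apices_eq by simp
      obtain g where g: "g \<in> polys_in 2 \<inter> coeffs_in R" "h = msubst (?s (\<lambda>_. 0) (\<lambda>_. 0)) g + lin_form m b"
        using poly_const[OF r0] b0 by blast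
      have rank: "vec_space.rank m (mat_of_cols m [vec m (\<lambda>_. 0 :: 'a), vec m (\<lambda>_. 0)]) = r"
        unfolding r0 by (rule rank_zero_cols(2)) simp_all
      show ?thesis
        by (intro bexI[OF _ g(1)] bexI[OF _ zero_vecs] conjI[OF _ conjI[OF rank conjI[OF g(2)]]]
            exI[of _ "\<lambda>_. 0"]) (simp_all add: zero_in b0 rank0_plane[OF r0[unfolded r_def]])
    next
      assume r1: "r = 1"
      obtain p U j where p: "p \<in> vecs m" "\<forall>i<m. p i \<in> R" "primitive R m p" "j < m" "p j \<noteq> 0" "p \<in> column_space"
        and U: "\<forall>i<m. H i = mConst (?\<beta>0 i) + mConst (p i) * U"
        using rank1[OF r1 gcd] by blast
      let ?a = "\<lambda>k. if k = j then 1 / p j else 0"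
      note dual = dual_pair_single[of j p, OF p(4,5)]
      interpret dense_plane m H ?\<beta>0 p "\<lambda>_. 0" ?a "\<lambda>_. 0"
        by (rule dense_planeI[OF value_at_0_vecs p(1) zero_vecs _ p(6) column_space_zero dual, where U = U and V = 0])
          (use U in simp)
      have "b \<in> {a. image_apex m H a}" using b_apex by simp
      then obtain l where l: "b = (\<lambda>i. ?\<beta>0 i + l * p i)" unfolding apices_eq by auto
      \<comment> \<open>The prescribed apex lies on the line through H(0), so recentring the
        factorisation at b only shifts U by a constant.\<close>
      have Ub: "H i = mConst (b i) + mConst (p i) * (U - mConst l)" if "i < m" for i
        using U that by (simp add: l mConst_add mConst_mult algebra_simps)
      obtain g where g: "g \<in> polys_in 1" "g \<in> coeffs_in R" "h = msubst (\<lambda>_. lin_form m p) g + lin_form m b"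
        using rank1_potential[OF R gcd hR bR p(3,4,5) Ub] by blast
      \<comment> \<open>With q = 0 the factor in one variable is reused as one in two variables that
        ignores the second.\<close>
      have "g \<in> polys_in 2" using g(1) by (rule polys_in_mono) simp
      moreover have "msubst (?s p (\<lambda>_. 0)) g = msubst (\<lambda>_. lin_form m p) g"
        by (rule msubst_cong[OF g(1)]) simp
      moreover have "dense_plane m H b p (\<lambda>_. 0) ?a (\<lambda>_. 0)"
        by (rule dense_planeI[OF b p(1) zero_vecs _ p(6) column_space_zero dual, where U = "U - mConst l" and V = 0])
          (simp add: Ub)
      moreover have "vec_space.rank m (mat_of_cols m [vec m p, vec m (\<lambda>_. 0)]) = r"
        unfolding r1 using p(4,5) by (rule rank_one_col(2)) simp
      ultimately show ?thesis
        using p(1,2) g(2,3) zero_vecs zero_in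
        by (intro bexI[of _ g] bexI[of _ p] bexI[of _ "\<lambda>_. 0"] conjI exI[of _ ?a] exI[of _ "\<lambda>_. 0"]) simp_all
    next
      assume r2: "r = 2"
      show ?thesis
      proof (rule rank2_structure[OF r2[unfolded r_def] b_apex])
        fix \<gamma> \<delta> U V
        assume col: "\<gamma> \<in> column_space" "\<delta> \<in> column_space"
          and UV: "\<And>i. i < m \<Longrightarrow> H i = mConst (b i) + mConst (\<gamma> i) * U + mConst (\<delta> i) * V"
          and ind: "\<And>k l. (\<And>i. i < m \<Longrightarrow> k * \<gamma> i + l * \<delta> i = 0) \<Longrightarrow> k = 0 \<and> l = 0"
        show ?thesis
        proof (rule dual_basis[OF bezout ind])
          fix p0 q0 a0 b0 A B C D A' B' C' D'
          assume inR: "\<And>i. i < m \<Longrightarrow> p0 i \<in> R \<and> q0 i \<in> R \<and> a0 i \<in> R \<and> b0 i \<in> R"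
            and dots: "(\<Sum>i<m. a0 i * p0 i) = 1" "(\<Sum>i<m. a0 i * q0 i) = 0"
              "(\<Sum>i<m. b0 i * p0 i) = 0" "(\<Sum>i<m. b0 i * q0 i) = 1"
            and p0: "\<And>i. p0 i = A * \<gamma> i + B * \<delta> i" and q0: "\<And>i. q0 i = C * \<gamma> i + D * \<delta> i"
            and \<gamma>: "\<And>i. \<gamma> i = A' * p0 i + B' * q0 i" and \<delta>: "\<And>i. \<delta> i = C' * p0 i + D' * q0 i"
          \<comment> \<open>Membership in R is known only for indices below m. Truncation puts p and
            q into \<open>vecs m\<close> and gives a and b entries in R at every index.\<close>
          define cut :: "(nat \<Rightarrow> 'a) \<Rightarrow> nat \<Rightarrow> 'a" where "cut v i = (if i < m then v i else 0)" for v i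
          have cut_eq: "cut v i = v i" if "i < m" for v i using that by (simp add: cut_def)
          have cut_vecs: "cut v \<in> vecs m" for v by (simp add: cut_def vecs_def)
          have cut_dot: "(\<Sum>i<m. cut u i * cut v i) = (\<Sum>i<m. u i * v i)" for u v
            by (intro sum.cong) (simp_all add: cut_eq)
          have colpq: "cut p0 \<in> column_space" "cut q0 \<in> column_space"
            by (rule column_space_combination[OF col, of _ A B], simp only: cut_eq p0)
              (rule column_space_combination[OF col, of _ C D], simp only: cut_eq q0)
          have dual: "dual_pair m (cut p0) (cut q0) (cut a0) (cut b0)"
            by (simp add: dual_pair_def cut_dot dots)
          have UV': "H i = mConst (b i) + mConst (cut p0 i) * (mConst A' * U + mConst C' * V)
              + mConst (cut q0 i) * (mConst B' * U + mConst D' * V)" if "i < m" for i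
            unfolding UV[OF that] cut_eq[OF that] \<gamma>[of i] \<delta>[of i]
            by (simp only: mConst_add mConst_mult ring_distribs ac_simps)
          have in_R: "cut a0 i \<in> R" "cut b0 i \<in> R" for i using inR zero_in by (simp_all add: cut_def)
          have pqR: "\<forall>i<m. cut p0 i \<in> R \<and> cut q0 i \<in> R" using inR by (simp add: cut_def)
          have rank: "vec_space.rank m (mat_of_cols m [vec m (cut p0), vec m (cut q0)]) = r"
            unfolding r2
          proof (rule rank_two_cols)
            fix k l assume kl: "\<And>i. i < m \<Longrightarrow> k * cut p0 i + l * cut q0 i = 0"
            have "(\<Sum>i<m. c i * (k * cut p0 i + l * cut q0 i)) = k * (\<Sum>i<m. c i * p0 i) + l * (\<Sum>i<m. c i * q0 i)" for c
              unfolding sum_distrib_left sum.distrib[symmetric]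
              by (intro sum.cong) (simp_all add: cut_eq algebra_simps)
            moreover have "(\<Sum>i<m. c i * (k * cut p0 i + l * cut q0 i)) = 0" for c
              by (intro sum.neutral) (simp add: kl)
            ultimately have "k * (\<Sum>i<m. c i * p0 i) + l * (\<Sum>i<m. c i * q0 i) = 0" for c by simp
            from this[of a0] this[of b0] show "k = 0 \<and> l = 0" by (simp add: dots)
          qed
          obtain g where g: "g \<in> polys_in 2 \<inter> coeffs_in R" "h = msubst (?s (cut p0) (cut q0)) g + lin_form m b"
            using rank2_potential[OF subring hR bR in_R UV' dual] by blast
          have plane: "dense_plane m H b (cut p0) (cut q0) (cut a0) (cut b0)"
            by (rule dense_planeI[OF b cut_vecs cut_vecs UV' colpq dual])
          show ?thesis
            by (intro bexI[OF _ g(1)] bexI[OF _ cut_vecs[of p0]] bexI[OF _ cut_vecs[of q0]] conjI[OF pqR]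
                conjI[OF rank] conjI[OF g(2)] exI) (rule plane)
        qed
      qed
    qed
    then obtain g p q c d where g: "g \<in> polys_in 2 \<inter> coeffs_in R" and p: "p \<in> vecs m" and q: "q \<in> vecs m"
      and pq: "\<forall>i<m. p i \<in> R \<and> q i \<in> R"
      and rank: "vec_space.rank m (mat_of_cols m [vec m p, vec m q]) = r"
      and h: "h = msubst (?s p q) g + lin_form m b" and plane: "dense_plane m H b p q c d" by blast
    interpret dense_plane m H b p q c d by (rule plane)
    have iffs: "(msubst H f = 0 \<longleftrightarrow>
          msubst (\<lambda>i. mVar m * mConst (p i) + mVar (Suc m) * mConst (q i)
            + (1 - mVar (Suc (Suc m))) * H i + mVar (Suc (Suc m)) * mConst (b i)) f = 0) \<and>
        (msubst H f = 0 \<longleftrightarrow>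
          msubst (\<lambda>i. mVar m * mConst (p i) + mVar (Suc m) * mConst (q i) + mConst (b i)) f = 0)"
      if f: "f \<in> polys_in m" for f
    proof
      have "\<exists>x. meval x (mVar (Suc (Suc m))) = (1 :: 'a) \<and>
          (\<forall>i<m. meval x (mVar m) * p i + meval x (mVar (Suc m)) * q i = l * p i + n * q i)" for l n
        by (rule exI[of _ "\<lambda>k. if k = m then l else if k = Suc m then n else 1"]) simp
      from relation_join[OF f this] show "msubst H f = 0 \<longleftrightarrow>
          msubst (\<lambda>i. mVar m * mConst (p i) + mVar (Suc m) * mConst (q i)
            + (1 - mVar (Suc (Suc m))) * H i + mVar (Suc (Suc m)) * mConst (b i)) f = 0" .
      have "\<exists>x. \<forall>i<m. meval x (mVar m) * p i + meval x (mVar (Suc m)) * q i = l * p i + n * q i" for l n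
        by (rule exI[of _ "\<lambda>k. if k = m then l else n"]) simp
      from relation_param[OF f this] show "msubst H f = 0 \<longleftrightarrow>
          msubst (\<lambda>i. mVar m * mConst (p i) + mVar (Suc m) * mConst (q i) + mConst (b i)) f = 0" .
    qed
    show ?case
      by (intro bexI[OF _ g] bexI[OF _ p] bexI[OF _ q] conjI[OF pq] conjI[OF rank] conjI[OF h]
          conjI[OF zariski_closure_eq] conjI[OF apices_eq] ballI iffs)
  qed
qed

end
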